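(* Let $\mathcal H$ be a separable complex Hilbert space, let $H_0$ be a closed operator in $\mathcal H$ with $\rho(H_0)\neq\emptyset$, and let $V$ be a linear operator in $\mathcal H$ with $\operatorname{dom}(V)\supseteq\operatorname{dom}(H_0)$. Let $H=H_0+V$, $\operatorname{dom}(H)=\operatorname{dom}(H_0)$, and suppose that $\rho(H)\neq\emptyset$. Suppose further that $$K(z)=-V(H_0-zI_{\mathcal H})^{-1}\in\mathcal B(\mathcal H)\quad\text{for some (and hence for all) } z\in\rho(H_0).$$ Let $z_0\in\rho(H_0)\cap\sigma(H)$ be such that $D(z_0;\varepsilon_0)\backslash\{z_0\}\subset\rho(H_0)\cap\rho(H)$ for some $\varepsilon_0>0$, and suppose that $I_{\mathcal H}-K(z_0)$ is a Fredholm operator. Then $z_0$ is a discrete eigenvalue of $H$, that is, $z_0\in\sigma_d(H)$, and for $0<\varepsilon<\varepsilon_0$, $$m_a(z_0;H)=m_a(z_0;I_{\mathcal H}-K(\cdot))=\operatorname{ind}_{\partial D(z_0;\varepsilon)}(I_{\mathcal H}-K(\cdot)).$$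
   Context: $D(z_0;r)$ is the open disk of center $z_0$ and radius $r$; $\partial D(z_0;r)$ is its boundary circle, oriented counterclockwise. $\mathcal B(\mathcal H)$ denotes the bounded operators on $\mathcal H$. For a closed operator $A$ and an isolated point $\lambda_0$ of $\sigma(A)$, the Riesz projection is $P(\lambda_0;A)=\frac{-1}{2\pi i}\oint_{\partial D(\lambda_0;\varepsilon)}(A-\zeta I)^{-1}\,d\zeta$ with $\varepsilon>0$ small enough to exclude the rest of $\sigma(A)$. The discrete spectrum $\sigma_d(A)$ is the set of eigenvalues $\lambda$ of $A$ that are isolated points of $\sigma(A)$ with $\dim\operatorname{ran}P(\lambda;A)<\infty$; its elements are called discrete eigenvalues. For $\lambda\in\sigma_d(A)$ the algebraic multiplicity is $m_a(\lambda;A)=\dim\operatorname{ran}P(\lambda;A)$. Algebraic multiplicity of a zero of an analytic function: let $M(\cdot)$ be a $\mathcal B(\mathcal H)$-valued function analytic near $z_0$. Let $\mathcal N(z_0;M(\cdot))$ be the vector space of all functions $\phi(z)=\sum_{j=0}^{k-1}(z-z_0)^{-(k-j)}\varphi_j$, with $k\in\mathbb N$ and $\varphi_0,\dots,\varphi_{k-1}\in\mathcal H$, such that $M(z)\phi(z)=O(1)$ in norm as $z\to z_0$ (including $\phi=0$). Then $m_a(z_0;M(\cdot))=\dim\mathcal N(z_0;M(\cdot))$. For $\varphi_0\ne0$ the condition on $\phi$ says exactly that $\{\varphi_0,\dots,\varphi_{k-1}\}$ is a Jordan chain of $M(\cdot)$ at $z_0$, i.e. $\sum_{\ell=0}^j\frac1{\ell!}M^{(\ell)}(z_0)\varphi_{j-\ell}=0$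 for $j=0,\dots,k-1$. Index: for $M(\cdot)$ analytic on $D(z_0;\varepsilon_0)$ with values in $\mathcal B(\mathcal H)$, $M(z_0)$ Fredholm, and $M(z)$ boundedly invertible for $0<|z-z_0|<\varepsilon_0$, $\operatorname{ind}_{\partial D(z_0;\varepsilon)}(M(\cdot))=\operatorname{tr}_{\mathcal H}\Big(\frac1{2\pi i}\oint_{\partial D(z_0;\varepsilon)}M'(\zeta)M(\zeta)^{-1}\,d\zeta\Big)=\operatorname{tr}_{\mathcal H}\Big(\frac1{2\pi i}\oint_{\partial D(z_0;\varepsilon)}M(\zeta)^{-1}M'(\zeta)\,d\zeta\Big)$, $0<\varepsilon<\varepsilon_0$ (the contour integrals are finite-rank operators). *)

theory Defs
  imports
    "HOL-Complex_Analysis.Complex_Analysis"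
    "HOL-Library.Function_Algebras"
    "HOL-Library.Landau_Symbols"
    "HOL-Library.Extended_Nat"
begin

section \<open>Complex vector spaces and Hilbert spaces\<close>

class scaleC =
  fixes scaleC :: "complex \<Rightarrow> 'a \<Rightarrow> 'a"  (infixr \<open>*\<^sub>C\<close> 75)

class complex_vector = scaleC + ab_group_add +
  assumes scaleC_add_right: "a *\<^sub>C (x + y) = a *\<^sub>C x + a *\<^sub>C y"
    and scaleC_add_left: "(a + b) *\<^sub>C x = a *\<^sub>C x + b *\<^sub>C x"
    and scaleC_scaleC: "a *\<^sub>C b *\<^sub>C x = (a * b) *\<^sub>C x"
    and scaleC_one: "1 *\<^sub>C x = x"

global_interpretation complex_vector:
  vector_space "scaleC :: complex \<Rightarrow> 'a \<Rightarrow> 'a::complex_vector"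
  by unfold_locales
    (simp_all add: scaleC_add_right scaleC_add_left scaleC_scaleC scaleC_one)

class complex_normed_vector = complex_vector + real_normed_vector +
  assumes scaleR_scaleC: "scaleR r x = complex_of_real r *\<^sub>C x"
    and norm_scaleC: "norm (a *\<^sub>C x) = cmod a * norm x"

text \<open>The inner product is linear in the second argument. The triangle inequality, already part
  of \<^class>\<open>real_normed_vector\<close>, is redundant here.\<close>

class complex_hilbert_space = complex_normed_vector + complete_space +
  fixes cinner :: "'a \<Rightarrow> 'a \<Rightarrow> complex"
  assumes cinner_commute: "cinner x y = cnj (cinner y x)"
    and cinner_add_right: "cinner x (y + z) = cinner x y + cinner x z"
    and cinner_scaleC_right: "cinner x (a *\<^sub>C y) = a * cinner x y"
    and cinner_norm: "cinner x x = complex_of_real ((norm x)\<^sup>2)"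

subclass (in complex_hilbert_space) banach ..

instantiation complex :: complex_hilbert_space
begin

definition scaleC_complex :: "complex \<Rightarrow> complex \<Rightarrow> complex" where
  "scaleC_complex a x = a * x"

definition cinner_complex :: "complex \<Rightarrow> complex \<Rightarrow> complex" where
  "cinner_complex x y = cnj x * y"

instance
proof
  fix x :: complex
  show "cinner x x = complex_of_real ((norm x)\<^sup>2)"
    unfolding cinner_complex_def
    by (metis complex_norm_square mult.commute)
qed (simp_all add: scaleC_complex_def cinner_complex_def algebra_simps norm_mult scaleR_conv_of_real)

end

instantiation "fun" :: (type, complex_vector) complex_vector
begin

definition scaleC_fun :: "complex \<Rightarrow> ('a \<Rightarrow> 'b) \<Rightarrow> 'a \<Rightarrow> 'b" where
  "scaleC_fun c f = (\<lambda>x. c *\<^sub>C f x)"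

instance
  by standard
    (simp_all add: scaleC_fun_def fun_eq_iff scaleC_add_right scaleC_add_left scaleC_scaleC scaleC_one)

end

lemma bounded_linear_scaleC_right: "bounded_linear (\<lambda>x::'a::complex_normed_vector. c *\<^sub>C x)"
proof (rule bounded_linear_intro[where K = "cmod c"])
  show "c *\<^sub>C (r *\<^sub>R x) = r *\<^sub>R (c *\<^sub>C x)" for r and x :: 'a
    by (simp add: scaleR_scaleC mult.commute)
qed (simp_all add: scaleC_add_right norm_scaleC mult.commute)

instantiation blinfun :: (real_normed_vector, complex_normed_vector) complex_normed_vector
begin

lift_definition scaleC_blinfun :: "complex \<Rightarrow> 'a \<Rightarrow>\<^sub>L 'b \<Rightarrow> 'a \<Rightarrow>\<^sub>L 'b"
  is "\<lambda>c f x. c *\<^sub>C f x"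
  by (rule bounded_linear_compose[OF bounded_linear_scaleC_right])

instance
proof
  fix a :: complex and T :: "'a \<Rightarrow>\<^sub>L 'b"
  show "norm (a *\<^sub>C T) = cmod a * norm T"
  proof transfer
    fix a :: complex and f :: "'a \<Rightarrow> 'b"
    assume f: "bounded_linear f"
    have "onorm (\<lambda>x. a *\<^sub>C f x) = onorm (\<lambda>x. cmod a *\<^sub>R f x)"
      by (simp add: onorm_def norm_scaleC)
    also have "\<dots> = cmod a * onorm f"
      using onorm_scaleR[OF f, of "cmod a"] by simp
    finally show "onorm (\<lambda>x. a *\<^sub>C f x) = cmod a * onorm f" .
  qed
qed (transfer, simp add: scaleC_add_right scaleC_add_left scaleC_scaleC scaleC_one scaleR_scaleC)+

end

definition cfinite_dim :: "'a::complex_vector set \<Rightarrow> bool" where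
  "cfinite_dim S \<longleftrightarrow> (\<exists>B. finite B \<and> S \<subseteq> complex_vector.span B)"

definition cdim :: "'a::complex_vector set \<Rightarrow> enat" where
  "cdim S = (if cfinite_dim S then enat (complex_vector.dim S) else \<infinity>)"

section \<open>Bounded operators\<close>

text \<open>The algebra of bounded operators on a complex space is represented inside the type of
  bounded real-linear maps \<^typ>\<open>'a \<Rightarrow>\<^sub>L 'a\<close>, whose norm is the operator norm; a raw function is
  a bounded operator if it satisfies the following predicate.\<close>

definition bounded_clinear :: "('a::complex_normed_vector \<Rightarrow> 'b::complex_normed_vector) \<Rightarrow> bool" where
  "bounded_clinear f \<longleftrightarrow> bounded_linear f \<and> (\<forall>c x. f (c *\<^sub>C x) = c *\<^sub>C f x)"

definition op_inverse :: "'a::complex_normed_vector \<Rightarrow>\<^sub>L 'a \<Rightarrow> 'a \<Rightarrow>\<^sub>L 'a" where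
  "op_inverse T = Blinfun (inv (blinfun_apply T))"

text \<open>The last conjunct says that the quotient by the range is finite-dimensional.\<close>

definition fredholm :: "'a::complex_normed_vector \<Rightarrow>\<^sub>L 'a \<Rightarrow> bool" where
  "fredholm T \<longleftrightarrow> bounded_clinear (blinfun_apply T)
     \<and> cfinite_dim {x. blinfun_apply T x = 0}
     \<and> closed (range (blinfun_apply T))
     \<and> (\<exists>B. finite B \<and> complex_vector.span (range (blinfun_apply T) \<union> B) = UNIV)"

definition orthonormal_basis :: "'a::complex_hilbert_space set \<Rightarrow> bool" where
  "orthonormal_basis B \<longleftrightarrow>
     (\<forall>x\<in>B. \<forall>y\<in>B. cinner x y = (if x = y then 1 else 0)) \<and> closure (complex_vector.span B) = UNIV"

definition has_trace :: "'a::complex_hilbert_space \<Rightarrow>\<^sub>L 'a \<Rightarrow> complex \<Rightarrow> bool" where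
  "has_trace T t \<longleftrightarrow>
     (\<forall>B. orthonormal_basis B \<longrightarrow> ((\<lambda>e. cinner e (blinfun_apply T e)) has_sum t) B)"

definition op_trace :: "'a::complex_hilbert_space \<Rightarrow>\<^sub>L 'a \<Rightarrow> complex" where
  "op_trace T = (THE t. has_trace T t)"

section \<open>Vector-valued functions of a complex variable\<close>

definition vec_deriv :: "(complex \<Rightarrow> 'a::complex_normed_vector) \<Rightarrow> complex \<Rightarrow> 'a" where
  "vec_deriv f z = Lim (at z) (\<lambda>w. (1 / (w - z)) *\<^sub>C (f w - f z))"

text \<open>This extends \<^const>\<open>contour_integral\<close> to functions with values in a complex normed space.\<close>

definition vec_contour_integral ::
  "(real \<Rightarrow> complex) \<Rightarrow> (complex \<Rightarrow> 'a::complex_normed_vector) \<Rightarrow> 'a" where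
  "vec_contour_integral g f =
     integral {0..1} (\<lambda>t. vector_derivative g (at t within {0..1}) *\<^sub>C f (g t))"

section \<open>Unbounded operators\<close>

text \<open>An operator is given by its domain \<open>D\<close> and a function \<open>A\<close>, whose values outside \<open>D\<close> are
  irrelevant. The domain need not be dense.\<close>

definition linear_operator :: "'a::complex_normed_vector set \<Rightarrow> ('a \<Rightarrow> 'a) \<Rightarrow> bool" where
  "linear_operator D A \<longleftrightarrow> complex_vector.subspace D
     \<and> (\<forall>x\<in>D. \<forall>y\<in>D. A (x + y) = A x + A y) \<and> (\<forall>c. \<forall>x\<in>D. A (c *\<^sub>C x) = c *\<^sub>C A x)"

definition closed_operator :: "'a::complex_normed_vector set \<Rightarrow> ('a \<Rightarrow> 'a) \<Rightarrow> bool" where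
  "closed_operator D A \<longleftrightarrow> linear_operator D A \<and> closed ((\<lambda>x. (x, A x)) ` D)"

definition resolvent_fun :: "'a::complex_normed_vector set \<Rightarrow> ('a \<Rightarrow> 'a) \<Rightarrow> complex \<Rightarrow> 'a \<Rightarrow> 'a" where
  "resolvent_fun D A z = inv_into D (\<lambda>x. A x - z *\<^sub>C x)"

definition resolvent_set :: "'a::complex_normed_vector set \<Rightarrow> ('a \<Rightarrow> 'a) \<Rightarrow> complex set" where
  "resolvent_set D A =
     {z. bij_betw (\<lambda>x. A x - z *\<^sub>C x) D UNIV \<and> bounded_clinear (resolvent_fun D A z)}"

definition spectrum :: "'a::complex_normed_vector set \<Rightarrow> ('a \<Rightarrow> 'a) \<Rightarrow> complex set" where
  "spectrum D A = - resolvent_set D A"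

definition resolvent :: "'a::complex_normed_vector set \<Rightarrow> ('a \<Rightarrow> 'a) \<Rightarrow> complex \<Rightarrow> 'a \<Rightarrow>\<^sub>L 'a" where
  "resolvent D A z = Blinfun (resolvent_fun D A z)"

text \<open>Meaningful for isolated points \<open>l\<close> of the spectrum; the value does not depend on the radius
  chosen.\<close>

definition riesz_projection ::
  "'a::complex_normed_vector set \<Rightarrow> ('a \<Rightarrow> 'a) \<Rightarrow> complex \<Rightarrow> 'a \<Rightarrow>\<^sub>L 'a" where
  "riesz_projection D A l =
     (let r = (SOME r. r > 0 \<and> cball l r \<inter> spectrum D A = {l})
      in (- 1 / (2 * of_real pi * \<i>)) *\<^sub>C vec_contour_integral (circlepath l r) (resolvent D A))"

definition op_alg_mult :: "'a::complex_normed_vector set \<Rightarrow> ('a \<Rightarrow> 'a) \<Rightarrow> complex \<Rightarrow> enat" where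
  "op_alg_mult D A l = cdim (range (blinfun_apply (riesz_projection D A l)))"

definition discrete_spectrum :: "'a::complex_normed_vector set \<Rightarrow> ('a \<Rightarrow> 'a) \<Rightarrow> complex set" where
  "discrete_spectrum D A =
     {l. (\<exists>x\<in>D. x \<noteq> 0 \<and> A x = l *\<^sub>C x) \<and> l isolated_in spectrum D A
       \<and> cfinite_dim (range (blinfun_apply (riesz_projection D A l)))}"

section \<open>Multiplicity of zeros and index of operator-valued functions\<close>

text \<open>The principal parts below are functions on the whole plane; division by zero makes each of
  them vanish at \<open>z\<^sub>0\<close>, a value the filter \<^term>\<open>at z\<^sub>0\<close> ignores.\<close>

definition zero_space ::
  "complex \<Rightarrow> (complex \<Rightarrow> 'a::complex_normed_vector \<Rightarrow>\<^sub>L 'a) \<Rightarrow> (complex \<Rightarrow> 'a) set" where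
  "zero_space z\<^sub>0 M =
     {\<phi>. (\<exists>k f. \<phi> = (\<lambda>z. \<Sum>j<k. (1 / (z - z\<^sub>0) ^ (k - j)) *\<^sub>C f j))
       \<and> (\<lambda>z. norm (blinfun_apply (M z) (\<phi> z))) \<in> O[at z\<^sub>0](\<lambda>_. 1)}"

definition fun_alg_mult ::
  "complex \<Rightarrow> (complex \<Rightarrow> 'a::complex_normed_vector \<Rightarrow>\<^sub>L 'a) \<Rightarrow> enat" where
  "fun_alg_mult z\<^sub>0 M = cdim (zero_space z\<^sub>0 M)"

definition op_index ::
  "complex \<Rightarrow> real \<Rightarrow> (complex \<Rightarrow> 'a::complex_hilbert_space \<Rightarrow>\<^sub>L 'a) \<Rightarrow> complex" where
  "op_index z\<^sub>0 r M =
     op_trace ((1 / (2 * of_real pi * \<i>)) *\<^sub>C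
       vec_contour_integral (circlepath z\<^sub>0 r) (\<lambda>\<zeta>. vec_deriv M \<zeta> o\<^sub>L op_inverse (M \<zeta>)))"

section \<open>The Birman--Schwinger operator\<close>

definition birman_schwinger_fun ::
  "'a::complex_normed_vector set \<Rightarrow> ('a \<Rightarrow> 'a) \<Rightarrow> ('a \<Rightarrow> 'a) \<Rightarrow> complex \<Rightarrow> 'a \<Rightarrow> 'a" where
  "birman_schwinger_fun D H\<^sub>0 V z = (\<lambda>x. - V (resolvent_fun D H\<^sub>0 z x))"

definition birman_schwinger ::
  "'a::complex_normed_vector set \<Rightarrow> ('a \<Rightarrow> 'a) \<Rightarrow> ('a \<Rightarrow> 'a) \<Rightarrow> complex \<Rightarrow> 'a \<Rightarrow>\<^sub>L 'a" where
  "birman_schwinger D H\<^sub>0 V z = Blinfun (birman_schwinger_fun D H\<^sub>0 V z)"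

end

theory Submission
  imports Defs "Jordan_Normal_Form.Determinant"
begin

text \<open>
  Write \<open>R0(z) = (H0 - z)\<^sup>-\<^sup>1\<close>, \<open>R(z) = (H - z)\<^sup>-\<^sup>1\<close> and \<open>M(z) = I - K(z) = I + V R0(z)\<close>. Everything rests on
  the factorization \<open>H - z = M(z) (H0 - z)\<close>, that is, \<open>R(z) = R0(z) M(z)\<^sup>-\<^sup>1\<close> wherever both resolvents
  exist.

  Since \<open>M(z0)\<close> is Fredholm and \<open>M(z)\<close> is invertible for \<open>z \<noteq> z0\<close>, the inverse \<open>M(z)\<^sup>-\<^sup>1\<close> grows at most
  like a power of \<open>1 / |z - z0|\<close> (\<open>analytic_fredholm_inverse_bound\<close>). A parametrix \<open>T\<close> of \<open>M(z0)\<close> makes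
  \<open>T M(z)\<close> a finite-rank perturbation of an analytically invertible operator; its inverse is governed by
  a determinant that is analytic in \<open>z\<close> and does not vanish off \<open>z0\<close>. That \<open>T\<close> can be
  chosen invertible, i.e. that the index is zero, also follows from this determinant, because a
  square matrix is injective iff it is surjective. So \<open>R\<close> has a pole, of some order at most \<open>p\<close>, at
  \<open>z0\<close>.

  For a pole the Laurent coefficients satisfy a simple algebra (locale \<open>isolated_pole\<close>): with
  \<open>A\<^sub>l = - (2 \<pi> \<i>)\<^sup>-\<^sup>1 \<integral> (z - z0)\<^sup>l R(z) dz\<close> one has \<open>(H - z0) A\<^sub>l = A\<^sub>l\<^sub>+\<^sub>1\<close> and \<open>A\<^sub>p = 0\<close>, whereas
  \<open>A\<^sub>l \<psi>\<^sub>0 = \<psi>\<^sub>l\<close> for every finite Jordan sequence \<open>\<psi>\<close> of \<open>H\<close>. Hence the Riesz projection \<open>A\<^sub>0\<close> is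
  the projection onto the space \<open>E\<close> of generalized eigenvectors, which is finite-dimensional because
  \<open>ker (H - z0) = R0(z0) ker M(z0)\<close> is.

  For the zeros of \<open>M\<close>: if \<open>x \<in> E\<close>, then \<open>V R(z) x\<close> is a principal part, and \<open>M\<close> maps it to the bounded
  function \<open>- K(z) x\<close>. Conversely, expanding \<open>R0(z) \<phi>(z)\<close> for a zero \<open>\<phi>\<close> of \<open>M\<close> yields a Jordan sequence
  of \<open>H\<close> from which \<open>\<phi>\<close> arises in this way. So \<open>E\<close> is isomorphic to the space of zeros
  (\<open>fun_alg_mult_eq\<close>).

  For the index: \<open>M' M\<^sup>-\<^sup>1 = - K R\<close>, and its residue \<open>S\<close> satisfies \<open>S = S A\<^sub>0\<close>. The compression of \<open>S\<close> to
  \<open>E\<close> is the identity plus a commutator of operators on \<open>E\<close> (\<open>compressed_residue\<close>), so its trace is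
  \<open>dim E\<close> (\<open>op_index_eq\<close>).
\<close>

abbreviation cspan :: "'a::complex_vector set \<Rightarrow> 'a set" where
  "cspan \<equiv> complex_vector.span"

section \<open>Bounded complex-linear maps and the inner product\<close>

lemma scaleC_zero_left [simp]: "0 *\<^sub>C (x::'a::complex_vector) = 0"
  by (rule complex_vector.scale_zero_left)

lemma scaleC_zero_right [simp]: "c *\<^sub>C (0::'a::complex_vector) = 0"
  by (rule complex_vector.scale_zero_right)

lemma scaleC_minus_left [simp]: "(- c) *\<^sub>C (x::'a::complex_vector) = - (c *\<^sub>C x)"
  by (rule complex_vector.scale_minus_left)

lemma scaleC_minus_right [simp]: "c *\<^sub>C (- x::'a::complex_vector) = - (c *\<^sub>C x)"
  by (rule complex_vector.scale_minus_right)

lemma scaleC_diff_right: "c *\<^sub>C (x - y::'a::complex_vector) = c *\<^sub>C x - c *\<^sub>C y"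
  by (rule complex_vector.scale_right_diff_distrib)

lemma scaleC_diff_left: "(a - b) *\<^sub>C (x::'a::complex_vector) = a *\<^sub>C x - b *\<^sub>C x"
  by (rule complex_vector.scale_left_diff_distrib)

lemma scaleC_sum_right: "c *\<^sub>C (\<Sum>i\<in>A. f i::'a::complex_vector) = (\<Sum>i\<in>A. c *\<^sub>C f i)"
  by (rule complex_vector.scale_sum_right)

declare scaleC_one [simp] scaleC_scaleC [simp]

lemma scaleC_complex [simp]: "a *\<^sub>C (b::complex) = a * b"
  by (simp add: scaleC_complex_def)

lemma clinear_bounded_linear: "bounded_clinear f \<Longrightarrow> bounded_linear f"
  and clinear_scaleC: "bounded_clinear f \<Longrightarrow> f (c *\<^sub>C x) = c *\<^sub>C f x"
  by (auto simp: bounded_clinear_def)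

lemma clinear_add: "bounded_clinear f \<Longrightarrow> f (x + y) = f x + f y"
  and clinear_diff: "bounded_clinear f \<Longrightarrow> f (x - y) = f x - f y"
  and clinear_zero: "bounded_clinear f \<Longrightarrow> f 0 = 0"
  and clinear_minus: "bounded_clinear f \<Longrightarrow> f (- x) = - f x"
  and clinear_sum: "bounded_clinear f \<Longrightarrow> f (\<Sum>i\<in>A. g i) = (\<Sum>i\<in>A. f (g i))"
  using linear_sum[OF bounded_linear.linear, of f g A]
  by (simp_all add: bounded_clinear_def bounded_linear.linear linear_add linear_diff linear_0 linear_neg)

lemmas clinear_simps =
  clinear_add clinear_diff clinear_scaleC clinear_zero
  clinear_minus clinear_sum

lemma bounded_clinearI:
  assumes "\<And>x y. f (x + y) = f x + f y" "\<And>c x. f (c *\<^sub>C x) = c *\<^sub>C f x"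
    and "\<And>x. norm (f x) \<le> norm x * C"
  shows "bounded_clinear f"
  unfolding bounded_clinear_def using assms
  by (auto intro!: bounded_linear_intro[where K = C] simp: scaleR_scaleC)

lemma clinear_compose:
  "bounded_clinear f \<Longrightarrow> bounded_clinear g \<Longrightarrow> bounded_clinear (\<lambda>x. f (g x))"
  by (auto simp: bounded_clinear_def intro: bounded_linear_compose)

lemma clinear_ident: "bounded_clinear (\<lambda>x. x)"
  by (auto simp: bounded_clinear_def)

lemma clinear_const_zero: "bounded_clinear (\<lambda>x. 0)"
  by (auto simp: bounded_clinear_def)

lemma clinear_plus:
  "bounded_clinear f \<Longrightarrow> bounded_clinear g \<Longrightarrow> bounded_clinear (\<lambda>x. f x + g x)"
  by (auto simp: bounded_clinear_def bounded_linear_add scaleC_add_right)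

lemma clinear_minus_fun:
  "bounded_clinear f \<Longrightarrow> bounded_clinear g \<Longrightarrow> bounded_clinear (\<lambda>x. f x - g x)"
  by (auto simp: bounded_clinear_def bounded_linear_sub scaleC_diff_right)

lemma clinear_scaleC_fun:
  "bounded_clinear f \<Longrightarrow> bounded_clinear (\<lambda>x. c *\<^sub>C f x)"
  by (auto simp: bounded_clinear_def mult.commute intro: bounded_linear_compose[OF bounded_linear_scaleC_right])

lemma clinear_sum_fun:
  "(\<And>i. i \<in> A \<Longrightarrow> bounded_clinear (f i)) \<Longrightarrow> bounded_clinear (\<lambda>x. \<Sum>i\<in>A. f i x)"
  by (induction A rule: infinite_finite_induct)
    (auto intro!: clinear_plus clinear_const_zero)

lemma bounded_bilinear_scaleC: "bounded_bilinear (\<lambda>(a::complex) (b::'b::complex_normed_vector). a *\<^sub>C b)"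
proof (rule bounded_bilinear.intro)
  show "\<exists>K. \<forall>a b. norm ((a::complex) *\<^sub>C (b::'b)) \<le> norm a * norm b * K"
    by (intro exI[of _ 1]) (simp add: norm_scaleC)
qed (simp_all add: scaleC_add_left scaleC_add_right scaleR_scaleC scaleR_conv_of_real mult.commute)

lemma bounded_linear_scaleC_left: "bounded_linear (\<lambda>c. c *\<^sub>C (u::'a::complex_normed_vector))"
  by (rule bounded_linear_intro[where K = "norm u"])
    (simp_all add: scaleC_add_left norm_scaleC scaleR_scaleC scaleR_conv_of_real)

lemma clinear_scaleC_const:
  "bounded_clinear f \<Longrightarrow> bounded_clinear (\<lambda>x. f x *\<^sub>C (u::'a::complex_normed_vector))"
  by (auto simp: bounded_clinear_def intro: bounded_linear_compose[OF bounded_linear_scaleC_left])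

lemma blinfun_apply_Blinfun_clinear:
  "bounded_clinear f \<Longrightarrow> blinfun_apply (Blinfun f) = f"
  by (simp add: bounded_clinear_def bounded_linear_Blinfun_apply)

lemma norm_bounded_clinear_bound:
  assumes "bounded_clinear f" obtains C where "C > 0" "\<And>x. norm (f x) \<le> C * norm x"
  using bounded_linear.pos_bounded[OF clinear_bounded_linear[OF assms]]
  by (auto simp: mult.commute)

lemma blinfun_apply_scaleC [simp]: "blinfun_apply (c *\<^sub>C T) x = c *\<^sub>C blinfun_apply T x"
  by (rule scaleC_blinfun.rep_eq[THEN fun_cong])

lemma cinner_zero_right [simp]: "cinner x (0::'a::complex_hilbert_space) = 0"
  by (metis add_cancel_right_right cinner_add_right)

lemma cinner_minus_right [simp]: "cinner x (- y) = - cinner x (y::'a::complex_hilbert_space)"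
  by (metis add.right_inverse add_eq_0_iff cinner_add_right cinner_zero_right)

lemma cinner_diff_right: "cinner x (y - z) = cinner x y - cinner x (z::'a::complex_hilbert_space)"
  by (metis cinner_add_right cinner_minus_right diff_conv_add_uminus)

lemma cinner_add_left: "cinner (x + y) z = cinner x z + cinner y (z::'a::complex_hilbert_space)"
  by (metis cinner_add_right cinner_commute complex_cnj_add)

lemma cinner_scaleC_left: "cinner (a *\<^sub>C x) y = cnj a * cinner x (y::'a::complex_hilbert_space)"
  by (metis cinner_commute cinner_scaleC_right complex_cnj_mult)

lemma cinner_zero_left [simp]: "cinner (0::'a::complex_hilbert_space) x = 0"
  by (metis cinner_commute cinner_zero_right complex_cnj_zero)

lemma cinner_minus_left [simp]: "cinner (- x) y = - cinner x (y::'a::complex_hilbert_space)"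
  by (metis cinner_commute cinner_minus_right complex_cnj_minus)

lemma cinner_sum_right:
  "cinner x (\<Sum>i\<in>A. f i) = (\<Sum>i\<in>A. cinner x (f i::'a::complex_hilbert_space))"
  by (induction A rule: infinite_finite_induct) (auto simp: cinner_add_right)

lemma norm_add_cinner:
  "(norm (x + y))\<^sup>2 = (norm x)\<^sup>2 + (norm y)\<^sup>2 + 2 * Re (cinner x (y::'a::complex_hilbert_space))"
proof -
  have "cinner (x + y) (x + y) = cinner x x + cinner y y + (cinner x y + cnj (cinner x y))"
    by (simp add: cinner_add_left cinner_add_right cinner_commute[of y x])
  hence "complex_of_real ((norm (x + y))\<^sup>2)
      = complex_of_real ((norm x)\<^sup>2 + (norm y)\<^sup>2 + 2 * Re (cinner x y))"
    by (simp add: cinner_norm complex_add_cnj)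
  thus ?thesis using of_real_eq_iff by blast
qed

lemma norm_add_orthogonal:
  "cinner x (y::'a::complex_hilbert_space) = 0 \<Longrightarrow> (norm (x + y))\<^sup>2 = (norm x)\<^sup>2 + (norm y)\<^sup>2"
  by (simp add: norm_add_cinner)

lemma cinner_self_eq_0: "cinner x x = 0 \<longleftrightarrow> x = (0::'a::complex_hilbert_space)"
  by (simp add: cinner_norm)

lemma cauchy_schwarz: "cmod (cinner x y) \<le> norm x * norm (y::'a::complex_hilbert_space)"
proof (cases "x = 0")
  case False
  define a where "a = cinner x y / cinner x x"
  define w where "w = y - a *\<^sub>C x"
  have nz: "cinner x x \<noteq> 0" using False by (simp add: cinner_self_eq_0)
  have "cinner x w = 0"
    using nz by (simp add: w_def a_def cinner_diff_right cinner_scaleC_right)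
  hence "cinner (a *\<^sub>C x) w = 0" by (simp add: cinner_scaleC_left)
  hence "(norm y)\<^sup>2 = (norm (a *\<^sub>C x))\<^sup>2 + (norm w)\<^sup>2"
    using norm_add_orthogonal[of "a *\<^sub>C x" w] by (simp add: w_def)
  hence "norm (a *\<^sub>C x) \<le> norm y"
    by (metis le_add_same_cancel1 norm_ge_zero power2_le_imp_le zero_le_power2)
  hence "cmod (cinner x y) / (norm x)\<^sup>2 * norm x \<le> norm y"
    by (simp add: a_def norm_scaleC norm_divide cinner_norm norm_power)
  thus ?thesis using False by (simp add: field_simps power2_eq_square)
qed simp

lemma clinear_cinner: "bounded_clinear (cinner (x::'a::complex_hilbert_space))"
  by (rule bounded_clinearI[where C = "norm x"])
    (use cauchy_schwarz[of x] in \<open>simp_all add: cinner_add_right cinner_scaleC_right mult.commute[of _ "norm x"]\<close>)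

lemma blinfun_eq_cinnerI:
  fixes S T :: "'b::real_normed_vector \<Rightarrow>\<^sub>L 'a::complex_hilbert_space"
  assumes "\<And>x y. cinner y (S x) = cinner y (T x)"
  shows "S = T"
proof (rule blinfun_eqI)
  fix x
  have "cinner (S x - T x) (S x - T x) = 0"
    by (simp only: cinner_diff_right assms diff_self)
  thus "S x = T x" by (simp add: cinner_self_eq_0)
qed

section \<open>Orthonormal families and the trace\<close>

text \<open>Finite families are indexed by an initial segment of the natural numbers because the
  same indices number the rows and columns of matrices below.\<close>

definition orthonormal_family :: "nat \<Rightarrow> (nat \<Rightarrow> 'a::complex_hilbert_space) \<Rightarrow> bool" where
  "orthonormal_family n u \<longleftrightarrow> (\<forall>i<n. \<forall>j<n. cinner (u i) (u j) = (if i = j then 1 else 0))"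

definition orthonormal_set :: "'a::complex_hilbert_space set \<Rightarrow> bool" where
  "orthonormal_set B \<longleftrightarrow> (\<forall>x\<in>B. \<forall>y\<in>B. cinner x y = (if x = y then 1 else 0))"

lemma orthonormal_family_cinner:
  "orthonormal_family n u \<Longrightarrow> i < n \<Longrightarrow> j < n \<Longrightarrow> cinner (u i) (u j) = (if i = j then 1 else 0)"
  by (auto simp: orthonormal_family_def)

lemma orthonormal_family_coeff:
  assumes "orthonormal_family n u" "i < n" "m \<le> n"
  shows "cinner (u i) (\<Sum>j<m. c j *\<^sub>C u j) = (if i < m then c i else 0)"
proof -
  have "cinner (u i) (\<Sum>j<m. c j *\<^sub>C u j) = (\<Sum>j<m. if j = i then c i else 0)"
    unfolding cinner_sum_right cinner_scaleC_right
    by (rule sum.cong) (use assms in \<open>auto simp: orthonormal_family_cinner\<close>)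
  thus ?thesis by simp
qed

lemma orthonormal_set_sum:
  assumes "orthonormal_set B" "finite F" "F \<subseteq> B" "e \<in> F"
  shows "cinner e (\<Sum>f\<in>F. c f *\<^sub>C f) = c e"
proof -
  have "cinner e (\<Sum>f\<in>F. c f *\<^sub>C f) = (\<Sum>f\<in>F. if f = e then c e else 0)"
    unfolding cinner_sum_right cinner_scaleC_right
    by (rule sum.cong) (use assms in \<open>auto simp: orthonormal_set_def subset_iff\<close>)
  thus ?thesis using assms by simp
qed

text \<open>One step of the Gram--Schmidt procedure, for sets: the vector adjoined lies in the span of
  the old ones and \<open>x\<close>, which keeps the procedure inside any prescribed subspace.\<close>

lemma gram_schmidt_step:
  assumes "orthonormal_set (U::'a::complex_hilbert_space set)" "finite U"
  obtains U' where "orthonormal_set U'" "finite U'" "U \<subseteq> U'" "x \<in> cspan U'"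
    "U' \<subseteq> cspan (insert x U)"
proof -
  define p where "p = (\<Sum>f\<in>U. cinner f x *\<^sub>C f)"
  define w where "w = x - p"
  have orth: "cinner e w = 0" if "e \<in> U" for e
    using orthonormal_set_sum[OF assms(1,2) subset_refl that] by (simp add: w_def p_def cinner_diff_right)
  have pU: "p \<in> cspan U"
    unfolding p_def by (intro complex_vector.span_sum complex_vector.span_scale complex_vector.span_base)
  show thesis
  proof (cases "w = 0")
    case True
    show thesis
    proof (rule that[OF assms(1,2) subset_refl])
      show "x \<in> cspan U" using True pU by (simp add: w_def)
      show "U \<subseteq> cspan (insert x U)"
        by (meson complex_vector.span_base insertI2 subsetI)
    qed
  next
    case False
    define v where "v = complex_of_real (1 / norm w) *\<^sub>C w"
    have vv: "cinner v v = 1"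
      using False by (simp add: v_def norm_scaleC norm_divide cinner_norm)
    have ev: "cinner e v = 0" if "e \<in> U" for e
      using orth[OF that] by (simp add: v_def cinner_scaleC_right)
    have ve: "cinner v e = 0" if "e \<in> U" for e
      by (metis cinner_commute complex_cnj_zero ev that)
    have wv: "w = complex_of_real (norm w) *\<^sub>C v" using False by (simp add: v_def flip: of_real_mult)
    show thesis
    proof (rule that[of "insert v U"])
      show "orthonormal_set (insert v U)"
        using assms(1) vv ev ve unfolding orthonormal_set_def by (metis insert_iff zero_neq_one)
      have "x = p + complex_of_real (norm w) *\<^sub>C v" using wv by (simp add: w_def)
      moreover have "p \<in> cspan (insert v U)"
        using pU complex_vector.span_mono[of U "insert v U"] by auto
      ultimately show "x \<in> cspan (insert v U)"
        by (metis complex_vector.span_add complex_vector.span_base complex_vector.span_scale insertI1)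
      have "p \<in> cspan (insert x U)"
        using pU complex_vector.span_mono[of U "insert x U"] by auto
      hence "v \<in> cspan (insert x U)" unfolding v_def w_def
        by (intro complex_vector.span_scale complex_vector.span_diff) (auto intro: complex_vector.span_base)
      thus "insert v U \<subseteq> cspan (insert x U)"
        by (auto intro: complex_vector.span_base)
    qed (use assms in auto)
  qed
qed

lemma orthonormal_spanning_set:
  assumes "finite (B::'a::complex_hilbert_space set)"
  obtains U where "orthonormal_set U" "finite U" "cspan U = cspan B"
  using assms
proof (induction B arbitrary: thesis)
  case empty
  show ?case by (rule empty(1)[of "{}"]) (auto simp: orthonormal_set_def)
next
  case (insert x B)
  obtain U where U: "orthonormal_set U" "finite U" "cspan U = cspan B"
    using insert.IH by blast
  obtain U' where U': "orthonormal_set U'" "finite U'" "U \<subseteq> U'" "x \<in> cspan U'"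
    "U' \<subseteq> cspan (insert x U)" using gram_schmidt_step[OF U(1,2)] by blast
  have eq: "cspan (insert x U) = cspan (insert x B)"
    using U(3) by (simp add: complex_vector.span_insert)
  have "insert x U \<subseteq> cspan U'"
    using U'(3,4) complex_vector.span_base by auto
  hence "cspan (insert x U) \<subseteq> cspan U'"
    using complex_vector.span_minimal[OF _ complex_vector.subspace_span] by blast
  moreover have "cspan U' \<subseteq> cspan (insert x U)"
    using U'(5) complex_vector.span_minimal[OF _ complex_vector.subspace_span] by blast
  ultimately show ?case using insert.prems[OF U'(1,2)] eq by auto
qed

lemma orthonormal_family_of_set:
  assumes "orthonormal_set U" "finite U"
  obtains n u where "orthonormal_family n u" "U = u ` {..<n}" "inj_on u {..<n}"
proof -
  obtain f n where f: "U = f ` {i::nat. i < n}" "inj_on f {i. i < n}"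
    using finite_imp_nat_seg_image_inj_on[OF assms(2)] by metis
  have "orthonormal_family n f"
    using assms(1) f unfolding orthonormal_family_def orthonormal_set_def inj_on_def by auto
  with f show thesis using that[of n f] by (auto simp: lessThan_def)
qed

lemma span_family:
  assumes "x \<in> cspan (u ` {..<n::nat})"
  obtains c where "x = (\<Sum>i<n. c i *\<^sub>C u i)"
  using assms
proof (induction arbitrary: thesis rule: complex_vector.span_induct_alt)
  case base
  show ?case by (rule base[of "\<lambda>_. 0"]) simp
next
  case (step a v y)
  obtain c where c: "y = (\<Sum>i<n. c i *\<^sub>C u i)" using step.IH by blast
  obtain j where j: "j < n" "v = u j" using step by auto
  have "a *\<^sub>C v = (\<Sum>i<n. (if i = j then a else 0) *\<^sub>C u i)"
    using j by (subst sum.mono_neutral_right[of "{..<n}" "{j}"]) auto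
  hence "a *\<^sub>C v + y = (\<Sum>i<n. ((if i = j then a else 0) + c i) *\<^sub>C u i)"
    by (simp add: c scaleC_add_left sum.distrib)
  thus ?case by (rule step.prems)
qed

lemma orthonormal_family_expansion:
  assumes "orthonormal_family n u" "x \<in> cspan (u ` {..<n})"
  shows "x = (\<Sum>i<n. cinner (u i) x *\<^sub>C u i)"
proof -
  obtain c where c: "x = (\<Sum>i<n. c i *\<^sub>C u i)" using span_family[OF assms(2)] .
  have "cinner (u i) x = c i" if "i < n" for i
    using orthonormal_family_coeff[OF assms(1) that order_refl, of c] c that by simp
  thus ?thesis using c by simp
qed

lemma cfinite_dim_orthonormal_family:
  assumes "cfinite_dim (S::'a::complex_hilbert_space set)" "complex_vector.subspace S"
  obtains n u where "orthonormal_family n u" "S = cspan (u ` {..<n})"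
proof -
  obtain B where B: "finite B" "S \<subseteq> cspan B" using assms(1) by (auto simp: cfinite_dim_def)
  obtain B' where B': "B' \<subseteq> S" "complex_vector.independent B'" "S \<subseteq> cspan B'"
    by (rule complex_vector.maximal_independent_subset)
  have "finite B'" using complex_vector.independent_span_bound[OF B(1) B'(2)] B' B by auto
  then obtain U where U: "orthonormal_set U" "finite U" "cspan U = cspan B'"
    using orthonormal_spanning_set by blast
  obtain n u where "orthonormal_family n u" "U = u ` {..<n}"
    using orthonormal_family_of_set[OF U(1,2)] by blast
  moreover have "cspan B' = S"
    using B' assms(2) complex_vector.span_minimal by blast
  ultimately show thesis using that U by metis
qed

lemma orthonormal_family_dim:
  assumes "orthonormal_family n u"
  shows "complex_vector.dim (cspan (u ` {..<n})) = n"
    and "complex_vector.independent (u ` {..<n})" and "inj_on u {..<n}"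
proof -
  show inj: "inj_on u {..<n}"
  proof (rule inj_onI)
    fix i j assume ij: "i \<in> {..<n}" "j \<in> {..<n}" "u i = u j"
    hence "cinner (u i) (u j) = 1" using orthonormal_family_cinner[OF assms, of i i] by simp
    thus "i = j" using orthonormal_family_cinner[OF assms, of i j] ij by (auto split: if_splits)
  qed
  show ind: "complex_vector.independent (u ` {..<n})"
  proof (rule complex_vector.independent_if_scalars_zero)
    fix f v assume s: "(\<Sum>x\<in>u ` {..<n}. f x *\<^sub>C x) = 0" and "v \<in> u ` {..<n}"
    then obtain i where i: "i < n" "v = u i" by auto
    have "(\<Sum>j<n. f (u j) *\<^sub>C u j) = 0" using s inj by (simp add: sum.reindex)
    thus "f v = 0" using orthonormal_family_coeff[OF assms i(1) order_refl, of "\<lambda>j. f (u j)"] i by simp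
  qed simp
  show "complex_vector.dim (cspan (u ` {..<n})) = n"
    using complex_vector.dim_eq_card_independent[OF ind] inj
    by (simp add: card_image complex_vector.dim_span)
qed

text \<open>Gram--Schmidt along a dense sequence; this is where separability enters.\<close>

lemma orthonormal_basis_exists:
  assumes "separable_space (euclidean :: 'a::complex_hilbert_space topology)"
  shows "\<exists>B::'a set. orthonormal_basis B"
proof -
  obtain C :: "'a set" where C: "countable C" "closure C = UNIV"
    using assms by (auto simp: separable_space_def)
  have "C \<noteq> {}" using C(2) by auto
  then obtain d where d: "C = range (d::nat \<Rightarrow> 'a)" using C(1) by (metis range_from_nat_into)
  define good where "good U \<longleftrightarrow> orthonormal_set U \<and> finite U" for U :: "'a set"
  define nxt where "nxt U x = (SOME U'. good U' \<and> U \<subseteq> U' \<and> x \<in> cspan U')" for U and x :: 'a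
  have nxt: "good (nxt U x) \<and> U \<subseteq> nxt U x \<and> x \<in> cspan (nxt U x)" if "good U" for U x
  proof -
    have "\<exists>U'. good U' \<and> U \<subseteq> U' \<and> x \<in> cspan U'"
      using gram_schmidt_step[of U x] that unfolding good_def by metis
    thus ?thesis unfolding nxt_def by (rule someI_ex)
  qed
  define Q where "Q = rec_nat {} (\<lambda>k U. nxt U (d k))"
  have Q0: "Q 0 = {}" and QS: "Q (Suc k) = nxt (Q k) (d k)" for k by (simp_all add: Q_def)
  have good: "good (Q k)" for k
    by (induction k) (auto simp: Q0 QS nxt, simp add: good_def orthonormal_set_def)
  have mono: "Q i \<subseteq> Q j" if "i \<le> j" for i j
    using that by (rule lift_Suc_mono_le[rotated]) (use nxt[OF good] QS in auto)
  define B where "B = (\<Union>k. Q k)"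
  have "cinner x y = (if x = y then 1 else 0)" if xy: "x \<in> B" "y \<in> B" for x y
  proof -
    obtain i j where "x \<in> Q i" "y \<in> Q j" using xy by (auto simp: B_def)
    hence "x \<in> Q (max i j)" "y \<in> Q (max i j)"
      using mono[of i "max i j"] mono[of j "max i j"] by auto
    thus ?thesis using good[of "max i j"] by (auto simp: good_def orthonormal_set_def)
  qed
  moreover have "C \<subseteq> cspan B"
  proof
    fix x assume "x \<in> C"
    then obtain k where "x = d k" using d by auto
    hence "x \<in> cspan (Q (Suc k))" using nxt[OF good] QS by metis
    thus "x \<in> cspan B" using complex_vector.span_mono[of "Q (Suc k)" B] by (auto simp: B_def)
  qed
  hence "closure (cspan B) = UNIV" using C(2) closure_mono by blast
  ultimately show ?thesis unfolding orthonormal_basis_def by blast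
qed

lemma orthonormal_set_best_approximation:
  assumes "orthonormal_set B" "finite F" "F \<subseteq> B" "v \<in> cspan F"
  shows "norm (x - (\<Sum>e\<in>F. cinner e x *\<^sub>C e)) \<le> norm (x - v)"
proof -
  define p where "p = (\<Sum>e\<in>F. cinner e x *\<^sub>C e)"
  have orth: "cinner e (x - p) = 0" if "e \<in> F" for e
    using orthonormal_set_sum[OF assms(1-3) that] by (simp add: p_def cinner_diff_right)
  have pv: "p - v \<in> cspan F" unfolding p_def
    by (intro complex_vector.span_diff complex_vector.span_sum complex_vector.span_scale
        complex_vector.span_base assms)
  have span0: "cinner w (x - p) = 0" if "w \<in> cspan F" for w
    using that by (induction rule: complex_vector.span_induct_alt)
      (auto simp: cinner_add_left cinner_scaleC_left orth)
  have "cinner (p - v) (x - p) = 0" using span0 pv by blast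
  hence "cinner (x - p) (p - v) = 0" by (metis cinner_commute complex_cnj_zero)
  hence "(norm (x - v))\<^sup>2 = (norm (x - p))\<^sup>2 + (norm (p - v))\<^sup>2"
    using norm_add_orthogonal[of "x - p" "p - v"] by simp
  hence "norm (x - p) \<le> norm (x - v)"
    by (metis le_add_same_cancel1 norm_ge_zero power2_le_imp_le zero_le_power2)
  thus ?thesis by (simp add: p_def)
qed

lemma orthonormal_basis_has_sum:
  assumes "orthonormal_basis (B::'a::complex_hilbert_space set)"
  shows "((\<lambda>e. cinner e x *\<^sub>C e) has_sum x) B"
  unfolding has_sum_def tendsto_iff eventually_finite_subsets_at_top
proof (intro allI impI)
  fix r :: real assume "r > 0"
  have B: "orthonormal_set B" "closure (cspan B) = UNIV"
    using assms by (auto simp: orthonormal_basis_def orthonormal_set_def)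
  obtain v where v: "v \<in> cspan B" "dist v x < r"
    using B(2) \<open>r > 0\<close> closure_approachable by (metis UNIV_I)
  obtain F where F: "finite F" "F \<subseteq> B" "v \<in> cspan F"
    using v(1) complex_vector.span_explicit[of B]
      complex_vector.span_sum[of _ _ ] unfolding complex_vector.span_explicit by blast
  show "\<exists>X. finite X \<and> X \<subseteq> B \<and> (\<forall>Y. finite Y \<and> X \<subseteq> Y \<and> Y \<subseteq> B \<longrightarrow>
      dist (\<Sum>e\<in>Y. cinner e x *\<^sub>C e) x < r)"
  proof (intro exI[of _ F] conjI allI impI F(1,2))
    fix Y assume Y: "finite Y \<and> F \<subseteq> Y \<and> Y \<subseteq> B"
    hence "v \<in> cspan Y" using F(3) complex_vector.span_mono by blast
    thus "dist (\<Sum>e\<in>Y. cinner e x *\<^sub>C e) x < r"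
      using orthonormal_set_best_approximation[OF B(1), of Y v x] Y v(2)
      by (simp add: dist_norm norm_minus_commute)
  qed
qed

text \<open>The functionals \<open>f\<^sub>i\<close> commute with the Fourier expansion of \<open>u\<^sub>i\<close>, so \<open>\<Sum> f\<^sub>i(e) \<langle>e, u\<^sub>i\<rangle>\<close>, taken over
  any orthonormal basis, is \<open>f\<^sub>i(u\<^sub>i)\<close>.\<close>

lemma has_trace_finite_rank:
  fixes T :: "'a::complex_hilbert_space \<Rightarrow>\<^sub>L 'a" and f :: "'i \<Rightarrow> 'a \<Rightarrow> complex"
  assumes f: "\<And>i. i \<in> I \<Longrightarrow> bounded_clinear (f i)" and "finite I"
    and T: "\<And>x. T x = (\<Sum>i\<in>I. f i x *\<^sub>C u i)"
  shows "has_trace T (\<Sum>i\<in>I. f i (u i))"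
  unfolding has_trace_def
proof (intro allI impI)
  fix B :: "'a set" assume B: "orthonormal_basis B"
  have summand: "((\<lambda>e. f i e * cinner e (u i)) has_sum f i (u i)) B" if "i \<in> I" for i
  proof -
    have "((\<lambda>e. f i (cinner e (u i) *\<^sub>C e)) has_sum f i (u i)) B"
      by (rule has_sum_bounded_linear[OF clinear_bounded_linear[OF f[OF that]]
            orthonormal_basis_has_sum[OF B]])
    thus ?thesis
      by (simp add: o_def clinear_scaleC[OF f[OF that]] mult.commute)
  qed
  have "((\<lambda>e. \<Sum>i\<in>I. f i e * cinner e (u i)) has_sum (\<Sum>i\<in>I. f i (u i))) B"
    using \<open>finite I\<close> summand by (induction I rule: finite_induct) (auto intro: has_sum_add)
  thus "((\<lambda>e. cinner e (T e)) has_sum (\<Sum>i\<in>I. f i (u i))) B"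
    by (simp add: T cinner_sum_right cinner_scaleC_right)
qed

text \<open>Separability provides a basis, without which every number would be a trace.\<close>

lemma op_trace_finite_rank:
  fixes T :: "'a::complex_hilbert_space \<Rightarrow>\<^sub>L 'a" and f :: "'i \<Rightarrow> 'a \<Rightarrow> complex"
  assumes "separable_space (euclidean :: 'a topology)"
    and f: "\<And>i. i \<in> I \<Longrightarrow> bounded_clinear (f i)" and "finite I"
    and T: "\<And>x. T x = (\<Sum>i\<in>I. f i x *\<^sub>C u i)"
  shows "op_trace T = (\<Sum>i\<in>I. f i (u i))"
  unfolding op_trace_def
proof (rule the_equality)
  show tr: "has_trace T (\<Sum>i\<in>I. f i (u i))" by (rule has_trace_finite_rank[OF f \<open>finite I\<close> T])
  fix t assume t: "has_trace T t"
  obtain B :: "'a set" where "orthonormal_basis B" using orthonormal_basis_exists[OF assms(1)] by blast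
  thus "t = (\<Sum>i\<in>I. f i (u i))" using t tr has_sum_unique unfolding has_trace_def by blast
qed

section \<open>Nearest points, the open mapping theorem, and perturbations of the identity\<close>

lemma parallelogram:
  "(norm (x + y))\<^sup>2 + (norm (x - y))\<^sup>2 = 2 * (norm x)\<^sup>2 + 2 * (norm (y::'a::complex_hilbert_space))\<^sup>2"
  using norm_add_cinner[of x y] norm_add_cinner[of x "- y"] by simp

lemma orthogonal_if_nearest:
  assumes nearest: "\<And>c. norm w \<le> norm (w - c *\<^sub>C (t::'a::complex_hilbert_space))"
  shows "cinner t w = 0"
proof (rule ccontr)
  assume nz: "cinner t w \<noteq> 0"
  hence t: "norm t > 0" by auto
  define c where "c = cinner t w / cinner t t"
  have tt: "cinner t t \<noteq> 0" using t by (simp add: cinner_norm)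
  have "cinner t (w - c *\<^sub>C t) = 0"
    using tt by (simp add: c_def cinner_diff_right cinner_scaleC_right)
  hence "cinner (c *\<^sub>C t) (w - c *\<^sub>C t) = 0" by (simp add: cinner_scaleC_left)
  hence "(norm w)\<^sup>2 = (norm (c *\<^sub>C t))\<^sup>2 + (norm (w - c *\<^sub>C t))\<^sup>2"
    using norm_add_orthogonal[of "c *\<^sub>C t" "w - c *\<^sub>C t"] by simp
  moreover have "(norm w)\<^sup>2 \<le> (norm (w - c *\<^sub>C t))\<^sup>2" using nearest by (simp add: power_mono)
  ultimately have "c *\<^sub>C t = 0" by simp
  hence "norm (c *\<^sub>C t) = 0" by simp
  hence "c = 0" using t by (simp add: norm_scaleC)
  thus False using nz tt by (simp add: c_def)
qed

text \<open>A minimizing sequence is Cauchy by the parallelogram law, and a nearest point leaves an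
  orthogonal remainder.\<close>

lemma orthogonal_projection_exists:
  fixes S :: "'a::complex_hilbert_space set"
  assumes S: "complex_vector.subspace S" "closed S"
  obtains s where "s \<in> S" "\<And>t. t \<in> S \<Longrightarrow> cinner t (w - s) = 0"
proof -
  define d where "d = (INF s\<in>S. norm (w - s))"
  have ne: "S \<noteq> {}" using S(1) complex_vector.subspace_0 by blast
  have bdd: "bdd_below ((\<lambda>s. norm (w - s)) ` S)" by (rule bdd_belowI2[of _ 0]) simp
  have d_le: "d \<le> norm (w - s)" if "s \<in> S" for s
    unfolding d_def by (rule cINF_lower[OF bdd that])
  have d0: "d \<ge> 0" unfolding d_def using ne by (intro cINF_greatest) auto
  have "\<exists>s\<in>S. norm (w - s) < d + 1 / real (Suc k)" for k
    using cINF_less_iff[OF ne bdd, of "d + 1 / real (Suc k)"] by (auto simp: d_def)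
  then obtain s where s: "\<And>k. s k \<in> S" "\<And>k. norm (w - s k) < d + 1 / real (Suc k)" by metis
  have lim: "(\<lambda>k. norm (w - s k)) \<longlonglongrightarrow> d"
  proof (rule tendsto_sandwich[of "\<lambda>_. d" _ _ "\<lambda>k. d + 1 / real (Suc k)"])
    show "(\<lambda>k. d + 1 / real (Suc k)) \<longlonglongrightarrow> d"
      using tendsto_add[OF tendsto_const LIMSEQ_inverse_real_of_nat, of d] by (simp add: field_simps)
  qed (use d_le s in \<open>auto intro!: always_eventually less_imp_le\<close>)
  have half: "(1/2) *\<^sub>R (x + y) \<in> S" if "x \<in> S" "y \<in> S" for x y
    unfolding scaleR_scaleC using S(1) that
    by (intro complex_vector.subspace_scale complex_vector.subspace_add)
  \<comment> \<open>The midpoint of \<open>s i\<close> and \<open>s j\<close> lies in \<open>S\<close>, hence at distance at least \<open>d\<close> from \<open>w\<close>.\<close>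
  have gap: "(norm (s i - s j))\<^sup>2 \<le> 2 * (norm (w - s i))\<^sup>2 + 2 * (norm (w - s j))\<^sup>2 - 4 * d\<^sup>2" for i j
  proof -
    have "2 * d \<le> 2 * norm (w - (1/2) *\<^sub>R (s i + s j))" using d_le[OF half[OF s(1) s(1)]] by simp
    also have "\<dots> = norm (2 *\<^sub>R (w - (1/2) *\<^sub>R (s i + s j)))" by simp
    also have "2 *\<^sub>R (w - (1/2) *\<^sub>R (s i + s j)) = (w - s i) + (w - s j)"
      by (simp add: algebra_simps scaleR_2)
    finally have "(2 * d)\<^sup>2 \<le> (norm ((w - s i) + (w - s j)))\<^sup>2" using d0 by (intro power_mono) auto
    thus ?thesis using parallelogram[of "w - s i" "w - s j"]
      by (simp add: norm_minus_commute[of "s j" "s i"])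
  qed
  have "Cauchy s"
  proof (rule metric_CauchyI)
    fix e :: real assume e: "e > 0"
    have "(\<lambda>k. (norm (w - s k))\<^sup>2) \<longlonglongrightarrow> d\<^sup>2" by (intro tendsto_intros lim)
    hence "eventually (\<lambda>k. (norm (w - s k))\<^sup>2 < d\<^sup>2 + e\<^sup>2 / 4) sequentially"
      using e by (intro order_tendstoD) auto
    then obtain N where N: "\<And>k. k \<ge> N \<Longrightarrow> (norm (w - s k))\<^sup>2 < d\<^sup>2 + e\<^sup>2 / 4"
      by (auto simp: eventually_sequentially)
    have "dist (s i) (s j) < e" if "i \<ge> N" "j \<ge> N" for i j
    proof -
      have "(norm (s i - s j))\<^sup>2 < e\<^sup>2" using gap[of i j] N[OF that(1)] N[OF that(2)] by simp
      thus ?thesis using e by (simp add: dist_norm power2_less_imp_less)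
    qed
    thus "\<exists>M. \<forall>m\<ge>M. \<forall>n\<ge>M. dist (s m) (s n) < e" by blast
  qed
  then obtain p where p: "s \<longlonglongrightarrow> p" by (metis Cauchy_convergent convergentD)
  have pS: "p \<in> S" using S(2) s(1) p closed_sequentially by blast
  have "(\<lambda>k. norm (w - s k)) \<longlonglongrightarrow> norm (w - p)" by (intro tendsto_intros p)
  hence dp: "norm (w - p) = d" using lim LIMSEQ_unique by blast
  show thesis
  proof (rule that[OF pS])
    fix t assume t: "t \<in> S"
    show "cinner t (w - p) = 0"
    proof (rule orthogonal_if_nearest)
      fix c
      have "p + c *\<^sub>C t \<in> S"
        using S(1) pS t complex_vector.subspace_add complex_vector.subspace_scale by blast
      from d_le[OF this] show "norm (w - p) \<le> norm (w - p - c *\<^sub>C t)"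
        by (simp add: dp algebra_simps)
    qed
  qed
qed

text \<open>Baire's theorem in the range provides a ball that the closure of the image of some ball
  contains; completeness of the domain then removes the closure by successive approximation.\<close>

lemma open_mapping_bound:
  fixes T :: "'a::banach \<Rightarrow> 'b::banach"
  assumes T: "bounded_linear T" and cl: "closed (range T)"
  obtains C where "C > 0" "\<And>y. y \<in> range T \<Longrightarrow> \<exists>x. T x = y \<and> norm x \<le> C * norm y"
proof -
  interpret T: bounded_linear T by fact
  define R where "R = range T"
  define A where "A k = closure (T ` cball 0 (real k))" for k :: nat
  have AR: "A k \<subseteq> R" for k unfolding A_def R_def by (rule closure_minimal) (use cl in auto)
  have cover: "R \<subseteq> (\<Union>k. A k)"
  proof
    fix y assume "y \<in> R"
    then obtain x where x: "y = T x" by (auto simp: R_def)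
    obtain k :: nat where "norm x \<le> real k" using real_arch_simple by blast
    hence "y \<in> A k" unfolding A_def x using closure_subset by (metis imageI mem_cball_0 subsetD)
    thus "y \<in> (\<Union>k. A k)" by blast
  qed
  interpret R: Submetric UNIV dist R
    by unfold_locales auto
  have top: "R.sub.mtopology = top_of_set R"
    using R.mtopology_submetric by simp
  have mc: "R.sub.mcomplete"
    by (rule R.closedin_mcomplete_imp_mcomplete) (use cl in \<open>simp_all add: R_def complete_UNIV\<close>)
  have zR: "0 \<in> R" unfolding R_def by (metis T.zero rangeI)
  have "\<exists>k. R.sub.mtopology interior_of A k \<noteq> {}"
  proof (rule ccontr)
    assume "\<not> ?thesis"
    hence "R.sub.mtopology interior_of (\<Union>(range A)) = {}"
      using AR by (intro R.sub.metric_Baire_category_alt mc)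
        (auto simp: top A_def closedin_closed_eq intro!: closed_subset)
    moreover have "\<Union>(range A) = R" using cover AR by blast
    ultimately show False using zR interior_of_topspace[of R.sub.mtopology] by (auto simp: top)
  qed
  then obtain k y0 where "y0 \<in> R.sub.mtopology interior_of A k" by blast
  then obtain U where U: "open U" "y0 \<in> U" "y0 \<in> R" "U \<inter> R \<subseteq> A k"
    unfolding top interior_of_def by (auto simp: openin_open Int_commute)
  obtain r where r: "r > 0" "cball y0 r \<subseteq> U" using U(1,2) open_contains_cball by blast
  have Rdiff: "x - y \<in> R" "x + y \<in> R" "c *\<^sub>R x \<in> R" if "x \<in> R" "y \<in> R" for x y c
    using that unfolding R_def by (metis (no_types) T.diff T.add T.scaleR rangeE rangeI)+
  define C where "C = 2 * real k / r"
  have k0: "real k \<ge> 0" by simp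
  \<comment> \<open>Scale \<open>y\<close> so that \<open>y0 + y\<close> still lies in the ball, and subtract approximate preimages of \<open>y0 + y\<close>
    and \<open>y0\<close>.\<close>
  have approx: "\<exists>x. norm x \<le> C * norm y \<and> norm (y - T x) \<le> e" if y: "y \<in> R" "e > 0" for y and e :: real
  proof (cases "y = 0")
    case True
    thus ?thesis using y by (intro exI[of _ 0]) (simp add: T.zero)
  next
    case False
    define s where "s = r / norm y"
    have s0: "s > 0" using False r by (simp add: s_def)
    have "norm (s *\<^sub>R y) = r" using False r by (simp add: s_def)
    hence "y0 + s *\<^sub>R y \<in> cball y0 r" by (simp add: dist_norm)
    hence "y0 + s *\<^sub>R y \<in> A k" "y0 \<in> A k" using r U Rdiff y by (auto simp: subset_iff)
    hence near: "\<exists>a. norm a \<le> real k \<and> dist (T a) v < e * s / 2" if "v \<in> {y0 + s *\<^sub>R y, y0}" for v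
      using that y s0 unfolding A_def closure_approachable by (auto dest!: spec[of _ "e * s / 2"])
    obtain a where a: "norm a \<le> real k" "dist (T a) (y0 + s *\<^sub>R y) < e * s / 2" using near by blast
    obtain b where b: "norm b \<le> real k" "dist (T b) y0 < e * s / 2" using near by blast
    define x where "x = (1 / s) *\<^sub>R (a - b)"
    have "norm (s *\<^sub>R (y - T x)) = norm ((y0 + s *\<^sub>R y - T a) - (y0 - T b))"
      using s0 by (simp add: x_def T.scaleR T.diff algebra_simps)
    also have "\<dots> \<le> norm (y0 + s *\<^sub>R y - T a) + norm (y0 - T b)" by (rule norm_triangle_ineq4)
    also have "\<dots> \<le> e * s" using a(2) b(2) by (simp add: dist_norm norm_minus_commute)
    finally have "norm (y - T x) \<le> e" using s0 by (simp add: mult.commute)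
    moreover have "norm x \<le> (1 / s) * (2 * real k)"
      unfolding x_def using a(1) b(1) norm_triangle_ineq4[of a b] s0 by (simp add: divide_right_mono)
    hence "norm x \<le> C * norm y" by (simp add: C_def s_def field_simps)
    ultimately show ?thesis by blast
  qed
  show thesis
  proof (rule that[of "2 * C + 1"])
    show "2 * C + 1 > 0" using r by (simp add: C_def add_nonneg_pos)
    fix y assume "y \<in> range T"
    hence yR: "y \<in> R" by (simp add: R_def)
    show "\<exists>x. T x = y \<and> norm x \<le> (2 * C + 1) * norm y"
    proof (cases "y = 0")
      case True
      thus ?thesis by (intro exI[of _ 0]) (simp add: T.zero)
    next
      case False
      \<comment> \<open>\<open>z j\<close> below is the error left after \<open>j\<close> corrections; it halves in every step.\<close>
      define g where "g z j = (SOME x. norm x \<le> C * norm z \<and> norm (z - T x) \<le> norm y / 2 ^ Suc j)"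
        for z and j :: nat
      have g: "norm (g z j) \<le> C * norm z \<and> norm (z - T (g z j)) \<le> norm y / 2 ^ Suc j" if "z \<in> R" for z j
        unfolding g_def by (rule someI_ex, rule approx) (use that False in auto)
      define z where "z = rec_nat y (\<lambda>j z. z - T (g z j))"
      have z0: "z 0 = y" and zS: "z (Suc j) = z j - T (g (z j) j)" for j by (simp_all add: z_def)
      have zR: "z j \<in> R" for j
        by (induction j) (use yR Rdiff in \<open>auto simp: z0 zS R_def\<close>)
      have znorm: "norm (z j) \<le> norm y / 2 ^ j" for j
        using g[OF zR] by (cases j) (simp_all add: z0 zS)
      define x where "x j = g (z j) j" for j
      have xn: "norm (x j) \<le> C * norm y * (1/2) ^ j" for j
      proof -
        have "norm (x j) \<le> C * norm (z j)" using g[OF zR] by (simp add: x_def)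
        also have "\<dots> \<le> C * (norm y / 2 ^ j)"
          using znorm r by (intro mult_left_mono) (auto simp: C_def)
        finally show ?thesis by (simp add: power_divide)
      qed
      have sm: "summable (\<lambda>j. C * norm y * (1/2::real) ^ j)" by (intro summable_mult summable_geometric) simp
      have sx: "summable x" by (rule summable_comparison_test'[OF sm]) (use xn in auto)
      have part: "(\<Sum>j<n. T (x j)) = y - z n" for n
        by (induction n) (simp_all add: z0 zS x_def)
      have null: "(\<lambda>n. norm y * (1/2) ^ n) \<longlonglongrightarrow> 0"
        using tendsto_mult[OF tendsto_const LIMSEQ_power_zero[of "1/2::real"]] by simp
      have "z \<longlonglongrightarrow> 0"
        by (rule Lim_null_comparison[where g = "\<lambda>n. norm y * (1/2) ^ n"])
          (use znorm null in \<open>simp_all add: power_divide\<close>)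
      hence "(\<lambda>n. \<Sum>j<n. T (x j)) \<longlonglongrightarrow> y - 0" unfolding part by (rule tendsto_diff[OF tendsto_const])
      hence "(\<lambda>j. T (x j)) sums y" by (simp add: sums_def)
      moreover have "(\<lambda>j. T (x j)) sums T (suminf x)"
        using T.sums[OF summable_sums[OF sx]] .
      ultimately have "T (suminf x) = y" using sums_unique2 by blast
      moreover have "norm (suminf x) \<le> (\<Sum>j. C * norm y * (1/2) ^ j)"
        by (rule norm_suminf_le[OF xn sm])
      hence "norm (suminf x) \<le> 2 * C * norm y"
        using suminf_geometric[of "1/2::real"] by (simp add: suminf_mult)
      hence "norm (suminf x) \<le> (2 * C + 1) * norm y"
        unfolding distrib_right using norm_ge_zero[of y] by linarith
      ultimately show ?thesis by blast
    qed
  qed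
qed

text \<open>The inverse is bounded by the constant of the open mapping theorem.\<close>

lemma clinear_inv:
  fixes T :: "'a::complex_hilbert_space \<Rightarrow>\<^sub>L 'a"
  assumes T: "bounded_clinear T" and bij: "bij T"
  shows "bounded_clinear (inv_into UNIV T)"
proof -
  have surj: "range T = UNIV" using bij by (simp add: bij_is_surj)
  obtain C where C: "\<And>y. \<exists>x. T x = y \<and> norm x \<le> C * norm y"
    using open_mapping_bound[OF clinear_bounded_linear[OF T]] surj by (metis closed_UNIV UNIV_I)
  have inv: "inv_into UNIV T y = x \<longleftrightarrow> y = T x" for x y
    using bij by (metis bij_inv_eq_iff)
  show ?thesis
  proof (rule bounded_clinearI[where C = C])
    fix x y c
    show "inv_into UNIV T (x + y) = inv_into UNIV T x + inv_into UNIV T y"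
      unfolding inv by (metis clinear_add[OF T] inv)
    show "inv_into UNIV T (c *\<^sub>C x) = c *\<^sub>C inv_into UNIV T x"
      unfolding inv by (metis clinear_scaleC[OF T] inv)
    show "norm (inv_into UNIV T x) \<le> norm x * C"
      using C[of x] inv by (metis mult.commute)
  qed
qed

text \<open>The Neumann series in the form of Banach's fixed point theorem: \<open>x\<close> solves
  \<open>x + E x = y\<close> iff it is the fixed point of the contraction \<open>x \<mapsto> y - E x\<close>.\<close>

lemma identity_plus_small_inverse:
  fixes E :: "'a::complex_hilbert_space \<Rightarrow>\<^sub>L 'a"
  assumes E: "bounded_clinear E" and small: "norm E \<le> 1/2"
  obtains J :: "'a \<Rightarrow>\<^sub>L 'a" where "bounded_clinear J" "norm J \<le> 2"
    "\<And>x. J (x + E x) = x"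
    "\<And>y. J y + E (J y) = y"
proof -
  have Eb: "norm (E x) \<le> norm x / 2" for x
    using order_trans[OF norm_blinfun mult_right_mono[OF small, of "norm x"]] by simp
  have ex1: "\<exists>!x. y - E x = x" for y
  proof (rule banach_fix_type[of "1/2"])
    have "dist (y - E x) (y - E x') \<le> 1/2 * dist x x'" for x x'
      using Eb[of "x' - x"] by (simp add: dist_norm blinfun.diff_right norm_minus_commute)
    thus "\<forall>x x'. dist (y - E x) (y - E x') \<le> 1/2 * dist x x'" by blast
  qed auto
  define J where "J y = (THE x. y - E x = x)" for y
  have Jeq: "y - E (J y) = J y" for y
    unfolding J_def by (rule theI'[OF ex1])
  have Juniq: "J y = x" if "x + E x = y" for x y
    using ex1[of y] Jeq[of y] that by (metis add_diff_cancel_right')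
  have bc: "bounded_clinear J"
  proof (rule bounded_clinearI[where C = 2])
    fix x y c
    show "J (x + y) = J x + J y"
      by (rule Juniq) (use Jeq[of x] Jeq[of y] in \<open>simp add: blinfun.add_right algebra_simps\<close>)
    show "J (c *\<^sub>C x) = c *\<^sub>C J x"
      by (rule Juniq) (metis Jeq diff_add_cancel clinear_scaleC[OF E] scaleC_add_right)
    have "norm (J x) \<le> norm x + norm (J x) / 2"
      using norm_triangle_ineq4[of x "E (J x)"] Eb[of "J x"] Jeq[of x] by simp
    thus "norm (J x) \<le> norm x * 2" by simp
  qed
  have app: "blinfun_apply (Blinfun J) = J" by (rule blinfun_apply_Blinfun_clinear[OF bc])
  show thesis
  proof (rule that[of "Blinfun J"])
    show "norm (Blinfun J) \<le> 2"
    proof (rule norm_blinfun_bound)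
      fix x
      have "norm (J x) \<le> norm x + norm (J x) / 2"
        using norm_triangle_ineq4[of x "E (J x)"] Eb[of "J x"] Jeq[of x] by simp
      thus "norm (Blinfun J x) \<le> 2 * norm x" by (simp add: app)
    qed simp
    show "Blinfun J y + E (Blinfun J y) = y" for y
      unfolding app using Jeq[of y] by (metis diff_add_cancel)
  qed (use bc Juniq in \<open>simp_all add: app\<close>)
qed

section \<open>A parametrix for a Fredholm operator\<close>

text \<open>Projecting the finitely many complementary vectors off \<open>S\<close> and orthonormalizing the remainders gives
  explicit, bounded coordinates on a complement of \<open>S\<close>.\<close>

lemma orthonormal_complement:
  fixes S :: "'a::complex_hilbert_space set"
  assumes S: "complex_vector.subspace S" "closed S"
    and B: "finite B" "cspan (S \<union> B) = UNIV"
  obtains m w where "orthonormal_family m w" "\<And>k s. k < m \<Longrightarrow> s \<in> S \<Longrightarrow> cinner (w k) s = 0"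
    "\<And>y. y - (\<Sum>k<m. cinner (w k) y *\<^sub>C w k) \<in> S"
proof -
  have "\<exists>s\<in>S. \<forall>t\<in>S. cinner t (b - s) = 0" for b
    using orthogonal_projection_exists[OF S, of b] by metis
  then obtain \<pi> where \<pi>: "\<And>b. \<pi> b \<in> S" "\<And>b t. t \<in> S \<Longrightarrow> cinner t (b - \<pi> b) = 0" by metis
  obtain U where U: "orthonormal_set U" "finite U"
    "cspan U = cspan ((\<lambda>b. b - \<pi> b) ` B)"
    using orthonormal_spanning_set[of "(\<lambda>b. b - \<pi> b) ` B"] B(1) by blast
  obtain m w where w: "orthonormal_family m w" "U = w ` {..<m}"
    using orthonormal_family_of_set[OF U(1,2)] by metis
  have orth: "cinner t v = 0" if "t \<in> S" "v \<in> cspan U" for t v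
    using that(2) unfolding U(3)
    by (induction rule: complex_vector.span_induct_alt)
      (auto simp: cinner_add_right cinner_scaleC_right \<pi>(2)[OF that(1)])
  have wS: "cinner (w k) s = 0" if "k < m" "s \<in> S" for k s
  proof -
    have "w k \<in> cspan U" using that w(2) by (auto intro: complex_vector.span_base)
    thus ?thesis using orth[OF that(2)] by (metis cinner_commute complex_cnj_zero)
  qed
  \<comment> \<open>The remainders still span a complement of \<open>S\<close>.\<close>
  have dec: "\<exists>s\<in>S. y - s \<in> cspan U" if "y \<in> cspan (S \<union> B)" for y
    using that
  proof (induction rule: complex_vector.span_induct_alt)
    case base
    show ?case using complex_vector.subspace_0[OF S(1)] complex_vector.span_zero
      by (intro bexI[of _ 0]) auto
  next
    case (step c x y)
    then obtain s where s: "s \<in> S" "y - s \<in> cspan U" by blast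
    have "\<exists>t\<in>S. x - t \<in> cspan U"
    proof (cases "x \<in> S")
      case True
      thus ?thesis using complex_vector.span_zero by (intro bexI[of _ x]) auto
    next
      case False
      hence "x - \<pi> x \<in> cspan U"
        using step(1) unfolding U(3) by (intro complex_vector.span_base) auto
      thus ?thesis using \<pi>(1) by blast
    qed
    then obtain t where t: "t \<in> S" "x - t \<in> cspan U" by blast
    have "c *\<^sub>C x + y - (c *\<^sub>C t + s) = c *\<^sub>C (x - t) + (y - s)" by (simp add: scaleC_diff_right)
    also have "\<dots> \<in> cspan U"
      by (rule complex_vector.span_add[OF complex_vector.span_scale[OF t(2)] s(2)])
    finally have "c *\<^sub>C x + y - (c *\<^sub>C t + s) \<in> cspan U" .
    moreover have "c *\<^sub>C t + s \<in> S"
      using S(1) t s complex_vector.subspace_add complex_vector.subspace_scale by blast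
    ultimately show ?case by blast
  qed
  have "y - (\<Sum>k<m. cinner (w k) y *\<^sub>C w k) \<in> S" for y
  proof -
    obtain s where s: "s \<in> S" "y - s \<in> cspan (w ` {..<m})" using dec[of y] B(2) w(2) by auto
    have "y - s = (\<Sum>k<m. cinner (w k) (y - s) *\<^sub>C w k)"
      by (rule orthonormal_family_expansion[OF w(1) s(2)])
    also have "\<dots> = (\<Sum>k<m. cinner (w k) y *\<^sub>C w k)"
      by (rule sum.cong) (auto simp: cinner_diff_right wS s(1))
    finally show ?thesis using s(1) by (metis diff_diff_eq2 add_diff_cancel_left')
  qed
  with w(1) wS show thesis by (rule that)
qed

text \<open>The left inverse modulo the kernel is made injective or surjective, whichever the dimensions of
  kernel and cokernel permit, by pairing as many basis vectors of the cokernel as possible with basis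
  vectors of the kernel. Invertibility of neighbouring operators will force it to be both.\<close>

lemma fredholm_parametrix:
  fixes X :: "'a::complex_hilbert_space \<Rightarrow>\<^sub>L 'a"
  assumes "fredholm X"
  obtains n u and T :: "'a \<Rightarrow>\<^sub>L 'a" where "orthonormal_family n u" "{x. X x = 0} = cspan (u ` {..<n})"
    "bounded_clinear T"
    "\<And>x. T (X x) = x - (\<Sum>i<n. cinner (u i) x *\<^sub>C u i)"
    "inj T \<or> surj T"
proof -
  have X: "bounded_clinear X" and fin: "cfinite_dim {x. X x = 0}"
    and cl: "closed (range X)" using assms by (auto simp: fredholm_def)
  obtain B where B: "finite B" "cspan (range X \<union> B) = UNIV"
    using assms by (auto simp: fredholm_def)
  have subK: "complex_vector.subspace {x. X x = 0}"
    by (rule complex_vector.subspaceI)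
      (auto simp: clinear_simps[OF X])
  obtain n u where u: "orthonormal_family n u" "{x. X x = 0} = cspan (u ` {..<n})"
    using cfinite_dim_orthonormal_family[OF fin subK] .
  have Xu: "X (u i) = 0" if "i < n" for i
  proof -
    have "u i \<in> {x. X x = 0}" unfolding u(2) using that by (intro complex_vector.span_base) auto
    thus ?thesis by simp
  qed
  define R where "R = range X"
  have subR: "complex_vector.subspace R"
  proof (rule complex_vector.subspaceI)
    show "0 \<in> R" unfolding R_def using clinear_zero[OF X] by (metis rangeI)
    fix x y c assume "x \<in> R" "y \<in> R"
    then obtain a b where ab: "x = X a" "y = X b" by (auto simp: R_def)
    show "x + y \<in> R" using clinear_add[OF X, of a b] ab unfolding R_def by (metis rangeI)
    show "c *\<^sub>C x \<in> R" using clinear_scaleC[OF X, of c a] ab unfolding R_def by (metis rangeI)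
  qed
  obtain m w where w: "orthonormal_family m w" "\<And>k s. k < m \<Longrightarrow> s \<in> R \<Longrightarrow> cinner (w k) s = 0"
    "\<And>y. y - (\<Sum>k<m. cinner (w k) y *\<^sub>C w k) \<in> R"
    using orthonormal_complement[OF subR _ B(1)] cl B(2) unfolding R_def by metis
  define P where "P x = (\<Sum>i<n. cinner (u i) x *\<^sub>C u i)" for x
  define Q where "Q y = y - (\<Sum>k<m. cinner (w k) y *\<^sub>C w k)" for y
  have bcP: "bounded_clinear P" unfolding P_def
    by (intro clinear_sum_fun clinear_scaleC_const clinear_cinner)
  have bcQ: "bounded_clinear Q" unfolding Q_def
    by (intro clinear_minus_fun clinear_ident clinear_sum_fun
        clinear_scaleC_const clinear_cinner)
  have XP: "X (P x) = 0" for x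
    by (simp add: P_def clinear_simps[OF X] Xu)
  have uP: "cinner (u i) (x - P x) = 0" if "i < n" for i x
    using orthonormal_family_coeff[OF u(1) that order_refl, of "\<lambda>j. cinner (u j) x"] that
    by (simp add: P_def cinner_diff_right)
  have Px0: "P x = 0" if "\<forall>i<n. cinner (u i) x = 0" for x using that by (simp add: P_def)
  have kerP: "P x = x" if "X x = 0" for x
    using orthonormal_family_expansion[OF u(1), of x] that unfolding u(2)[symmetric] P_def by simp
  obtain C where C: "C > 0" "\<And>y. y \<in> R \<Longrightarrow> \<exists>x. X x = y \<and> norm x \<le> C * norm y"
    using open_mapping_bound[OF clinear_bounded_linear[OF X] cl] unfolding R_def by metis
  obtain C' where C': "C' > 0" "\<And>x. norm (x - P x) \<le> C' * norm x"
    using norm_bounded_clinear_bound[OF clinear_minus_fun[OF clinear_ident bcP]] by metis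
  define Y where "Y s = (THE x. X x = s \<and> (\<forall>i<n. cinner (u i) x = 0))" for s
  have uniq: "x = x'" if "X x = X x'"
    "\<forall>i<n. cinner (u i) x = 0" "\<forall>i<n. cinner (u i) x' = 0" for x x'
  proof -
    have "P (x - x') = x - x'" using kerP[of "x - x'"] that(1) by (simp add: clinear_diff[OF X])
    moreover have "P (x - x') = 0" by (rule Px0) (use that in \<open>simp add: cinner_diff_right\<close>)
    ultimately show ?thesis by simp
  qed
  have Yeq: "Y (X x) = x" if "\<forall>i<n. cinner (u i) x = 0" for x
    unfolding Y_def by (rule the_equality) (use uniq that in auto)
  have YX: "Y (X x) = x - P x" for x
    using Yeq[of "x - P x"] uP by (simp add: clinear_diff[OF X] XP)
  have Yuniq: "X (Y s) = s" "\<forall>i<n. cinner (u i) (Y s) = 0" "norm (Y s) \<le> C' * C * norm s"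
    if "s \<in> R" for s
  proof -
    obtain x where x: "X x = s" "norm x \<le> C * norm s" using C(2)[OF \<open>s \<in> R\<close>] by blast
    have Ys: "Y s = x - P x" using YX[of x] x by simp
    thus "X (Y s) = s" "\<forall>i<n. cinner (u i) (Y s) = 0"
      using x uP by (auto simp: clinear_diff[OF X] XP)
    have "norm (Y s) \<le> C' * norm x" using C'(2)[of x] Ys by simp
    also have "\<dots> \<le> C' * (C * norm s)" using x(2) C'(1) by (intro mult_left_mono) auto
    finally show "norm (Y s) \<le> C' * C * norm s" by simp
  qed
  have QR: "Q y \<in> R" for y unfolding Q_def by (rule w(3))
  have bcYQ: "bounded_clinear (\<lambda>y. Y (Q y))"
  proof -
    obtain D where D: "D > 0" "\<And>y. norm (Q y) \<le> D * norm y" using norm_bounded_clinear_bound[OF bcQ] by metis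
    show ?thesis
    proof (rule bounded_clinearI[where C = "C' * C * D"])
      fix x y c
      have "Y (X (Y (Q x) + Y (Q y))) = Y (Q x) + Y (Q y)"
        by (rule Yeq) (use Yuniq(2) QR in \<open>auto simp: cinner_add_right\<close>)
      thus "Y (Q (x + y)) = Y (Q x) + Y (Q y)"
        by (simp add: clinear_add[OF X] clinear_add[OF bcQ] Yuniq(1) QR)
      have "Y (X (c *\<^sub>C Y (Q x))) = c *\<^sub>C Y (Q x)"
        by (rule Yeq) (use Yuniq(2) QR in \<open>auto simp: cinner_scaleC_right\<close>)
      thus "Y (Q (c *\<^sub>C x)) = c *\<^sub>C Y (Q x)"
        by (simp add: clinear_scaleC[OF X] clinear_scaleC[OF bcQ] Yuniq(1) QR)
      have "norm (Y (Q x)) \<le> C' * C * norm (Q x)" by (rule Yuniq(3)[OF QR])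
      also have "\<dots> \<le> C' * C * (D * norm x)" using C(1) C'(1) D(2) by (intro mult_left_mono) auto
      finally show "norm (Y (Q x)) \<le> norm x * (C' * C * D)" by (simp add: mult_ac)
    qed
  qed
  \<comment> \<open>\<open>Y\<close> inverts \<open>X\<close> on its range; the sum pairs cokernel vectors with kernel vectors.\<close>
  define T where "T y = Y (Q y) + (\<Sum>k<min m n. cinner (w k) y *\<^sub>C u k)" for y
  have bcT: "bounded_clinear T" unfolding T_def
    by (intro clinear_plus bcYQ clinear_sum_fun clinear_scaleC_const
        clinear_cinner)
  have wX: "cinner (w k) (X x) = 0" if "k < m" for k x
    using w(2)[OF that, of "X x"] by (simp add: R_def)
  have QX: "Q (X x) = X x" for x
    by (simp add: Q_def wX)
  have TX: "T (X x) = x - P x" for x by (simp add: T_def QX YX wX)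
  have injsurj: "inj T \<or> surj T"
  proof (cases "n \<le> m")
    case True
    have "\<exists>y. T y = x" for x
    proof -
      define v where "v = (\<Sum>k<n. cinner (u k) x *\<^sub>C w k)"
      have wv: "cinner (w k) v = (if k < n then cinner (u k) x else 0)" if "k < m" for k
        unfolding v_def by (rule orthonormal_family_coeff[OF w(1) that True])
      have "(\<Sum>k<m. cinner (w k) v *\<^sub>C w k) = (\<Sum>k<n. cinner (u k) x *\<^sub>C w k)"
        by (rule sum.mono_neutral_cong_right) (use True wv in auto)
      hence "Q v = 0" by (simp add: Q_def v_def)
      moreover have "(\<Sum>k<n. cinner (w k) v *\<^sub>C u k) = P x"
        unfolding P_def by (rule sum.cong) (use True wv in auto)
      moreover have "Y 0 = 0" using Yeq[of 0] by (simp add: clinear_zero[OF X])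
      ultimately have "T v = P x" using True by (simp add: T_def min_absorb2)
      hence "T (X x + v) = x" by (simp add: clinear_add[OF bcT] TX)
      thus ?thesis by blast
    qed
    thus ?thesis by (metis surjI)
  next
    case False
    hence mn: "min m n = m" by simp
    have "y = 0" if y: "T y = 0" for y
    proof -
      have "cinner (w k) y = 0" if k: "k < m" for k
      proof -
        have "cinner (u k) (T y) = cinner (u k) (Y (Q y)) + cinner (w k) y"
          using orthonormal_family_coeff[OF u(1), of k m "\<lambda>k. cinner (w k) y"] k False
          by (simp add: T_def mn cinner_add_right)
        thus ?thesis using y Yuniq(2)[OF QR, of y] k False by simp
      qed
      hence "Q y = y" "Y (Q y) = 0" using y by (simp_all add: Q_def T_def mn)
      thus ?thesis using Yuniq(1)[OF QR, of y] by (simp add: clinear_zero[OF X])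
    qed
    hence "inj T" using clinear_diff[OF bcT] by (metis eq_iff_diff_eq_0 injI)
    thus ?thesis ..
  qed
  have app: "blinfun_apply (Blinfun T) = T" by (rule blinfun_apply_Blinfun_clinear[OF bcT])
  show thesis
    by (rule that[of n u "Blinfun T"]) (use u bcT TX injsurj in \<open>simp_all add: app P_def\<close>)
qed

section \<open>Invertibility modulo finite rank as a determinant\<close>

text \<open>From here on, \<open>$\<close> selects the entries of vectors of variable dimension.\<close>

unbundle no vec_syntax

lemma smult_one_mult_mat_vec:
  assumes "v \<in> carrier_vec n"
  shows "(c \<cdot>\<^sub>m 1\<^sub>m n) *\<^sub>v v = c \<cdot>\<^sub>v (v :: complex vec)"
proof (rule eq_vecI)
  fix i assume "i < dim_vec (c \<cdot>\<^sub>v v)"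
  hence i: "i < n" using assms by auto
  have "((c \<cdot>\<^sub>m 1\<^sub>m n) *\<^sub>v v) $ i = (c \<cdot>\<^sub>v unit_vec n i) \<bullet> v" using i by simp
  also have "\<dots> = c * (unit_vec n i \<bullet> v)" by (rule smult_scalar_prod_distrib[OF unit_vec_carrier assms])
  finally show "((c \<cdot>\<^sub>m 1\<^sub>m n) *\<^sub>v v) $ i = (c \<cdot>\<^sub>v v) $ i" using i assms by simp
qed (use assms in auto)

lemma mult_adj_mat_vec:
  assumes "A \<in> carrier_mat n n" "v \<in> carrier_vec n"
  shows "A *\<^sub>v (adj_mat A *\<^sub>v v) = det A \<cdot>\<^sub>v (v :: complex vec)"
    and "adj_mat A *\<^sub>v (A *\<^sub>v v) = det A \<cdot>\<^sub>v v"
  using assoc_mult_mat_vec[OF assms(1) adj_mat(1)[OF assms(1)] assms(2)]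
    assoc_mult_mat_vec[OF adj_mat(1)[OF assms(1)] assms(1,2)]
    adj_mat(2,3)[OF assms(1)] smult_one_mult_mat_vec[OF assms(2)]
  by metis+

text \<open>For \<open>L = G - \<Sum> u\<^sub>i \<langle>u\<^sub>i, \<cdot>\<rangle>\<close> with \<open>G\<close> invertible, the coefficients \<open>\<xi>\<^sub>i = \<langle>u\<^sub>i, x\<rangle>\<close> of a solution of
  \<open>L x = y\<close> satisfy a square linear system with this matrix; \<open>J\<close> stands for the inverse of \<open>G\<close>.\<close>

definition perturbation_matrix ::
  "nat \<Rightarrow> (nat \<Rightarrow> 'a::complex_hilbert_space) \<Rightarrow> ('a \<Rightarrow>\<^sub>L 'a) \<Rightarrow> complex mat" where
  "perturbation_matrix n u J = mat n n (\<lambda>(i, j). (if i = j then 1 else 0) - cinner (u i) (J (u j)))"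

lemma perturbation_matrix_carrier [simp]: "perturbation_matrix n u J \<in> carrier_mat n n"
  by (simp add: perturbation_matrix_def)

lemma perturbation_matrix_mult:
  assumes "\<xi> \<in> carrier_vec n"
  shows "perturbation_matrix n u J *\<^sub>v \<xi>
    = vec n (\<lambda>i. \<xi> $ i - (\<Sum>j<n. cinner (u i) (J (u j)) * \<xi> $ j))"
proof (rule eq_vecI)
  fix i assume i: "i < dim_vec (vec n (\<lambda>i. \<xi> $ i - (\<Sum>j<n. cinner (u i) (J (u j)) * \<xi> $ j)))"
  have "(perturbation_matrix n u J *\<^sub>v \<xi>) $ i
      = (\<Sum>j<n. ((if i = j then 1 else 0) - cinner (u i) (J (u j))) * \<xi> $ j)"
    using i assms by (simp add: perturbation_matrix_def scalar_prod_def lessThan_atLeast0)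
  also have "\<dots> = (\<Sum>j<n. (if j = i then \<xi> $ j else 0) - cinner (u i) (J (u j)) * \<xi> $ j)"
    by (rule sum.cong) (auto simp: algebra_simps)
  also have "\<dots> = \<xi> $ i - (\<Sum>j<n. cinner (u i) (J (u j)) * \<xi> $ j)"
    using i by (simp add: sum_subtractf)
  finally show "(perturbation_matrix n u J *\<^sub>v \<xi>) $ i
      = vec n (\<lambda>i. \<xi> $ i - (\<Sum>j<n. cinner (u i) (J (u j)) * \<xi> $ j)) $ i" using i by simp
qed (simp add: perturbation_matrix_def)

locale finite_rank_perturbation =
  fixes G J L :: "'a::complex_hilbert_space \<Rightarrow>\<^sub>L 'a" and n :: nat and u :: "nat \<Rightarrow> 'a"
  assumes J: "bounded_clinear J"
    and JG: "\<And>x. J (G x) = x"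
    and GJ: "\<And>y. G (J y) = y"
    and L: "\<And>x. L x = G x - (\<Sum>i<n. cinner (u i) x *\<^sub>C u i)"
    and u: "orthonormal_family n u"
begin

abbreviation "B \<equiv> perturbation_matrix n u J"

lemma solution_eq:
  "x = J (L x) + (\<Sum>j<n. cinner (u j) x *\<^sub>C J (u j))"
proof -
  have "G x = L x + (\<Sum>i<n. cinner (u i) x *\<^sub>C u i)" by (simp add: L)
  hence "x = J (L x + (\<Sum>i<n. cinner (u i) x *\<^sub>C u i))" using JG by metis
  thus ?thesis
    by (simp add: clinear_simps[OF J])
qed

lemma coefficient_system:
  "B *\<^sub>v vec n (\<lambda>i. cinner (u i) x) = vec n (\<lambda>i. cinner (u i) (J (L x)))"
proof (rule eq_vecI)
  fix i assume i: "i < dim_vec (vec n (\<lambda>i. cinner (u i) (J (L x))))"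
  have "cinner (u i) x = cinner (u i) (J (L x))
      + (\<Sum>j<n. cinner (u j) x * cinner (u i) (J (u j)))"
    by (subst solution_eq) (simp add: cinner_add_right cinner_sum_right cinner_scaleC_right)
  thus "(B *\<^sub>v vec n (\<lambda>i. cinner (u i) x)) $ i
      = vec n (\<lambda>i. cinner (u i) (J (L x))) $ i"
    using i by (simp add: perturbation_matrix_mult mult.commute)
qed (simp add: perturbation_matrix_def)

text \<open>A null vector \<open>\<xi>\<close> of the matrix yields the null vector \<open>J (\<Sum> \<xi>\<^sub>j u\<^sub>j)\<close> of \<open>L\<close>.\<close>

lemma det_nonzero_if_inj:
  assumes "inj L" shows "det B \<noteq> 0"
proof
  assume "det B = 0"
  then obtain \<xi> where \<xi>: "\<xi> \<in> carrier_vec n" "\<xi> \<noteq> 0\<^sub>v n" "B *\<^sub>v \<xi> = 0\<^sub>v n"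
    using det_0_iff_vec_prod_zero[OF perturbation_matrix_carrier] by blast
  define x where "x = (\<Sum>j<n. \<xi> $ j *\<^sub>C J (u j))"
  have c: "cinner (u i) x = \<xi> $ i" if "i < n" for i
  proof -
    have "(B *\<^sub>v \<xi>) $ i = 0" using \<xi>(3) that by simp
    thus ?thesis using that \<xi>(1)
      by (simp add: perturbation_matrix_mult x_def cinner_sum_right cinner_scaleC_right mult.commute)
  qed
  have "G x = (\<Sum>j<n. \<xi> $ j *\<^sub>C u j)"
  proof -
    have "x = J (\<Sum>j<n. \<xi> $ j *\<^sub>C u j)"
      by (simp add: x_def clinear_simps[OF J])
    thus ?thesis using GJ by metis
  qed
  hence "L x = 0" by (simp add: L c)
  hence "x = 0" using assms by (metis blinfun.zero_right injD)
  hence "\<xi> $ i = 0" if "i < n" for i using c[OF that] by simp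
  hence "\<xi> = 0\<^sub>v n" using \<xi>(1) by (intro eq_vecI) auto
  thus False using \<xi>(2) by simp
qed

text \<open>Solutions of \<open>L x\<^sub>k = G u\<^sub>k\<close> supply the columns of a right inverse of the matrix.\<close>

lemma det_nonzero_if_surj:
  assumes "surj L" shows "det B \<noteq> 0"
proof -
  have "\<exists>x. \<forall>i<n. cinner (u i) (J (L x)) = (if i = k then 1 else 0)"
    if "k < n" for k
  proof -
    obtain x where "L x = G (u k)" using assms by (metis surjD)
    thus ?thesis using that by (intro exI[of _ x]) (simp add: JG orthonormal_family_cinner[OF u])
  qed
  then obtain x where x: "\<And>i k. k < n \<Longrightarrow> i < n \<Longrightarrow>
      cinner (u i) (J (L (x k))) = (if i = k then 1 else 0)" by metis
  define C where "C = mat n n (\<lambda>(i, k). cinner (u i) (x k))"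
  have "B * C = 1\<^sub>m n"
  proof (rule eq_matI)
    fix i k assume ik: "i < dim_row (1\<^sub>m n :: complex mat)" "k < dim_col (1\<^sub>m n :: complex mat)"
    have "col C k = vec n (\<lambda>i. cinner (u i) (x k))" using ik by (intro eq_vecI) (auto simp: C_def)
    hence "(B * C) $$ (i, k) = (B *\<^sub>v vec n (\<lambda>i. cinner (u i) (x k))) $ i"
      using ik by (simp add: C_def perturbation_matrix_def)
    thus "(B * C) $$ (i, k) = (1\<^sub>m n :: complex mat) $$ (i, k)"
      using ik x by (simp add: coefficient_system)
  qed (auto simp: C_def perturbation_matrix_def)
  hence "det B * det C = 1" by (simp add: det_mult[of _ n, symmetric] C_def)
  thus ?thesis by auto
qed

text \<open>The linear system determines the coefficients \<open>\<langle>u\<^sub>i, x\<rangle>\<close>, and these determine \<open>x\<close>.\<close>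

lemma bij_if_det_nonzero:
  assumes "det B \<noteq> 0" shows "bij L"
proof (rule bijI)
  have ker: "x = 0" if "L x = 0" for x
  proof -
    have "B *\<^sub>v vec n (\<lambda>i. cinner (u i) x) = 0\<^sub>v n"
      using coefficient_system[of x] that
      by (auto simp: clinear_zero[OF J] intro!: eq_vecI)
    hence "vec n (\<lambda>i. cinner (u i) x) = 0\<^sub>v n"
      using det_0_iff_vec_prod_zero[OF perturbation_matrix_carrier, of n u J] assms by force
    hence "cinner (u i) x = 0" if "i < n" for i using that by (metis index_vec index_zero_vec(1))
    thus ?thesis using solution_eq[of x] that by (simp add: clinear_zero[OF J])
  qed
  show "inj L"
  proof (rule injI)
    fix x y assume "L x = L y"
    hence "L (x - y) = 0" by (simp add: blinfun.diff_right)
    hence "x - y = 0" by (rule ker)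
    thus "x = y" by simp
  qed
  have "\<exists>x. L x = y" for y
  proof -
    define \<eta> where "\<eta> = vec n (\<lambda>i. cinner (u i) (J y))"
    define \<xi> where "\<xi> = (1 / det B) \<cdot>\<^sub>v (adj_mat B *\<^sub>v \<eta>)"
    have carr: "adj_mat B \<in> carrier_mat n n" "\<eta> \<in> carrier_vec n" by (simp_all add: adj_mat(1)[OF perturbation_matrix_carrier] \<eta>_def)
    have \<xi>c: "\<xi> \<in> carrier_vec n"
      unfolding \<xi>_def by (rule smult_carrier_vec[THEN iffD2, OF mult_mat_vec_carrier[OF carr]])
    have "B *\<^sub>v \<xi> = (1 / det B) \<cdot>\<^sub>v (B *\<^sub>v (adj_mat B *\<^sub>v \<eta>))"
      unfolding \<xi>_def by (rule mult_mat_vec[OF perturbation_matrix_carrier]) (rule mult_mat_vec_carrier[OF carr])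
    also have "B *\<^sub>v (adj_mat B *\<^sub>v \<eta>) = det B \<cdot>\<^sub>v \<eta>"
      by (rule mult_adj_mat_vec(1)[OF perturbation_matrix_carrier carr(2)])
    also have "(1 / det B) \<cdot>\<^sub>v (det B \<cdot>\<^sub>v \<eta>) = \<eta>"
      using assms carr by (intro eq_vecI) auto
    finally have B\<xi>: "B *\<^sub>v \<xi> = \<eta>" .
    define x where "x = J (y + (\<Sum>j<n. \<xi> $ j *\<^sub>C u j))"
    have "cinner (u i) x = \<xi> $ i" if "i < n" for i
    proof -
      have "(B *\<^sub>v \<xi>) $ i = \<eta> $ i" by (simp add: B\<xi>)
      thus ?thesis using that \<xi>c
        by (simp add: perturbation_matrix_mult x_def \<eta>_def cinner_add_right cinner_sum_right
            cinner_scaleC_right clinear_simps[OF J] mult.commute algebra_simps)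
    qed
    hence "L x = y" by (simp add: L) (simp add: x_def GJ)
    thus ?thesis by blast
  qed
  thus "surj L" by (metis surjI)
qed

end

section \<open>Complex derivatives in norm\<close>

text \<open>Existence of the limit that \<^const>\<open>vec_deriv\<close> refers to.\<close>

definition has_norm_derivative ::
  "(complex \<Rightarrow> 'a::complex_normed_vector) \<Rightarrow> 'a \<Rightarrow> complex \<Rightarrow> bool" where
  "has_norm_derivative f D z \<longleftrightarrow> ((\<lambda>w. (1 / (w - z)) *\<^sub>C (f w - f z)) \<longlongrightarrow> D) (at z)"

lemma vec_deriv_eq: "has_norm_derivative f D z \<Longrightarrow> vec_deriv f z = D"
  unfolding has_norm_derivative_def vec_deriv_def by (rule tendsto_Lim) auto

lemma has_norm_derivative_clinear:
  assumes "bounded_clinear \<Lambda>" "has_norm_derivative f D z"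
  shows "has_norm_derivative (\<lambda>w. \<Lambda> (f w)) (\<Lambda> D) z"
  using bounded_linear.tendsto[OF clinear_bounded_linear[OF assms(1)]
      assms(2)[unfolded has_norm_derivative_def]]
  by (simp add: has_norm_derivative_def clinear_simps[OF assms(1)])

lemma has_norm_derivative_field:
  "has_norm_derivative f D z \<longleftrightarrow> (f has_field_derivative D) (at z)"
  by (simp add: has_norm_derivative_def has_field_derivative_iff divide_inverse mult.commute)

lemma has_norm_derivative_isCont:
  fixes f :: "complex \<Rightarrow> 'a::complex_normed_vector"
  assumes "has_norm_derivative f D z" shows "isCont f z"
proof -
  have "((\<lambda>w. cmod (w - z) * norm ((1 / (w - z)) *\<^sub>C (f w - f z))) \<longlongrightarrow> cmod (z - z) * norm D) (at z)"
    by (intro tendsto_intros assms[unfolded has_norm_derivative_def])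
  hence "((\<lambda>w. cmod (w - z) * norm ((1 / (w - z)) *\<^sub>C (f w - f z))) \<longlongrightarrow> 0) (at z)" by simp
  moreover have "\<forall>\<^sub>F w in at z. cmod (w - z) * norm ((1 / (w - z)) *\<^sub>C (f w - f z)) = norm (f w - f z)"
    unfolding eventually_at by (intro exI[of _ 1]) (auto simp: norm_scaleC norm_divide)
  ultimately have "((\<lambda>w. norm (f w - f z)) \<longlongrightarrow> 0) (at z)" using filterlim_cong by fast
  hence "((\<lambda>w. f w - f z) \<longlongrightarrow> 0) (at z)" by (rule tendsto_norm_zero_cancel)
  thus ?thesis unfolding isCont_def using LIM_zero_cancel by blast
qed

lemma clinear_blinfun_compose_left:
  "bounded_clinear (blinfun_apply A) \<Longrightarrow> bounded_clinear (\<lambda>T. A o\<^sub>L T)"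
  unfolding bounded_clinear_def
  by (auto intro!: blinfun_eqI bounded_linear_intros simp: bounded_clinear_def)

lemma clinear_eval: "bounded_clinear (\<lambda>T. blinfun_apply T x)"
  unfolding bounded_clinear_def by (auto intro!: bounded_linear_intros)

lemma clinear_cinner_eval:
  "bounded_clinear (\<lambda>T. cinner y (blinfun_apply T (x::'a::complex_hilbert_space)))"
  by (rule clinear_compose[OF clinear_cinner clinear_eval])

text \<open>Differentiating an inverse: the difference quotient of \<open>J\<close> is \<open>- J w (F w - F z)/(w - z) J z\<close>.\<close>

lemma has_norm_derivative_inverse:
  fixes F J :: "complex \<Rightarrow> 'a::complex_hilbert_space \<Rightarrow>\<^sub>L 'a"
  assumes F: "has_norm_derivative F D z" and S: "open S" "z \<in> S"
    and J: "\<And>w. w \<in> S \<Longrightarrow> bounded_clinear (J w)" "\<And>w. w \<in> S \<Longrightarrow> norm (J w) \<le> C"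
    and JF: "\<And>w x. w \<in> S \<Longrightarrow> J w (F w x) = x"
    and FJ: "\<And>w x. w \<in> S \<Longrightarrow> F w (J w x) = x"
  shows "has_norm_derivative J (- (J z o\<^sub>L (D o\<^sub>L J z))) z"
proof -
  have diff: "J w - J z = - (J w o\<^sub>L ((F w - F z) o\<^sub>L J z))" if "w \<in> S" for w
    by (rule blinfun_eqI)
      (simp add: blinfun.diff_left blinfun.minus_left blinfun.diff_right JF[OF that] FJ[OF S(2)])
  have comp: "((\<lambda>w. A w o\<^sub>L B w) \<longlongrightarrow> a o\<^sub>L b) (at z)"
    if "(A \<longlongrightarrow> a) (at z)" "(B \<longlongrightarrow> b) (at z)" for A B :: "complex \<Rightarrow> 'a \<Rightarrow>\<^sub>L 'a" and a b
    by (rule bounded_bilinear.tendsto[OF bounded_bilinear_blinfun_compose that])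
  have evS: "\<forall>\<^sub>F w in at z. w \<in> S" using S by (simp add: eventually_at_in_open')
  have F0: "((\<lambda>w. F w - F z) \<longlongrightarrow> 0) (at z)"
    using has_norm_derivative_isCont[OF F] by (simp add: isCont_def LIM_zero)
  have "((\<lambda>w. J w - J z) \<longlongrightarrow> 0) (at z)"
  proof (rule Lim_null_comparison)
    have "norm (J w - J z) \<le> C * (norm (F w - F z) * norm (J z))" if "w \<in> S" for w
    proof -
      have "norm (J w - J z) \<le> norm (J w) * norm ((F w - F z) o\<^sub>L J z)"
        unfolding diff[OF that] norm_minus_cancel by (rule norm_blinfun_compose)
      also have "\<dots> \<le> C * (norm (F w - F z) * norm (J z))"
        using J(2)[OF that] order_trans[OF norm_ge_zero J(2)[OF that]]
        by (intro mult_mono norm_blinfun_compose) auto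
      finally show ?thesis .
    qed
    thus "\<forall>\<^sub>F w in at z. norm (J w - J z) \<le> C * (norm (F w - F z) * norm (J z))"
      using evS by (rule eventually_mono[rotated])
    have "((\<lambda>w. C * (norm (F w - F z) * norm (J z))) \<longlongrightarrow> C * (norm (0::'a \<Rightarrow>\<^sub>L 'a) * norm (J z))) (at z)"
      by (intro tendsto_intros F0)
    thus "((\<lambda>w. C * (norm (F w - F z) * norm (J z))) \<longlongrightarrow> 0) (at z)" by simp
  qed
  hence Jlim: "(J \<longlongrightarrow> J z) (at z)" by (rule LIM_zero_cancel)
  have "((\<lambda>w. - (J w o\<^sub>L (((1 / (w - z)) *\<^sub>C (F w - F z)) o\<^sub>L J z))) \<longlongrightarrow> - (J z o\<^sub>L (D o\<^sub>L J z))) (at z)"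
    by (intro tendsto_minus comp Jlim tendsto_const F[unfolded has_norm_derivative_def])
  moreover have "\<forall>\<^sub>F w in at z. - (J w o\<^sub>L (((1 / (w - z)) *\<^sub>C (F w - F z)) o\<^sub>L J z))
      = (1 / (w - z)) *\<^sub>C (J w - J z)"
    using evS
  proof (rule eventually_mono)
    fix w assume w: "w \<in> S"
    show "- (J w o\<^sub>L (((1 / (w - z)) *\<^sub>C (F w - F z)) o\<^sub>L J z)) = (1 / (w - z)) *\<^sub>C (J w - J z)"
      unfolding diff[OF w]
      by (rule blinfun_eqI) (simp add: blinfun.minus_left clinear_scaleC[OF J(1)[OF w]])
  qed
  ultimately show ?thesis unfolding has_norm_derivative_def using filterlim_cong by fast
qed

section \<open>Inverses of analytic Fredholm families have poles\<close>

lemma cmod_det_le: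
  assumes "A \<in> carrier_mat n n" "\<And>i j. i < n \<Longrightarrow> j < n \<Longrightarrow> cmod (A $$ (i, j)) \<le> c"
  shows "cmod (det A) \<le> fact n * c ^ n"
proof -
  have "cmod (det A) \<le> (\<Sum>p\<in>{p. p permutes {0..<n}}. cmod (signof p * (\<Prod>i = 0..<n. A $$ (i, p i))))"
    unfolding det_def'[OF assms(1)] by (rule norm_sum)
  also have "\<dots> \<le> (\<Sum>p\<in>{p. p permutes {0..<n}}. c ^ n)"
  proof (rule sum_mono)
    fix p assume p: "p \<in> {p. p permutes {0..<n}}"
    have "cmod (\<Prod>i = 0..<n. A $$ (i, p i)) \<le> (\<Prod>i = 0..<n. c)"
      unfolding prod_norm[symmetric]
      by (rule prod_mono) (use p assms(2) in \<open>auto simp: permutes_in_image dest: permutes_in_image\<close>)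
    moreover have "cmod (signof p) = 1" by (simp add: sign_def)
    ultimately show "cmod (signof p * (\<Prod>i = 0..<n. A $$ (i, p i))) \<le> c ^ n"
      by (simp add: norm_mult)
  qed
  also have "\<dots> = fact n * c ^ n" by (simp add: card_permutations[of "{0..<n}" n])
  finally show ?thesis .
qed

lemma cmod_adj_mat_le:
  assumes A: "A \<in> carrier_mat n n" and c: "\<And>i j. i < n \<Longrightarrow> j < n \<Longrightarrow> cmod (A $$ (i, j)) \<le> c"
    and ij: "i < n" "j < n"
  shows "cmod (adj_mat A $$ (i, j)) \<le> fact (n - 1) * c ^ (n - 1)"
proof -
  have "cmod (det (mat_delete A j i)) \<le> fact (n - 1) * c ^ (n - 1)"
  proof (rule cmod_det_le)
    show "mat_delete A j i \<in> carrier_mat (n - 1) (n - 1)" using mat_delete_carrier[OF A] .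
    fix k l assume "k < n - 1" "l < n - 1"
    thus "cmod (mat_delete A j i $$ (k, l)) \<le> c"
      using A c ij by (auto simp: mat_delete_def)
  qed
  thus ?thesis using A ij by (simp add: adj_mat_def cofactor_def norm_mult norm_power)
qed

text \<open>Factor out the zero; what remains is bounded away from zero on a smaller disk.\<close>

lemma holomorphic_lower_bound:
  assumes f: "f holomorphic_on ball z0 r" and r: "r > 0" and nz: "\<And>z. z \<in> ball z0 r - {z0} \<Longrightarrow> f z \<noteq> 0"
  obtains p d c where "0 < d" "d \<le> r" "0 < c" "\<And>z. z \<in> ball z0 d \<Longrightarrow> c * cmod (z - z0) ^ p \<le> cmod (f z)"
proof -
  obtain g s p where g: "0 < s" "ball z0 s \<subseteq> ball z0 r" "g holomorphic_on ball z0 s"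
    "\<And>w. w \<in> ball z0 s \<Longrightarrow> f w = (w - z0) ^ p * g w" "\<And>w. w \<in> ball z0 s \<Longrightarrow> g w \<noteq> 0"
  proof (cases "f z0 = 0")
    case True
    have "\<not> f constant_on ball z0 r"
    proof
      assume "f constant_on ball z0 r"
      hence "f (z0 + of_real (r / 2)) = f z0" using r by (force simp: constant_on_def dist_norm)
      moreover have "z0 + of_real (r / 2) \<in> ball z0 r - {z0}" using r by (simp add: dist_norm)
      ultimately show False using nz True by auto
    qed
    then obtain g s p where "0 < s" "ball z0 s \<subseteq> ball z0 r" "g holomorphic_on ball z0 s"
      "\<And>w. w \<in> ball z0 s \<Longrightarrow> f w = (w - z0) ^ p * g w" "\<And>w. w \<in> ball z0 s \<Longrightarrow> g w \<noteq> 0"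
      using holomorphic_factor_zero_nonconstant[OF f open_ball connected_ball _ True] r
      by (metis centre_in_ball)
    thus thesis by (rule that)
  next
    case False
    hence "f z \<noteq> 0" if "z \<in> ball z0 r" for z using nz that by (cases "z = z0") auto
    thus thesis using that[of r f 0] f r by auto
  qed
  have cont: "continuous_on (cball z0 (s/2)) g"
    by (rule holomorphic_on_imp_continuous_on, rule holomorphic_on_subset[OF g(3)]) (use g(1) in auto)
  have "compact (cball z0 (s/2))" "cball z0 (s/2) \<noteq> {}" using g(1) by auto
  then obtain x where x: "x \<in> cball z0 (s/2)" "\<And>y. y \<in> cball z0 (s/2) \<Longrightarrow> cmod (g x) \<le> cmod (g y)"
    using continuous_attains_inf[of "cball z0 (s/2)" "\<lambda>y. cmod (g y)"] cont continuous_on_norm by blast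
  have pos: "cmod (g x) > 0" using g(1) g(5)[of x] x(1) by auto
  show thesis
  proof (rule that[of "s/2" "cmod (g x)" p])
    show "s / 2 \<le> r" using g(1,2) by (simp add: ball_subset_ball_iff)
    fix z assume z: "z \<in> ball z0 (s/2)"
    hence "cmod (g x) \<le> cmod (g z)" by (intro x(2)) auto
    moreover have "f z = (z - z0) ^ p * g z" using z g(1) by (intro g(4)) auto
    ultimately show "cmod (g x) * cmod (z - z0) ^ p \<le> cmod (f z)"
      by (simp add: norm_mult norm_power mult.commute[of "cmod (z - z0) ^ p"] mult_right_mono)
  qed (use g(1) pos in auto)
qed

text \<open>Cramer's rule. What matters about the constant is that it depends on \<open>n\<close> only: in a family with
  \<open>norm J \<le> 2\<close> the growth of the inverse is controlled by the determinant alone.\<close>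

lemma (in finite_rank_perturbation) inverse_bound:
  assumes J2: "norm J \<le> 2"
  shows "cmod (det B) * norm x \<le> (fact n * 3 ^ n * 2 + 4 * real n * (real n * (fact (n - 1) * 3 ^ (n - 1)))) * norm (L x)"
proof -
  define y where "y = L x"
  define F where "F = (fact (n - 1) * 3 ^ (n - 1) :: real)"
  have Jb: "norm (J v) \<le> 2 * norm v" for v
    using order_trans[OF norm_blinfun mult_right_mono[OF J2 norm_ge_zero]] .
  have un: "norm (u i) = 1" if "i < n" for i
  proof -
    have "complex_of_real ((norm (u i))\<^sup>2) = 1"
      using orthonormal_family_cinner[OF u that that] by (simp only: cinner_norm if_True refl)
    hence "(norm (u i))\<^sup>2 = 1" by (simp only: of_real_eq_1_iff)
    thus ?thesis using norm_ge_zero[of "u i"] by (auto simp: power2_eq_1_iff)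
  qed
  have uc: "cmod (cinner (u i) v) \<le> norm v" if "i < n" for i v
    using cauchy_schwarz[of "u i" v] un[OF that] by simp
  have entry: "cmod (B $$ (i, j)) \<le> 3" if ij: "i < n" "j < n" for i j
  proof -
    have "cmod (cinner (u i) (J (u j))) \<le> 2"
      using order_trans[OF uc[OF ij(1)] Jb, of "u j"] un[OF ij(2)] by simp
    moreover have "cmod (if i = j then 1 else 0) \<le> 1" by simp
    ultimately have "cmod ((if i = j then 1 else 0) - cinner (u i) (J (u j))) \<le> 3"
      using norm_triangle_ineq4[of "if i = j then 1 else 0" "cinner (u i) (J (u j))"] by linarith
    thus ?thesis using ij by (simp add: perturbation_matrix_def)
  qed
  have detB: "cmod (det B) \<le> fact n * 3 ^ n" by (rule cmod_det_le[OF perturbation_matrix_carrier entry])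
  define \<xi> where "\<xi> = vec n (\<lambda>i. cinner (u i) x)"
  define \<eta> where "\<eta> = vec n (\<lambda>i. cinner (u i) (J y))"
  have adj: "adj_mat B \<in> carrier_mat n n" by (rule adj_mat(1)) simp
  have "adj_mat B *\<^sub>v \<eta> = det B \<cdot>\<^sub>v \<xi>"
    using mult_adj_mat_vec(2)[OF perturbation_matrix_carrier, of \<xi> n u J] coefficient_system[of x]
    by (simp add: \<xi>_def \<eta>_def y_def)
  have \<xi>b: "cmod (det B) * cmod (cinner (u i) x) \<le> real n * (F * (2 * norm y))" if i: "i < n" for i
  proof -
    have "det B * cinner (u i) x = (adj_mat B *\<^sub>v \<eta>) $ i"
      using i unfolding \<open>adj_mat B *\<^sub>v \<eta> = det B \<cdot>\<^sub>v \<xi>\<close> by (simp add: \<xi>_def)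
    also have "\<dots> = (\<Sum>j = 0..<n. adj_mat B $$ (i, j) * cinner (u j) (J y))"
      using i adj by (simp add: scalar_prod_def \<eta>_def)
    finally have "cmod (det B) * cmod (cinner (u i) x)
        = cmod (\<Sum>j = 0..<n. adj_mat B $$ (i, j) * cinner (u j) (J y))"
      by (simp flip: norm_mult)
    also have "\<dots> \<le> (\<Sum>j = 0..<n. F * (2 * norm y))"
    proof (rule order_trans[OF norm_sum sum_mono])
      fix j assume j: "j \<in> {0..<n}"
      have "cmod (adj_mat B $$ (i, j)) \<le> F"
        unfolding F_def by (rule cmod_adj_mat_le[OF perturbation_matrix_carrier entry]) (use i j in auto)
      moreover have "cmod (cinner (u j) (J y)) \<le> 2 * norm y"
        using order_trans[OF uc Jb] j by auto
      ultimately show "cmod (adj_mat B $$ (i, j) * cinner (u j) (J y)) \<le> F * (2 * norm y)"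
        unfolding norm_mult by (intro mult_mono) (auto simp: F_def)
    qed
    finally show ?thesis by simp
  qed
  have "norm x \<le> norm (J y) + norm (\<Sum>j<n. cinner (u j) x *\<^sub>C J (u j))"
    by (subst solution_eq[of x]) (simp add: y_def norm_triangle_ineq)
  also have "\<dots> \<le> 2 * norm y + (\<Sum>j<n. cmod (cinner (u j) x) * 2)"
  proof (intro add_mono Jb order_trans[OF norm_sum sum_mono])
    fix j assume "j \<in> {..<n}"
    thus "norm (cinner (u j) x *\<^sub>C J (u j)) \<le> cmod (cinner (u j) x) * 2"
      using Jb[of "u j"] un[of j] by (simp add: norm_scaleC mult_left_mono)
  qed
  finally have "cmod (det B) * norm x \<le> cmod (det B) * (2 * norm y + (\<Sum>j<n. cmod (cinner (u j) x) * 2))"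
    by (rule mult_left_mono) simp
  also have "\<dots> = cmod (det B) * (2 * norm y) + (\<Sum>j<n. 2 * (cmod (det B) * cmod (cinner (u j) x)))"
    by (simp add: distrib_left sum_distrib_left mult_ac)
  also have "\<dots> \<le> (fact n * 3 ^ n) * (2 * norm y) + (\<Sum>j<n. 2 * (real n * (F * (2 * norm y))))"
    using detB \<xi>b by (intro add_mono mult_right_mono sum_mono mult_left_mono) auto
  also have "\<dots> = (fact n * 3 ^ n * 2 + 4 * real n * (real n * F)) * norm y"
    by (simp add: algebra_simps)
  finally show ?thesis unfolding y_def F_def .
qed

text \<open>The analytic Fredholm theorem, in the form of a bound. Near \<open>z0\<close> the parametrix turns \<open>M z\<close> into
  a finite-rank perturbation of an invertible operator, and the determinant that decides its
  invertibility is analytic and vanishes at most at \<open>z0\<close>. If \<open>M z0\<close> is injective, there is no kernel to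
  correct for, and the parametrix is its inverse.\<close>

lemma analytic_fredholm_inverse_bound:
  fixes M :: "complex \<Rightarrow> 'a::complex_hilbert_space \<Rightarrow>\<^sub>L 'a"
  assumes r: "r > 0"
    and M: "\<And>z. z \<in> ball z0 r \<Longrightarrow> bounded_clinear (M z)"
    and M': "\<And>z. z \<in> ball z0 r \<Longrightarrow> has_norm_derivative M (M' z) z"
    and bij: "\<And>z. z \<in> ball z0 r - {z0} \<Longrightarrow> bij (M z)"
    and fred: "fredholm (M z0)"
  shows "\<exists>p d C. 0 < d \<and> d \<le> r \<and> 0 < C \<and>
      (\<forall>z\<in>ball z0 d. \<forall>x. cmod (z - z0) ^ p * norm x \<le> C * norm (M z x))"
    and "inj (M z0) \<Longrightarrow> surj (M z0)"
proof -
  obtain n u and T :: "'a \<Rightarrow>\<^sub>L 'a" where u: "orthonormal_family n u"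
    and ker: "{x. M z0 x = 0} = cspan (u ` {..<n})"
    and T: "bounded_clinear T"
    and TM: "\<And>x. T (M z0 x) = x - (\<Sum>i<n. cinner (u i) x *\<^sub>C u i)"
    and Tor: "inj T \<or> surj T"
    using fredholm_parametrix[OF fred] by blast
  define E where "E z = T o\<^sub>L (M z - M z0)" for z
  have Eapp: "E z x = T (M z x) - T (M z0 x)" for z x
    by (simp add: E_def blinfun.diff_left clinear_diff[OF T])
  have z0r: "z0 \<in> ball z0 r" using r by simp
  have Eb: "bounded_clinear (E z)" if "z \<in> ball z0 r" for z
    unfolding Eapp by (intro clinear_minus_fun clinear_compose[OF T] M that z0r)
  have E': "has_norm_derivative E (T o\<^sub>L M' z) z" if "z \<in> ball z0 r" for z
    using has_norm_derivative_clinear[OF clinear_blinfun_compose_left[OF T] M'[OF that]]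
    unfolding has_norm_derivative_def E_def
    by (simp add: clinear_diff[OF clinear_blinfun_compose_left[OF T]])
  have "(E \<longlongrightarrow> E z0) (at z0)" using has_norm_derivative_isCont[OF E'[OF z0r]] by (simp add: isCont_def)
  moreover have "E z0 = 0" by (simp add: E_def)
  ultimately have "\<forall>\<^sub>F z in at z0. norm (E z) < 1/2" by (auto dest!: tendstoD[of _ _ _ "1/2"] simp: dist_norm)
  then obtain s where s: "s > 0" "\<And>z. z \<noteq> z0 \<Longrightarrow> dist z z0 < s \<Longrightarrow> norm (E z) < 1/2"
    unfolding eventually_at by auto
  define d where "d = min r s"
  have d: "d > 0" "d \<le> r" using r s(1) by (auto simp: d_def)
  have Esmall: "norm (E z) \<le> 1/2" if "z \<in> ball z0 d" for z
    using s(2)[of z] that \<open>E z0 = 0\<close> by (cases "z = z0") (auto simp: d_def dist_commute less_imp_le)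
  have dr: "z \<in> ball z0 r" if "z \<in> ball z0 d" for z using that d(2) by auto
  have "\<exists>J. bounded_clinear (blinfun_apply J) \<and> norm J \<le> 2
      \<and> (\<forall>x. blinfun_apply J (x + E z x) = x) \<and> (\<forall>y. blinfun_apply J y + E z (blinfun_apply J y) = y)" if "z \<in> ball z0 d" for z
    using identity_plus_small_inverse[OF Eb[OF dr[OF that]] Esmall[OF that]] by metis
  then obtain J :: "complex \<Rightarrow> 'a \<Rightarrow>\<^sub>L 'a" where J: "\<And>z. z \<in> ball z0 d \<Longrightarrow> bounded_clinear (J z)"
    "\<And>z. z \<in> ball z0 d \<Longrightarrow> norm (J z) \<le> 2"
    "\<And>z x. z \<in> ball z0 d \<Longrightarrow> J z (x + E z x) = x"
    "\<And>z y. z \<in> ball z0 d \<Longrightarrow> J z y + E z (J z y) = y"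
    by metis
  define L where "L z = T o\<^sub>L M z" for z
  define G where "G z = id_blinfun + E z" for z
  have frp: "finite_rank_perturbation (G z) (J z) (L z) n u" if z: "z \<in> ball z0 d" for z
  proof
    show "L z x = G z x - (\<Sum>i<n. cinner (u i) x *\<^sub>C u i)" for x
      by (simp add: L_def G_def blinfun.add_left Eapp TM)
  qed (use J z u in \<open>auto simp: G_def blinfun.add_left\<close>)
  define f where "f z = det (perturbation_matrix n u (J z))" for z
  have J': "has_norm_derivative J (- (J z o\<^sub>L ((T o\<^sub>L M' z) o\<^sub>L J z))) z" if z: "z \<in> ball z0 d" for z
  proof (rule has_norm_derivative_inverse[OF _ open_ball z])
    show "has_norm_derivative G (T o\<^sub>L M' z) z"
      using E'[OF dr[OF z]] by (simp add: has_norm_derivative_def G_def)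
  qed (use J in \<open>auto simp: G_def blinfun.add_left\<close>)
  have hol: "f holomorphic_on ball z0 d"
  proof -
    have entry: "(\<lambda>z. cinner (u i) (J z (u j))) holomorphic_on ball z0 d" for i j
      unfolding holomorphic_on_open[OF open_ball]
      using has_norm_derivative_clinear[OF clinear_cinner_eval J']
      unfolding has_norm_derivative_field by blast
    have "f z = (\<Sum>p | p permutes {0..<n}. signof p *
        (\<Prod>i = 0..<n. (if i = p i then 1 else 0) - cinner (u i) (J z (u (p i)))))" for z
      unfolding f_def det_def'[OF perturbation_matrix_carrier]
      by (intro sum.cong refl arg_cong2[where f = "(*)"] prod.cong)
        (auto simp: perturbation_matrix_def permutes_in_image dest: permutes_in_image)
    hence "f = (\<lambda>z. \<Sum>p | p permutes {0..<n}. signof p *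
        (\<Prod>i = 0..<n. (if i = p i then 1 else 0) - cinner (u i) (J z (u (p i)))))" by blast
    thus ?thesis by (auto intro!: holomorphic_intros entry)
  qed
  define z1 where "z1 = z0 + of_real (d / 2)"
  have z1: "z1 \<in> ball z0 d" "z1 \<noteq> z0" using d(1) by (auto simp: z1_def dist_norm)
  have bijM: "bij (M z)" if "z \<in> ball z0 d" "z \<noteq> z0" for z
    using bij dr[OF that(1)] that(2) by auto
  have Lcomp: "blinfun_apply (L z) = blinfun_apply T \<circ> blinfun_apply (M z)" for z
    by (auto simp: L_def)
  \<comment> \<open>At one point \<open>z1 \<noteq> z0\<close> the map \<open>L z1 = T M(z1)\<close> is injective or surjective because \<open>T\<close> is; the
    determinant upgrades this to bijectivity, which passes back to \<open>T\<close>.\<close>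
  have bijT: "bij T"
  proof -
    interpret finite_rank_perturbation "G z1" "J z1" "L z1" n u by (rule frp[OF z1(1)])
    have "bij (L z1)"
    proof (rule bij_if_det_nonzero, cases "inj T")
      case True
      show "det B \<noteq> 0" unfolding Lcomp
        by (rule det_nonzero_if_inj) (use True bijM[OF z1] in \<open>auto simp: Lcomp bij_def intro: inj_compose\<close>)
    next
      case False
      show "det B \<noteq> 0"
        by (rule det_nonzero_if_surj) (metis Tor False bijM[OF z1] Lcomp bij_is_surj comp_surj)
    qed
    moreover have "blinfun_apply T = blinfun_apply (L z1) \<circ> inv_into UNIV (M z1)"
      using bijM[OF z1] by (auto simp: Lcomp fun_eq_iff bij_is_surj surj_f_inv_f)
    ultimately show ?thesis using bijM[OF z1] by (metis bij_comp bij_imp_bij_inv)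
  qed
  have nz: "f z \<noteq> 0" if "z \<in> ball z0 d - {z0}" for z
  proof -
    have z: "z \<in> ball z0 d" "z \<noteq> z0" using that by auto
    interpret finite_rank_perturbation "G z" "J z" "L z" n u by (rule frp[OF z(1)])
    show ?thesis unfolding f_def
      by (rule det_nonzero_if_inj) (metis Lcomp bijT bijM[OF z] bij_comp bij_is_inj)
  qed
  obtain p d' c where lower: "0 < d'" "d' \<le> d" "0 < c" "\<And>z. z \<in> ball z0 d' \<Longrightarrow> c * cmod (z - z0) ^ p \<le> cmod (f z)"
    using holomorphic_lower_bound[OF hol d(1) nz] by metis
  define K where "K = fact n * 3 ^ n * 2 + 4 * real n * (real n * (fact (n - 1) * 3 ^ (n - 1)))"
  obtain CT where CT: "CT > 0" "\<And>x. norm (T x) \<le> CT * norm x"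
    using norm_bounded_clinear_bound[OF T] by metis
  have K: "K > 0" unfolding K_def by (intro add_pos_nonneg) auto
  show "\<exists>p d C. 0 < d \<and> d \<le> r \<and> 0 < C \<and>
      (\<forall>z\<in>ball z0 d. \<forall>x. cmod (z - z0) ^ p * norm x \<le> C * norm (M z x))"
  proof (rule exI[of _ p], rule exI[of _ d'], rule exI[of _ "K * CT / c"], intro conjI ballI allI)
    fix z and x :: 'a assume z: "z \<in> ball z0 d'"
    hence zd: "z \<in> ball z0 d" using lower(2) by auto
    have J2: "norm (J z) \<le> 2" by (rule J(2)[OF zd])
    interpret finite_rank_perturbation "G z" "J z" "L z" n u by (rule frp[OF zd])
    have "c * cmod (z - z0) ^ p * norm x \<le> cmod (f z) * norm x"
      using lower(4)[OF z] by (rule mult_right_mono) simp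
    also have "\<dots> \<le> K * norm (L z x)"
      unfolding f_def K_def by (rule inverse_bound[OF J2])
    also have "\<dots> \<le> K * (CT * norm (M z x))"
      using K CT(2) by (intro mult_left_mono) (auto simp: L_def)
    finally show "cmod (z - z0) ^ p * norm x \<le> K * CT / c * norm (M z x)"
      using lower(3) by (simp add: field_simps)
  qed (use lower d K CT in \<open>auto\<close>)
  show "surj (M z0)" if inj: "inj (M z0)"
  proof -
    have "{x. M z0 x = 0} = {0}" using inj by (auto dest: injD[of _ _ 0] simp: blinfun.zero_right)
    hence span0: "cspan (u ` {..<n}) = {0}" using ker by simp
    have "n = 0"
    proof (rule ccontr)
      assume "n \<noteq> 0"
      hence "u 0 \<in> cspan (u ` {..<n})" by (intro complex_vector.span_base) auto
      hence "u 0 = 0" using span0 by auto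
      thus False using orthonormal_family_cinner[OF u, of 0 0] \<open>n \<noteq> 0\<close> by simp
    qed
    hence "T (M z0 x) = x" for x by (simp add: TM)
    hence "M z0 (T y) = y" for y
      using bijT by (metis bij_is_inj injD)
    thus ?thesis by (metis surjI)
  qed
qed

section \<open>Contour integrals of operator-valued functions\<close>

text \<open>Bounded functionals commute with the integral. All statements about operator-valued integrals are
  deduced from scalar Cauchy theory through the functionals \<open>T \<mapsto> \<langle>y, T x\<rangle>\<close>.\<close>

lemma vec_contour_integral_functional:
  fixes f :: "complex \<Rightarrow> 'b::{complex_normed_vector,banach}" and \<Lambda> :: "'b \<Rightarrow> complex"
  assumes \<Lambda>: "bounded_clinear \<Lambda>" and f: "continuous_on (path_image (circlepath z r)) f"
  shows "\<Lambda> (vec_contour_integral (circlepath z r) f) = contour_integral (circlepath z r) (\<lambda>\<zeta>. \<Lambda> (f \<zeta>))"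
proof -
  define h where "h t = (2 * pi * \<i> * r * exp (2 * of_real pi * \<i> * of_real t)) *\<^sub>C f (circlepath z r t)" for t
  note sc = bounded_bilinear.continuous_on[OF bounded_bilinear_scaleC]
  have "continuous_on {0..1} (\<lambda>t. f (circlepath z r t))"
    by (rule continuous_on_compose2[OF f])
      (auto simp: path_image_def circlepath_def part_circlepath_def linepath_def intro!: continuous_intros)
  hence "continuous_on {0..1} h" unfolding h_def by (intro sc continuous_intros)
  hence int: "h integrable_on {0..1}" by (rule integrable_continuous_interval)
  have "vec_contour_integral (circlepath z r) f = integral {0..1} h"
    unfolding vec_contour_integral_def h_def
    by (rule integral_cong) (simp add: vector_derivative_circlepath01)
  hence "\<Lambda> (vec_contour_integral (circlepath z r) f) = integral {0..1} (\<Lambda> \<circ> h)"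
    using integral_linear[OF int clinear_bounded_linear[OF \<Lambda>]] by simp
  also have "\<dots> = contour_integral (circlepath z r) (\<lambda>\<zeta>. \<Lambda> (f \<zeta>))"
    unfolding contour_integral_integral
    by (rule integral_cong)
      (simp add: h_def clinear_scaleC[OF \<Lambda>] vector_derivative_circlepath mult.commute)
  finally show ?thesis .
qed

text \<open>The scalar facts about integrals around an isolated singularity that the functionals reduce
  everything to.\<close>

lemma circle_integral_removable:
  assumes f: "f holomorphic_on ball z0 e0 - {z0}" and e: "0 < e" "e < e0"
    and bd: "\<forall>\<^sub>F z in at z0. cmod (f z) \<le> C"
  shows "contour_integral (circlepath z0 e) f = 0"
proof -
  have "z0 \<in> interior (ball z0 e0)" using e by simp
  then obtain g where g: "g holomorphic_on ball z0 e0" "\<And>z. z \<in> ball z0 e0 - {z0} \<Longrightarrow> g z = f z"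
    using holomorphic_on_extend_bounded[OF f] bd by blast
  have sub: "path_image (circlepath z0 e) \<subseteq> ball z0 e0 - {z0}" using e by auto
  have "(g has_contour_integral 0) (circlepath z0 e)"
    by (rule Cauchy_theorem_convex_simple[OF g(1)]) (use sub in auto)
  hence "contour_integral (circlepath z0 e) g = 0" by (rule contour_integral_unique)
  moreover have "contour_integral (circlepath z0 e) g = contour_integral (circlepath z0 e) f"
    by (rule contour_integral_eq) (use g(2) sub in blast)
  ultimately show ?thesis by simp
qed

lemma circle_integral_power:
  assumes e: "0 < e"
  shows "((\<lambda>z. (z - z0) ^ l * (1 / (z - z0) ^ Suc j)) has_contour_integral (if l = j then 2 * of_real pi * \<i> else 0)) (circlepath z0 e)"
proof (cases "l \<le> j")
  case True
  then obtain k where k: "j = l + k" using le_Suc_ex by blast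
  have "((\<lambda>u. 1 / (u - z0) ^ Suc k) has_contour_integral (2 * pi * \<i>) / fact k * (deriv ^^ k) (\<lambda>_. 1) z0) (circlepath z0 e)"
    by (rule Cauchy_has_contour_integral_higher_derivative_circlepath) (use e in auto)
  moreover have "(2 * pi * \<i>) / fact k * (deriv ^^ k) (\<lambda>_. 1) z0 = (if l = j then 2 * of_real pi * \<i> else 0)"
    by (cases k) (auto simp: k higher_deriv_const)
  ultimately have "((\<lambda>u. 1 / (u - z0) ^ Suc k) has_contour_integral (if l = j then 2 * of_real pi * \<i> else 0)) (circlepath z0 e)"
    by simp
  moreover have "1 / (z - z0) ^ Suc k = (z - z0) ^ l * (1 / (z - z0) ^ Suc j)"
    if "z \<in> path_image (circlepath z0 e)" for z
  proof -
    have "z - z0 \<noteq> 0" using that e by auto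
    thus ?thesis by (simp add: k power_add field_simps)
  qed
  ultimately show ?thesis by (rule has_contour_integral_eq)
next
  case False
  then obtain k where k: "l = Suc j + k" using le_Suc_ex[of "Suc j" l] by auto
  have "((\<lambda>z. (z - z0) ^ k) has_contour_integral 0) (circlepath z0 e)"
    by (rule Cauchy_theorem_convex_simple[of _ UNIV]) (auto intro!: holomorphic_intros)
  moreover have "(z - z0) ^ k = (z - z0) ^ l * (1 / (z - z0) ^ Suc j)"
    if "z \<in> path_image (circlepath z0 e)" for z
  proof -
    have "z - z0 \<noteq> 0" using that e by auto
    thus ?thesis by (simp add: k power_add field_simps)
  qed
  ultimately have "((\<lambda>z. (z - z0) ^ l * (1 / (z - z0) ^ Suc j)) has_contour_integral 0) (circlepath z0 e)"
    by (rule has_contour_integral_eq)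
  thus ?thesis using k by simp
qed

section \<open>Resolvents\<close>

lemma linear_operatorD:
  assumes "linear_operator D A"
  shows "0 \<in> D" "x \<in> D \<Longrightarrow> y \<in> D \<Longrightarrow> x + y \<in> D" "x \<in> D \<Longrightarrow> c *\<^sub>C x \<in> D" "x \<in> D \<Longrightarrow> y \<in> D \<Longrightarrow> x - y \<in> D"
    "x \<in> D \<Longrightarrow> y \<in> D \<Longrightarrow> A (x + y) = A x + A y" "x \<in> D \<Longrightarrow> A (c *\<^sub>C x) = c *\<^sub>C A x"
    "x \<in> D \<Longrightarrow> y \<in> D \<Longrightarrow> A (x - y) = A x - A y" "x \<in> D \<Longrightarrow> - x \<in> D" "x \<in> D \<Longrightarrow> A (- x) = - A x" "A 0 = 0"
proof -
  have sub: "complex_vector.subspace D" and add: "\<And>x y. x \<in> D \<Longrightarrow> y \<in> D \<Longrightarrow> A (x + y) = A x + A y"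
    and sc: "\<And>c x. x \<in> D \<Longrightarrow> A (c *\<^sub>C x) = c *\<^sub>C A x"
    using assms by (auto simp: linear_operator_def)
  note subs = complex_vector.subspace_0[OF sub] complex_vector.subspace_add[OF sub]
    complex_vector.subspace_scale[OF sub] complex_vector.subspace_diff[OF sub] complex_vector.subspace_neg[OF sub]
  have neg: "A (- x) = - A x" if "x \<in> D" for x using sc[OF that, of "- 1"] by simp
  show "0 \<in> D" "x \<in> D \<Longrightarrow> y \<in> D \<Longrightarrow> x + y \<in> D" "x \<in> D \<Longrightarrow> c *\<^sub>C x \<in> D" "x \<in> D \<Longrightarrow> y \<in> D \<Longrightarrow> x - y \<in> D"
    "x \<in> D \<Longrightarrow> y \<in> D \<Longrightarrow> A (x + y) = A x + A y" "x \<in> D \<Longrightarrow> A (c *\<^sub>C x) = c *\<^sub>C A x"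
    "x \<in> D \<Longrightarrow> - x \<in> D" "x \<in> D \<Longrightarrow> A (- x) = - A x"
    using subs add sc neg by auto
  show "A (x - y) = A x - A y" if "x \<in> D" "y \<in> D"
    using add[OF that(1) subs(5)[OF that(2)]] neg[OF that(2)] by simp
  show "A 0 = 0" using sc[OF subs(1), of 0] by simp
qed

lemma linear_operator_sum:
  assumes "linear_operator D A" "\<And>i. i \<in> I \<Longrightarrow> f i \<in> D"
  shows "(\<Sum>i\<in>I. f i) \<in> D" "A (\<Sum>i\<in>I. f i) = (\<Sum>i\<in>I. A (f i))"
proof -
  have "(\<Sum>i\<in>I. f i) \<in> D \<and> A (\<Sum>i\<in>I. f i) = (\<Sum>i\<in>I. A (f i))"
    using assms(2)
    by (induction I rule: infinite_finite_induct) (auto simp: linear_operatorD[OF assms(1)])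
  thus "(\<Sum>i\<in>I. f i) \<in> D" "A (\<Sum>i\<in>I. f i) = (\<Sum>i\<in>I. A (f i))" by auto
qed

lemma resolvent_setI:
  assumes S: "bounded_clinear S" and D: "\<And>x. S x \<in> D" and r: "\<And>x. A (S x) - z *\<^sub>C S x = x"
    and l: "\<And>x. x \<in> D \<Longrightarrow> S (A x - z *\<^sub>C x) = x"
  shows "z \<in> resolvent_set D A"
proof -
  have inj: "inj_on (\<lambda>x. A x - z *\<^sub>C x) D" by (rule inj_on_inverseI[of _ S]) (rule l)
  have "bij_betw (\<lambda>x. A x - z *\<^sub>C x) D UNIV"
    unfolding bij_betw_def using inj D r by (auto intro!: image_eqI[of _ _ "S _"])
  moreover have "resolvent_fun D A z = S"
    unfolding resolvent_fun_def
    by (rule ext, rule inv_into_f_eq[OF inj]) (use D r in auto)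
  ultimately show ?thesis using S by (simp add: resolvent_set_def)
qed

lemma resolvent_props:
  assumes z: "z \<in> resolvent_set D A"
  shows resolvent_apply: "blinfun_apply (resolvent D A z) = resolvent_fun D A z"
    and resolvent_clinear: "bounded_clinear (resolvent D A z)"
    and resolvent_mem: "resolvent D A z x \<in> D"
    and resolvent_right: "A (resolvent D A z x) - z *\<^sub>C resolvent D A z x = x"
    and resolvent_left: "y \<in> D \<Longrightarrow> resolvent D A z (A y - z *\<^sub>C y) = y"
proof -
  have bij: "bij_betw (\<lambda>x. A x - z *\<^sub>C x) D UNIV" and bc: "bounded_clinear (resolvent_fun D A z)"
    using z by (auto simp: resolvent_set_def)
  show app: "blinfun_apply (resolvent D A z) = resolvent_fun D A z"
    unfolding resolvent_def by (rule blinfun_apply_Blinfun_clinear[OF bc])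
  show "bounded_clinear (resolvent D A z)" using bc app by simp
  have im: "(\<lambda>x. A x - z *\<^sub>C x) ` D = UNIV" and inj: "inj_on (\<lambda>x. A x - z *\<^sub>C x) D"
    using bij by (auto simp: bij_betw_def)
  show "resolvent D A z x \<in> D"
    unfolding app resolvent_fun_def by (rule inv_into_into) (simp add: im)
  show "A (resolvent D A z x) - z *\<^sub>C resolvent D A z x = x"
    unfolding app resolvent_fun_def
    using f_inv_into_f[of x "\<lambda>x. A x - z *\<^sub>C x" D] im by simp
  show "resolvent D A z (A y - z *\<^sub>C y) = y" if "y \<in> D"
    unfolding app resolvent_fun_def by (rule inv_into_f_f[OF inj that])
qed

lemma resolvent_identity:
  assumes z: "z \<in> resolvent_set D A" and w: "w \<in> resolvent_set D A"
  shows "resolvent D A z x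
    = resolvent D A w x + (z - w) *\<^sub>C resolvent D A w (resolvent D A z x)"
proof -
  define y where "y = resolvent D A z x"
  have y: "y \<in> D" "A y - z *\<^sub>C y = x" unfolding y_def using resolvent_mem[OF z] resolvent_right[OF z] by auto
  have "A y - w *\<^sub>C y = x + (z - w) *\<^sub>C y" unfolding y(2)[symmetric] by (simp add: scaleC_diff_left)
  hence "y = resolvent D A w (x + (z - w) *\<^sub>C y)" using resolvent_left[OF w y(1)] by simp
  thus ?thesis
    by (simp add: y_def clinear_simps[OF resolvent_clinear[OF w]])
qed

lemma resolvent_diff:
  assumes "z \<in> resolvent_set D A" "w \<in> resolvent_set D A"
  shows "resolvent D A z x - resolvent D A w x
    = (z - w) *\<^sub>C resolvent D A w (resolvent D A z x)"
  by (subst resolvent_identity[OF assms]) simp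

text \<open>On \<open>D\<close> one has \<open>A - w = (I + (z - w) R(z)) (A - z)\<close>, and the first factor is invertible for \<open>w\<close>
  near \<open>z\<close>.\<close>

lemma open_resolvent_set:
  fixes D :: "'a::complex_hilbert_space set"
  assumes lin: "linear_operator D A"
  shows "open (resolvent_set D A)"
  unfolding open_dist
proof
  fix z assume z: "z \<in> resolvent_set D A"
  define R where "R = resolvent D A z"
  note R = resolvent_clinear[OF z, folded R_def] and Rmem = resolvent_mem[OF z, folded R_def]
    and Rright = resolvent_right[OF z, folded R_def] and Rleft = resolvent_left[OF z, folded R_def]
  define N where "N = norm R + 1"
  have N: "N > 0" unfolding N_def using norm_ge_zero[of R] by linarith
  define e where "e = 1 / (2 * N)"
  have e: "e > 0" using N by (simp add: e_def)
  have "w \<in> resolvent_set D A" if w: "dist w z < e" for w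
  proof -
    define E where "E = (z - w) *\<^sub>C R"
    have Eb: "bounded_clinear E"
      unfolding E_def scaleC_blinfun.rep_eq by (rule clinear_scaleC_fun[OF R])
    have "norm E \<le> e * N" unfolding N_def E_def norm_scaleC
      using w e by (intro mult_mono) (auto simp: dist_norm norm_minus_commute)
    also have "\<dots> = 1/2" using N by (simp add: e_def)
    finally have small: "norm E \<le> 1/2" .
    then obtain J :: "'a \<Rightarrow>\<^sub>L 'a" where J: "bounded_clinear J" and "norm J \<le> 2" and J': "\<And>x. J (x + E x) = x"
      "\<And>y. J y + E (J y) = y"
      using identity_plus_small_inverse[OF Eb small] by metis
    have key: "A y - w *\<^sub>C y = v + E v" if "y \<in> D" "v = A y - z *\<^sub>C y" for y v
      using Rleft[OF that(1)] that(2) by (simp add: E_def scaleC_diff_left[of _ _ y])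
    show ?thesis
    proof (rule resolvent_setI[where S = "\<lambda>x. R (J x)"])
      show "bounded_clinear (\<lambda>x. R (J x))" by (rule clinear_compose[OF R J])
      show "A (R (J x)) - w *\<^sub>C R (J x) = x" for x
        using key[OF Rmem, of "J x" "J x"] Rright J'(2) by simp
      show "R (J (A x - w *\<^sub>C x)) = x" if "x \<in> D" for x
        unfolding key[OF that refl] J'(1) by (rule Rleft[OF that])
    qed (rule Rmem)
  qed
  thus "\<exists>e>0. \<forall>w. dist w z < e \<longrightarrow> w \<in> resolvent_set D A" using e by blast
qed

text \<open>The resolvent identity bounds \<open>R(w) - R(z)\<close> by \<open>|w - z| norm R(z) norm R(w)\<close>; for small \<open>|w - z|\<close> it
  also gives \<open>norm R(w) \<le> 2 norm R(z)\<close> up to an additive constant.\<close>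

lemma isCont_resolvent:
  fixes D :: "'a::complex_hilbert_space set"
  assumes lin: "linear_operator D A" and z: "z \<in> resolvent_set D A"
  shows "isCont (resolvent D A) z"
proof -
  define R where "R = resolvent D A"
  define c where "c = norm (R z) + 1"
  have c: "c > 0" "norm (R z) \<le> c" unfolding c_def using norm_ge_zero[of "R z"] by (linarith, simp)
  have bound: "norm (R w - R z) \<le> cmod (w - z) * (2 * c * c)"
    if w: "w \<in> resolvent_set D A" "cmod (w - z) * c \<le> 1/2" for w
  proof -
    have eq: "R w - R z = (w - z) *\<^sub>C (R z o\<^sub>L R w)"
      by (rule blinfun_eqI) (simp add: R_def blinfun.diff_left resolvent_diff[OF w(1) z])
    have le: "norm (R w - R z) \<le> cmod (w - z) * (c * norm (R w))"
      unfolding eq norm_scaleC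
      by (intro mult_left_mono order_trans[OF norm_blinfun_compose] mult_right_mono c) auto
    have "norm (R w) \<le> norm (R z) + norm (R w - R z)" using norm_triangle_ineq[of "R z" "R w - R z"] by simp
    also have "\<dots> \<le> c + (cmod (w - z) * c) * norm (R w)" using le c by (simp add: mult_ac)
    also have "\<dots> \<le> c + 1/2 * norm (R w)" using w(2) by (intro add_left_mono mult_right_mono) auto
    finally have "norm (R w) \<le> 2 * c" by simp
    hence "cmod (w - z) * (c * norm (R w)) \<le> cmod (w - z) * (c * (2 * c))"
      using c by (intro mult_left_mono) auto
    thus ?thesis using le by (simp add: mult_ac)
  qed
  have "((\<lambda>w. R w - R z) \<longlongrightarrow> 0) (at z)"
  proof (rule Lim_null_comparison)
    have "((\<lambda>w. cmod (w - z) * c) \<longlongrightarrow> cmod (z - z) * c) (at z)" by (intro tendsto_intros)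
    hence "\<forall>\<^sub>F w in at z. cmod (w - z) * c < 1/2" by (rule order_tendstoD) simp
    moreover have "\<forall>\<^sub>F w in at z. w \<in> resolvent_set D A"
      using open_resolvent_set[OF lin] z by (simp add: eventually_at_in_open')
    ultimately show "\<forall>\<^sub>F w in at z. norm (R w - R z) \<le> cmod (w - z) * (2 * c * c)"
      by eventually_elim (use bound in auto)
    have "((\<lambda>w. cmod (w - z) * (2 * c * c)) \<longlongrightarrow> cmod (z - z) * (2 * c * c)) (at z)" by (intro tendsto_intros)
    thus "((\<lambda>w. cmod (w - z) * (2 * c * c)) \<longlongrightarrow> 0) (at z)" by simp
  qed
  thus ?thesis unfolding isCont_def R_def by (rule LIM_zero_cancel)
qed

lemma has_norm_derivative_resolvent:
  fixes D :: "'a::complex_hilbert_space set"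
  assumes lin: "linear_operator D A" and z: "z \<in> resolvent_set D A"
  shows "has_norm_derivative (resolvent D A) (resolvent D A z o\<^sub>L resolvent D A z) z"
  unfolding has_norm_derivative_def
proof (rule Lim_transform_eventually)
  show "((\<lambda>w. resolvent D A z o\<^sub>L resolvent D A w) \<longlongrightarrow> resolvent D A z o\<^sub>L resolvent D A z) (at z)"
    using isCont_resolvent[OF lin z] unfolding isCont_def
    by (intro bounded_bilinear.tendsto[OF bounded_bilinear_blinfun_compose] tendsto_const)
  have "resolvent D A z o\<^sub>L resolvent D A w = (1 / (w - z)) *\<^sub>C (resolvent D A w - resolvent D A z)"
    if "w \<in> resolvent_set D A" "w \<noteq> z" for w
    by (rule blinfun_eqI)
      (use that(2) in \<open>simp add: blinfun.diff_left resolvent_diff[OF that(1) z]\<close>)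
  moreover have "\<forall>\<^sub>F w in at z. w \<in> resolvent_set D A \<and> w \<noteq> z"
    using open_resolvent_set[OF lin] z by (simp add: eventually_at_in_open' eventually_conj_iff eventually_neq_at_within)
  ultimately show "\<forall>\<^sub>F w in at z. resolvent D A z o\<^sub>L resolvent D A w = (1 / (w - z)) *\<^sub>C (resolvent D A w - resolvent D A z)"
    by (auto elim: eventually_mono)
qed

section \<open>The Laurent coefficients of a resolvent at a pole\<close>

lemma cinner_eqI: "(\<And>v. cinner v a = cinner v (b::'a::complex_hilbert_space)) \<Longrightarrow> a = b"
  by (metis cinner_diff_right cinner_self_eq_0 eq_iff_diff_eq_0)

text \<open>A finite Jordan chain of \<open>A\<close> at \<open>z0\<close>, listed from the generating vector down to the eigenvector
  and continued by zeros.\<close>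

definition jordan_sequence ::
  "'a::complex_normed_vector set \<Rightarrow> ('a \<Rightarrow> 'a) \<Rightarrow> complex \<Rightarrow> nat \<Rightarrow> (nat \<Rightarrow> 'a) \<Rightarrow> bool" where
  "jordan_sequence D A z0 k \<psi> \<longleftrightarrow>
     (\<forall>i. \<psi> i \<in> D \<and> A (\<psi> i) - z0 *\<^sub>C \<psi> i = \<psi> (Suc i)) \<and> (\<forall>i\<ge>k. \<psi> i = 0)"

text \<open>Applying \<open>A - z = (A - z0) - (z - z0)\<close> to a principal part shifts its coefficients. The recursion for
  \<open>\<psi>\<close> makes the shifts cancel up to the first term.\<close>

lemma principal_part_telescope:
  assumes lin: "linear_operator D A" and D: "\<And>l. \<psi> l \<in> D"
    and step: "\<And>l. l < k \<Longrightarrow> A (\<psi> l) - z0 *\<^sub>C \<psi> l = g l + \<psi> (Suc l)" and k0: "\<psi> k = 0" and z: "z \<noteq> z0"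
  defines "s \<equiv> \<Sum>l<k. (1 / (z - z0) ^ Suc l) *\<^sub>C \<psi> l"
  shows "s \<in> D" "A s - z *\<^sub>C s = (\<Sum>l<k. (1 / (z - z0) ^ Suc l) *\<^sub>C g l) - \<psi> 0"
proof -
  define b where "b l = 1 / (z - z0) ^ l" for l
  have b: "b (Suc l) * (z - z0) = b l" for l using z by (simp add: b_def)
  have s: "s = (\<Sum>l<k. b (Suc l) *\<^sub>C \<psi> l)" unfolding s_def b_def ..
  show "s \<in> D" unfolding s by (rule linear_operator_sum(1)[OF lin]) (rule linear_operatorD(3)[OF lin D])
  have "A s = (\<Sum>l<k. A (b (Suc l) *\<^sub>C \<psi> l))"
    unfolding s by (rule linear_operator_sum(2)[OF lin]) (rule linear_operatorD(3)[OF lin D])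
  hence "A s - z *\<^sub>C s = (\<Sum>l<k. A (b (Suc l) *\<^sub>C \<psi> l) - z *\<^sub>C b (Suc l) *\<^sub>C \<psi> l)"
    unfolding s scaleC_sum_right sum_subtractf by simp
  also have "\<dots> = (\<Sum>l<k. b (Suc l) *\<^sub>C g l + (b (Suc l) *\<^sub>C \<psi> (Suc l) - b l *\<^sub>C \<psi> l))"
  proof (rule sum.cong)
    fix l assume "l \<in> {..<k}"
    hence "A (\<psi> l) = g l + \<psi> (Suc l) + z0 *\<^sub>C \<psi> l" using step[of l] by (simp add: diff_eq_eq)
    hence "A (b (Suc l) *\<^sub>C \<psi> l) - z *\<^sub>C b (Suc l) *\<^sub>C \<psi> l
        = b (Suc l) *\<^sub>C g l + b (Suc l) *\<^sub>C \<psi> (Suc l) - (z * b (Suc l) - b (Suc l) * z0) *\<^sub>C \<psi> l"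
      unfolding linear_operatorD(6)[OF lin D] scaleC_diff_left by (simp add: scaleC_add_right)
    also have "z * b (Suc l) - b (Suc l) * z0 = b l" by (simp add: b[of l, symmetric] algebra_simps)
    finally show "A (b (Suc l) *\<^sub>C \<psi> l) - z *\<^sub>C b (Suc l) *\<^sub>C \<psi> l
        = b (Suc l) *\<^sub>C g l + (b (Suc l) *\<^sub>C \<psi> (Suc l) - b l *\<^sub>C \<psi> l)" by simp
  qed simp
  also have "\<dots> = (\<Sum>l<k. b (Suc l) *\<^sub>C g l) - \<psi> 0"
    unfolding sum.distrib sum_lessThan_telescope[of "\<lambda>l. b l *\<^sub>C \<psi> l" k] by (simp add: k0 b_def)
  finally show "A s - z *\<^sub>C s = (\<Sum>l<k. (1 / (z - z0) ^ Suc l) *\<^sub>C g l) - \<psi> 0" unfolding b_def .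
qed

lemma resolvent_jordan_sequence:
  assumes lin: "linear_operator D A" and \<psi>: "jordan_sequence D A z0 k \<psi>"
    and z: "z \<in> resolvent_set D A" "z \<noteq> z0"
  shows "resolvent D A z (\<psi> 0) = - (\<Sum>l<k. (1 / (z - z0) ^ Suc l) *\<^sub>C \<psi> l)"
proof -
  define s where "s = (\<Sum>l<k. (1 / (z - z0) ^ Suc l) *\<^sub>C \<psi> l)"
  have s: "s \<in> D" "A s - z *\<^sub>C s = - \<psi> 0"
    using principal_part_telescope[OF lin, of \<psi> k z0 "\<lambda>_. 0" z] \<psi> z(2)
    by (auto simp: jordan_sequence_def s_def)
  have "resolvent D A z (- \<psi> 0) = s" using resolvent_left[OF z(1) s(1)] s(2) by simp
  hence "- resolvent D A z (\<psi> 0) = s" by (simp only: clinear_minus[OF resolvent_clinear[OF z(1)]])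
  thus ?thesis unfolding s_def by (metis minus_minus)
qed

text \<open>The pole enters as a growth bound because that is what the analytic Fredholm theorem delivers;
  \<open>e\<close> is the radius of the contour used below.\<close>

locale isolated_pole =
  fixes D :: "'a::complex_hilbert_space set" and A :: "'a \<Rightarrow> 'a" and z0 :: complex
    and e0 e d C :: real and p :: nat
  assumes lin: "linear_operator D A"
    and punctured: "ball z0 e0 - {z0} \<subseteq> resolvent_set D A"
    and spec: "z0 \<in> spectrum D A"
    and e: "0 < e" "e < e0"
    and d: "0 < d"
    and pole: "\<And>z x. z \<in> ball z0 d - {z0} \<Longrightarrow> z \<in> resolvent_set D A \<Longrightarrow>
      cmod (z - z0) ^ p * norm (resolvent D A z x) \<le> C * norm x"
begin

abbreviation R where "R \<equiv> resolvent D A"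

abbreviation circle_integral where "circle_integral \<equiv> contour_integral (circlepath z0 e)"

text \<open>Up to the sign, the coefficient of \<open>(z - z0)\<^sup>-\<^sup>l\<^sup>-\<^sup>1\<close> in the Laurent expansion of the resolvent; the
  sign makes the zeroth one the Riesz projection.\<close>

definition coeff :: "nat \<Rightarrow> 'a \<Rightarrow>\<^sub>L 'a" where
  "coeff l = (- 1 / (2 * of_real pi * \<i>)) *\<^sub>C
     vec_contour_integral (circlepath z0 e) (\<lambda>\<zeta>. (\<zeta> - z0) ^ l *\<^sub>C R \<zeta>)"

lemma circle_subset: "path_image (circlepath z0 e) \<subseteq> ball z0 e0 - {z0}"
  using e by auto

lemma circle_resolvent: "\<zeta> \<in> path_image (circlepath z0 e) \<Longrightarrow> \<zeta> \<in> resolvent_set D A"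
  using circle_subset punctured by blast

lemma not_spec: "w \<in> resolvent_set D A \<Longrightarrow> w \<noteq> z0"
  using spec by (auto simp: spectrum_def)

lemma R_holomorphic:
  assumes "bounded_clinear \<Lambda>"
  shows "(\<lambda>\<zeta>. \<Lambda> (R \<zeta> x)) holomorphic_on resolvent_set D A"
  unfolding holomorphic_on_open[OF open_resolvent_set[OF lin]]
  using has_norm_derivative_clinear[OF clinear_compose[OF assms clinear_eval]
      has_norm_derivative_resolvent[OF lin]]
  unfolding has_norm_derivative_field by blast

lemma R_continuous: "continuous_on (resolvent_set D A) (\<lambda>\<zeta>. (\<zeta> - z0) ^ l *\<^sub>C R \<zeta>)"
proof (rule continuous_at_imp_continuous_on, rule ballI)
  fix \<zeta> assume \<zeta>: "\<zeta> \<in> resolvent_set D A"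
  have "isCont (\<lambda>\<zeta>. (\<zeta> - z0) ^ l) \<zeta>" by (intro continuous_intros)
  thus "isCont (\<lambda>\<zeta>. (\<zeta> - z0) ^ l *\<^sub>C R \<zeta>) \<zeta>"
    unfolding isCont_def
    by (rule bounded_bilinear.tendsto[OF bounded_bilinear_scaleC _ isCont_resolvent[OF lin \<zeta>, unfolded isCont_def]])
qed

lemma integrable_power_R:
  assumes "bounded_clinear \<Lambda>"
  shows "(\<lambda>\<zeta>. (\<zeta> - z0) ^ l * \<Lambda> (R \<zeta> x)) contour_integrable_on circlepath z0 e"
proof (rule contour_integrable_continuous_circlepath, rule holomorphic_on_imp_continuous_on)
  have "(\<lambda>\<zeta>. \<Lambda> (R \<zeta> x)) holomorphic_on path_image (circlepath z0 e)"
    by (rule holomorphic_on_subset[OF R_holomorphic[OF assms]]) (use circle_resolvent in blast)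
  thus "(\<lambda>\<zeta>. (\<zeta> - z0) ^ l * \<Lambda> (R \<zeta> x)) holomorphic_on path_image (circlepath z0 e)"
    by (intro holomorphic_intros)
qed

lemma coeff_functional:
  assumes \<Lambda>: "bounded_clinear \<Lambda>"
  shows "\<Lambda> (coeff l x) = (- 1 / (2 * of_real pi * \<i>)) *
    circle_integral (\<lambda>\<zeta>. (\<zeta> - z0) ^ l * \<Lambda> (R \<zeta> x))"
proof -
  have \<Lambda>': "bounded_clinear (\<lambda>T. \<Lambda> (blinfun_apply T x))"
    by (rule clinear_compose[OF \<Lambda> clinear_eval])
  have "continuous_on (path_image (circlepath z0 e)) (\<lambda>\<zeta>. (\<zeta> - z0) ^ l *\<^sub>C R \<zeta>)"
    by (rule continuous_on_subset[OF R_continuous]) (use circle_resolvent in blast)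
  note eq = vec_contour_integral_functional[OF \<Lambda>' this]
  show ?thesis
    unfolding coeff_def blinfun_apply_scaleC clinear_scaleC[OF \<Lambda>] eq by simp
qed

lemma coeff_clinear: "bounded_clinear (coeff l)"
  unfolding bounded_clinear_def
proof (intro conjI allI)
  fix c x
  show "coeff l (c *\<^sub>C x) = c *\<^sub>C coeff l x"
  proof (rule cinner_eqI)
    fix v
    have "circle_integral (\<lambda>\<zeta>. (\<zeta> - z0) ^ l * cinner v (R \<zeta> (c *\<^sub>C x)))
        = circle_integral (\<lambda>\<zeta>. c * ((\<zeta> - z0) ^ l * cinner v (R \<zeta> x)))"
      by (rule contour_integral_eq)
        (simp add: clinear_scaleC[OF resolvent_clinear[OF circle_resolvent]] cinner_scaleC_right)
    also have "\<dots> = c * circle_integral (\<lambda>\<zeta>. (\<zeta> - z0) ^ l * cinner v (R \<zeta> x))"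
      by (rule contour_integral_lmul[OF integrable_power_R[OF clinear_cinner]])
    finally show "cinner v (coeff l (c *\<^sub>C x)) = cinner v (c *\<^sub>C coeff l x)"
      by (simp add: coeff_functional[OF clinear_cinner] cinner_scaleC_right)
  qed
qed (rule blinfun.bounded_linear_right)

text \<open>For \<open>l \<ge> p\<close> the integrand is bounded near \<open>z0\<close>, so the singularity is removable.\<close>

lemma coeff_vanishes:
  assumes "p \<le> l" shows "coeff l x = 0"
proof (rule cinner_eqI)
  fix v
  have "circle_integral (\<lambda>\<zeta>. (\<zeta> - z0) ^ l * cinner v (R \<zeta> x)) = 0"
  proof (rule circle_integral_removable[OF _ e])
    have "(\<lambda>\<zeta>. cinner v (R \<zeta> x)) holomorphic_on ball z0 e0 - {z0}"
      by (rule holomorphic_on_subset[OF R_holomorphic[OF clinear_cinner] punctured])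
    thus "(\<lambda>\<zeta>. (\<zeta> - z0) ^ l * cinner v (R \<zeta> x)) holomorphic_on ball z0 e0 - {z0}"
      by (intro holomorphic_intros)
    define m where "m = min (min d e0) 1"
    have "\<forall>\<^sub>F z in at z0. z \<in> ball z0 m - {z0}"
      using d e by (intro eventually_at_in_open) (auto simp: m_def)
    thus "\<forall>\<^sub>F z in at z0. cmod ((z - z0) ^ l * cinner v (R z x)) \<le> norm v * (C * norm x)"
    proof (rule eventually_mono)
      fix z assume z: "z \<in> ball z0 m - {z0}"
      have zd: "z \<in> ball z0 d - {z0}" "z \<in> resolvent_set D A" using z punctured by (auto simp: m_def)
      have "cmod ((z - z0) ^ l * cinner v (R z x))
          = cmod (z - z0) ^ (l - p) * (cmod (z - z0) ^ p * cmod (cinner v (R z x)))"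
        using assms by (simp add: norm_mult norm_power flip: power_add mult.assoc)
      also have "\<dots> \<le> 1 * (cmod (z - z0) ^ p * cmod (cinner v (R z x)))"
        using z by (intro mult_right_mono power_le_one) (auto simp: m_def dist_norm norm_minus_commute)
      also have "\<dots> \<le> cmod (z - z0) ^ p * (norm v * norm (R z x))"
        unfolding mult_1 by (intro mult_left_mono cauchy_schwarz) simp
      also have "\<dots> = norm v * (cmod (z - z0) ^ p * norm (R z x))" by (simp add: mult_ac)
      also have "\<dots> \<le> norm v * (C * norm x)" by (intro mult_left_mono pole zd) simp
      finally show "cmod ((z - z0) ^ l * cinner v (R z x)) \<le> norm v * (C * norm x)" .
    qed
  qed
  thus "cinner v (coeff l x) = cinner v 0"
    by (simp add: coeff_functional[OF clinear_cinner])
qed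

text \<open>The recursion between the coefficients is obtained with the bounded operator \<open>R w\<close> instead of
  \<open>A\<close>, so that nothing unbounded has to be moved under the integral.\<close>

lemma coeff_resolvent:
  assumes w: "w \<in> resolvent_set D A"
  shows "R w (coeff (Suc l) x - (w - z0) *\<^sub>C coeff l x)
    = coeff l x"
proof (rule cinner_eqI)
  fix v
  note Rw = resolvent_clinear[OF w]
  define c where "c = (- 1 / (2 * of_real pi * \<i>) :: complex)"
  define F where "F l \<zeta> = (\<zeta> - z0) ^ l * cinner v (R w (R \<zeta> x))" for l \<zeta>
  define G where "G \<zeta> = (\<zeta> - z0) ^ l * cinner v (R \<zeta> x)" for \<zeta>
  define g where "g = cinner v (R w x)"
  have \<Lambda>: "bounded_clinear (\<lambda>y. cinner v (R w y))"
    by (rule clinear_compose[OF clinear_cinner Rw])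
  have intF: "F l contour_integrable_on circlepath z0 e" for l
    unfolding F_def by (rule integrable_power_R[OF \<Lambda>])
  have intG: "G contour_integrable_on circlepath z0 e"
    unfolding G_def by (rule integrable_power_R[OF clinear_cinner])
  have intp: "(\<lambda>\<zeta>. (\<zeta> - z0) ^ l * g) contour_integrable_on circlepath z0 e"
    by (intro contour_integrable_continuous_circlepath continuous_intros)
  have zero: "circle_integral (\<lambda>\<zeta>. (\<zeta> - z0) ^ l * g) = 0"
    by (rule contour_integral_unique, rule Cauchy_theorem_convex_simple[of _ UNIV])
      (auto intro!: holomorphic_intros)
  have "circle_integral (F (Suc l)) - (w - z0) * circle_integral (F l)
      = circle_integral (\<lambda>\<zeta>. F (Suc l) \<zeta> - (w - z0) * F l \<zeta>)"
    by (simp add: contour_integral_diff contour_integrable_lmul intF contour_integral_lmul[OF intF])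
  also have "\<dots> = circle_integral (\<lambda>\<zeta>. G \<zeta> - (\<zeta> - z0) ^ l * g)"
  proof (rule contour_integral_eq)
    fix \<zeta> assume "\<zeta> \<in> path_image (circlepath z0 e)"
    hence \<zeta>: "\<zeta> \<in> resolvent_set D A" by (rule circle_resolvent)
    have "F (Suc l) \<zeta> - (w - z0) * F l \<zeta>
        = (\<zeta> - z0) ^ l * cinner v ((\<zeta> - w) *\<^sub>C R w (R \<zeta> x))"
      unfolding cinner_scaleC_right F_def by (simp add: algebra_simps)
    also have "\<dots> = G \<zeta> - (\<zeta> - z0) ^ l * g"
      unfolding resolvent_diff[OF \<zeta> w, symmetric] by (simp add: G_def g_def cinner_diff_right right_diff_distrib)
    finally show "F (Suc l) \<zeta> - (w - z0) * F l \<zeta> = G \<zeta> - (\<zeta> - z0) ^ l * g" .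
  qed
  also have "\<dots> = circle_integral G"
    by (simp add: contour_integral_diff[OF intG intp] zero)
  finally have eq: "circle_integral (F (Suc l)) - (w - z0) * circle_integral (F l)
      = circle_integral G" .
  have IF: "cinner v (R w (coeff l x)) = c * circle_integral (F l)" for l
    unfolding F_def c_def by (rule coeff_functional[OF \<Lambda>])
  have "cinner v (R w (coeff (Suc l) x - (w - z0) *\<^sub>C coeff l x))
      = c * circle_integral (F (Suc l)) - (w - z0) * (c * circle_integral (F l))"
    unfolding clinear_simps[OF Rw] cinner_diff_right cinner_scaleC_right IF ..
  also have "\<dots> = c * circle_integral G" unfolding eq[symmetric] by (simp add: algebra_simps)
  also have "\<dots> = cinner v (coeff l x)"
    unfolding coeff_functional[OF clinear_cinner] c_def G_def ..
  finally show "cinner v (R w (coeff (Suc l) x - (w - z0) *\<^sub>C coeff l x))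
    = cinner v (coeff l x)" .
qed

lemma R_commute:
  assumes "w \<in> resolvent_set D A" "z \<in> resolvent_set D A"
  shows "R w (R z x) = R z (R w x)"
proof (cases "w = z")
  case False
  have "(w - z) *\<^sub>C R w (R z x)
      = - ((z - w) *\<^sub>C R w (R z x))"
    by (simp flip: scaleC_minus_left)
  also have "\<dots> = (w - z) *\<^sub>C R z (R w x)"
    unfolding resolvent_diff[OF assms(2,1), symmetric] resolvent_diff[OF assms(1,2), symmetric] by simp
  finally have "(1 / (w - z)) *\<^sub>C (w - z) *\<^sub>C R w (R z x)
      = (1 / (w - z)) *\<^sub>C (w - z) *\<^sub>C R z (R w x)" by (rule arg_cong)
  thus ?thesis using False by simp
qed simp

lemma coeff_commute:
  assumes w: "w \<in> resolvent_set D A"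
  shows "coeff l (R w x) = R w (coeff l x)"
proof (rule cinner_eqI)
  fix v
  have "circle_integral (\<lambda>\<zeta>. (\<zeta> - z0) ^ l * cinner v (R \<zeta> (R w x)))
      = circle_integral (\<lambda>\<zeta>. (\<zeta> - z0) ^ l * cinner v (R w (R \<zeta> x)))"
    by (rule contour_integral_eq) (simp add: R_commute[OF w circle_resolvent])
  thus "cinner v (coeff l (R w x)) = cinner v (R w (coeff l x))"
    unfolding coeff_functional[OF clinear_cinner]
      coeff_functional[OF clinear_compose[OF clinear_cinner resolvent_clinear[OF w]]]
    by simp
qed

lemma some_resolvent_point: obtains w where "w \<in> resolvent_set D A"
proof -
  have "z0 + of_real e \<in> ball z0 e0 - {z0}" using e by (auto simp: dist_norm)
  thus thesis using that punctured by blast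
qed

lemma coeff_step:
  "coeff l x \<in> D"
  "A (coeff l x) - z0 *\<^sub>C coeff l x = coeff (Suc l) x"
proof -
  obtain w where w: "w \<in> resolvent_set D A" by (rule some_resolvent_point)
  define y where "y = coeff (Suc l) x - (w - z0) *\<^sub>C coeff l x"
  have eq: "coeff l x = R w y"
    unfolding y_def by (rule coeff_resolvent[OF w, symmetric])
  show "coeff l x \<in> D" unfolding eq by (rule resolvent_mem[OF w])
  have "A (coeff l x) - w *\<^sub>C coeff l x = y"
    unfolding eq by (rule resolvent_right[OF w])
  thus "A (coeff l x) - z0 *\<^sub>C coeff l x = coeff (Suc l) x"
    by (simp add: y_def scaleC_diff_left algebra_simps)
qed

text \<open>The other order of the product follows because the coefficients commute with \<open>R w\<close>.\<close>

lemma coeff_operator: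
  assumes x: "x \<in> D"
  shows "coeff l (A x - z0 *\<^sub>C x) = coeff (Suc l) x"
proof -
  obtain w where w: "w \<in> resolvent_set D A" by (rule some_resolvent_point)
  define y where "y = A x - w *\<^sub>C x"
  have xy: "R w y = x" unfolding y_def by (rule resolvent_left[OF w x])
  have "coeff l y = R w (coeff (Suc l) y)
      - (w - z0) *\<^sub>C R w (coeff l y)"
    using coeff_resolvent[OF w, of l y]
    by (simp add: clinear_simps[OF resolvent_clinear[OF w]])
  also have "\<dots> = coeff (Suc l) x - (w - z0) *\<^sub>C coeff l x"
    by (simp add: coeff_commute[OF w, symmetric] xy)
  finally have "coeff l (y + (w - z0) *\<^sub>C x) = coeff (Suc l) x"
    by (simp add: clinear_simps[OF coeff_clinear])
  moreover have "y + (w - z0) *\<^sub>C x = A x - z0 *\<^sub>C x" by (simp add: y_def scaleC_diff_left)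
  ultimately show ?thesis by simp
qed

text \<open>On a generalized eigenvector the resolvent is a finite Laurent sum, whose residues can be read off.\<close>

lemma coeff_jordan_sequence:
  assumes \<psi>: "jordan_sequence D A z0 k \<psi>"
  shows "coeff l (\<psi> 0) = \<psi> l"
proof (rule cinner_eqI)
  fix v
  have integral: "((\<lambda>\<zeta>. \<Sum>j<k. ((\<zeta> - z0) ^ l * (1 / (\<zeta> - z0) ^ Suc j)) * - cinner v (\<psi> j)) has_contour_integral
      (\<Sum>j<k. (if l = j then 2 * of_real pi * \<i> else 0) * - cinner v (\<psi> j))) (circlepath z0 e)"
    by (intro has_contour_integral_sum has_contour_integral_rmul circle_integral_power e finite_lessThan)
  have single: "(\<Sum>j<k. (if l = j then 2 * of_real pi * \<i> else 0) * - cinner v (\<psi> j))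
      = - (2 * of_real pi * \<i>) * cinner v (\<psi> l)"
  proof (cases "l < k")
    case True
    have "(\<Sum>j<k. (if l = j then 2 * of_real pi * \<i> else 0) * - cinner v (\<psi> j))
        = (\<Sum>j<k. if j = l then - (2 * of_real pi * \<i>) * cinner v (\<psi> l) else 0)"
      by (rule sum.cong) auto
    thus ?thesis using True by simp
  next
    case False
    hence "\<psi> l = 0" using \<psi> by (auto simp: jordan_sequence_def)
    thus ?thesis using False by (auto intro!: sum.neutral)
  qed
  have "circle_integral (\<lambda>\<zeta>. \<Sum>j<k. ((\<zeta> - z0) ^ l * (1 / (\<zeta> - z0) ^ Suc j)) * - cinner v (\<psi> j))
      = - (2 * of_real pi * \<i>) * cinner v (\<psi> l)" by (rule trans[OF contour_integral_unique[OF integral] single])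
  moreover have "circle_integral (\<lambda>\<zeta>. \<Sum>j<k. ((\<zeta> - z0) ^ l * (1 / (\<zeta> - z0) ^ Suc j)) * - cinner v (\<psi> j))
      = circle_integral (\<lambda>\<zeta>. (\<zeta> - z0) ^ l * cinner v (R \<zeta> (\<psi> 0)))"
  proof (rule contour_integral_eq)
    fix \<zeta> assume "\<zeta> \<in> path_image (circlepath z0 e)"
    hence \<zeta>: "\<zeta> \<in> resolvent_set D A" by (rule circle_resolvent)
    show "(\<Sum>j<k. ((\<zeta> - z0) ^ l * (1 / (\<zeta> - z0) ^ Suc j)) * - cinner v (\<psi> j))
        = (\<zeta> - z0) ^ l * cinner v (R \<zeta> (\<psi> 0))"
      unfolding resolvent_jordan_sequence[OF lin \<psi> \<zeta> not_spec[OF \<zeta>]]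
      by (simp add: cinner_sum_right cinner_scaleC_right sum_distrib_left sum_negf mult.assoc)
  qed
  ultimately have total: "circle_integral (\<lambda>\<zeta>. (\<zeta> - z0) ^ l * cinner v (R \<zeta> (\<psi> 0)))
      = - (2 * of_real pi * \<i>) * cinner v (\<psi> l)" by (simp only:)
  show "cinner v (coeff l (\<psi> 0)) = cinner v (\<psi> l)"
    unfolding coeff_functional[OF clinear_cinner] total by simp
qed

text \<open>In particular everything in the range of \<open>coeff 0\<close> starts a Jordan sequence. Together with the preceding
  lemma this determines all products of coefficients and shows that \<open>coeff 0\<close> is idempotent.\<close>

lemma coeff_is_jordan_sequence:
  "jordan_sequence D A z0 p (\<lambda>i. coeff (i + m) x)"
  unfolding jordan_sequence_def using coeff_step coeff_vanishes by auto

lemma coeff_coeff: "coeff l (coeff m x) = coeff (l + m) x"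
  using coeff_jordan_sequence[OF coeff_is_jordan_sequence, of l m x] by simp

lemma resolvent_on_range:
  assumes "z \<in> resolvent_set D A"
  shows "R z (coeff 0 x) = - (\<Sum>l<p. (1 / (z - z0) ^ Suc l) *\<^sub>C coeff l x)"
  using resolvent_jordan_sequence[OF lin coeff_is_jordan_sequence assms not_spec[OF assms], of 0 x] by simp

lemma subspace_range_coeff: "complex_vector.subspace (range (coeff l))"
proof (rule complex_vector.subspaceI)
  show "0 \<in> range (coeff l)" using clinear_zero[OF coeff_clinear] by (metis rangeI)
  fix x y c assume "x \<in> range (coeff l)" "y \<in> range (coeff l)"
  then obtain a b where ab: "x = coeff l a" "y = coeff l b" by auto
  show "x + y \<in> range (coeff l)"
    unfolding ab clinear_add[OF coeff_clinear, symmetric] by (rule rangeI)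
  show "c *\<^sub>C x \<in> range (coeff l)"
    unfolding ab clinear_scaleC[OF coeff_clinear, symmetric] by (rule rangeI)
qed

end

lemma cfinite_dim_if_kernel_and_image:
  assumes T: "bounded_clinear (T::'a::complex_hilbert_space \<Rightarrow> 'a)" and S: "complex_vector.subspace S"
    and ker: "cfinite_dim {x\<in>S. T x = 0}" and im: "cfinite_dim (T ` S)"
  shows "cfinite_dim S"
proof -
  obtain B1 where B1: "finite B1" "{x\<in>S. T x = 0} \<subseteq> cspan B1" using ker by (auto simp: cfinite_dim_def)
  have "complex_vector.subspace (T ` S)"
  proof (rule complex_vector.subspaceI)
    show "0 \<in> T ` S" using clinear_zero[OF T] complex_vector.subspace_0[OF S] by (metis imageI)
    fix x y c assume "x \<in> T ` S" "y \<in> T ` S"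
    then obtain a b where ab: "x = T a" "y = T b" "a \<in> S" "b \<in> S" by auto
    show "x + y \<in> T ` S" unfolding ab clinear_add[OF T, symmetric]
      using ab complex_vector.subspace_add[OF S] by blast
    show "c *\<^sub>C x \<in> T ` S" unfolding ab clinear_scaleC[OF T, symmetric]
      using ab complex_vector.subspace_scale[OF S] by blast
  qed
  then obtain n u where u: "orthonormal_family n u" "T ` S = cspan (u ` {..<n})"
    using cfinite_dim_orthonormal_family[OF im] by metis
  have "\<exists>g\<in>S. T g = u i" if "i < n" for i
  proof -
    have "u i \<in> T ` S" unfolding u(2) using that by (intro complex_vector.span_base) auto
    thus ?thesis by auto
  qed
  then obtain g where g: "\<And>i. i < n \<Longrightarrow> g i \<in> S" "\<And>i. i < n \<Longrightarrow> T (g i) = u i" by metis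
  have "S \<subseteq> cspan (B1 \<union> g ` {..<n})"
  proof
    fix x assume x: "x \<in> S"
    define s where "s = (\<Sum>i<n. cinner (u i) (T x) *\<^sub>C g i)"
    have "T x = (\<Sum>i<n. cinner (u i) (T x) *\<^sub>C u i)"
      by (rule orthonormal_family_expansion[OF u(1)]) (use x u(2) in blast)
    hence "T (x - s) = 0"
      by (simp add: s_def clinear_simps[OF T] g(2))
    moreover have "s \<in> S" unfolding s_def
      by (intro complex_vector.subspace_sum[OF S] complex_vector.subspace_scale[OF S]) (use g in auto)
    ultimately have "x - s \<in> cspan B1" using B1(2) x complex_vector.subspace_diff[OF S] by blast
    hence "x - s \<in> cspan (B1 \<union> g ` {..<n})" using complex_vector.span_mono[of B1 "B1 \<union> g ` {..<n}"] by blast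
    moreover have "s \<in> cspan (B1 \<union> g ` {..<n})" unfolding s_def
      by (intro complex_vector.span_sum complex_vector.span_scale complex_vector.span_base) auto
    ultimately have "(x - s) + s \<in> cspan (B1 \<union> g ` {..<n})" by (rule complex_vector.span_add)
    thus "x \<in> cspan (B1 \<union> g ` {..<n})" by simp
  qed
  thus ?thesis unfolding cfinite_dim_def using B1(1) by (intro exI[of _ "B1 \<union> g ` {..<n}"]) auto
qed

lemma cfinite_dim_subset: "cfinite_dim T \<Longrightarrow> S \<subseteq> T \<Longrightarrow> cfinite_dim S"
  unfolding cfinite_dim_def by blast

context isolated_pole
begin

text \<open>Downward induction from the vanishing coefficient: \<open>coeff 1\<close> maps the range of each coefficient
  onto that of the next one, with eigenvectors as kernel.\<close>

lemma cfinite_dim_range_coeff: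
  assumes ker: "cfinite_dim {x\<in>D. A x = z0 *\<^sub>C x}"
  shows "cfinite_dim (range (coeff (p - k)))"
proof (induction k)
  case 0
  have "range (coeff p) = {0}" by (auto simp: coeff_vanishes)
  thus ?case unfolding cfinite_dim_def by (intro exI[of _ "{}"]) simp
next
  case (Suc k)
  show ?case
  proof (cases "k < p")
    case True
    define l where "l = p - Suc k"
    have l: "p - k = Suc l" using True by (simp add: l_def)
    have "cfinite_dim (range (coeff l))"
    proof (rule cfinite_dim_if_kernel_and_image[OF coeff_clinear[of 1] subspace_range_coeff])
      show "cfinite_dim {x \<in> range (coeff l). coeff 1 x = 0}"
      proof (rule cfinite_dim_subset[OF ker], rule subsetI)
        fix x assume "x \<in> {x \<in> range (coeff l). coeff 1 x = 0}"
        then obtain y where y: "x = coeff l y" "coeff (Suc l) y = 0"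
          by (auto simp: coeff_coeff)
        thus "x \<in> {x \<in> D. A x = z0 *\<^sub>C x}" using coeff_step[of l y] by simp
      qed
      have "coeff 1 ` range (coeff l) \<subseteq> range (coeff (Suc l))"
        by (auto simp: coeff_coeff)
      thus "cfinite_dim (coeff 1 ` range (coeff l))"
        using Suc.IH unfolding l by (rule cfinite_dim_subset[rotated])
    qed
    thus ?thesis by (simp add: l_def)
  next
    case False
    thus ?thesis using Suc.IH by simp
  qed
qed

text \<open>The radius chosen in the definition of the Riesz projection may exceed \<open>e0\<close>, but both circles lie in
  the open set of regular points together with \<open>z0\<close>, where the contour can be deformed.\<close>

lemma riesz_projection_eq: "riesz_projection D A z0 = coeff 0"
proof -
  define r where "r = (SOME r. r > 0 \<and> cball z0 r \<inter> spectrum D A = {z0})"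
  have "e > 0 \<and> cball z0 e \<inter> spectrum D A = {z0}"
  proof -
    have "x = z0" if x: "x \<in> cball z0 e" "x \<in> spectrum D A" for x
    proof (rule ccontr)
      assume "x \<noteq> z0"
      hence "x \<in> ball z0 e0 - {z0}" using x(1) e(2) by simp
      thus False using punctured x(2) unfolding spectrum_def by blast
    qed
    thus ?thesis using e spec by auto
  qed
  hence "r > 0 \<and> cball z0 r \<inter> spectrum D A = {z0}"
    unfolding r_def by (rule someI[where P = "\<lambda>r. r > 0 \<and> cball z0 r \<inter> spectrum D A = {z0}"])
  hence r: "r > 0" and rs: "cball z0 r - {z0} \<subseteq> resolvent_set D A" by (auto simp: spectrum_def)
  define S where "S = resolvent_set D A \<union> ball z0 e0"
  have S: "open S" unfolding S_def using open_resolvent_set[OF lin] by blast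
  have Sm: "S - {z0} \<subseteq> resolvent_set D A" using punctured by (auto simp: S_def)
  have z0S: "z0 \<in> S" using e by (auto simp: S_def)
  have circ: "path_image (circlepath z0 q) \<subseteq> resolvent_set D A" if "0 < q" "q = r \<or> q = e" for q
    using that rs circle_resolvent by (auto simp: subset_iff)
  have ball_S: "cball z0 q \<subseteq> S" if "q = r \<or> q = e" for q
    using that rs z0S e unfolding S_def by (auto simp: subset_iff)
  define \<Lambda> where "\<Lambda> v x T = cinner v (T x)" for v x :: 'a and T :: "'a \<Rightarrow>\<^sub>L 'a"
  have \<Lambda>: "bounded_clinear (\<Lambda> v x)" for v x unfolding \<Lambda>_def by (rule clinear_cinner_eval)
  have cont: "continuous_on (resolvent_set D A) R" using R_continuous[of 0] by simp
  have "vec_contour_integral (circlepath z0 r) R = vec_contour_integral (circlepath z0 e) R"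
  proof (rule blinfun_eq_cinnerI)
    fix x v
    define f where "f = (\<lambda>\<zeta>. \<Lambda> v x (R \<zeta>))"
    have hol: "f holomorphic_on S - {z0}"
      unfolding f_def \<Lambda>_def by (rule holomorphic_on_subset[OF R_holomorphic[OF clinear_cinner] Sm])
    have "contour_integral (circlepath z0 r) f = circle_integral f"
    proof (cases "r \<le> e")
      case True
      thus ?thesis using contour_integral_circlepath_eq(3)[OF S hol r True] ball_S by simp
    next
      case False
      thus ?thesis using contour_integral_circlepath_eq(3)[OF S hol e(1), of r] ball_S by simp
    qed
    moreover have "\<Lambda> v x (vec_contour_integral (circlepath z0 q) R) = contour_integral (circlepath z0 q) f"
      if "0 < q" "q = r \<or> q = e" for q
      unfolding f_def by (rule vec_contour_integral_functional[OF \<Lambda> continuous_on_subset[OF cont circ[OF that]]])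
    ultimately have "\<Lambda> v x (vec_contour_integral (circlepath z0 r) R) = \<Lambda> v x (vec_contour_integral (circlepath z0 e) R)"
      using r e by simp
    thus "cinner v (vec_contour_integral (circlepath z0 r) R x)
        = cinner v (vec_contour_integral (circlepath z0 e) R x)" by (simp add: \<Lambda>_def)
  qed
  thus ?thesis unfolding riesz_projection_def r_def[symmetric] Let_def coeff_def by simp
qed

end

section \<open>The Birman--Schwinger factorization\<close>

lemma has_norm_derivative_compose:
  fixes F G :: "complex \<Rightarrow> 'a::complex_hilbert_space \<Rightarrow>\<^sub>L 'a"
  assumes F: "has_norm_derivative F F' z" and G: "has_norm_derivative G G' z"
    and bc: "bounded_clinear (F z)"
  shows "has_norm_derivative (\<lambda>w. F w o\<^sub>L G w) ((F' o\<^sub>L G z) + (F z o\<^sub>L G')) z"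
proof -
  have comp: "((\<lambda>w. a w o\<^sub>L b w) \<longlongrightarrow> a' o\<^sub>L b') (at z)"
    if "(a \<longlongrightarrow> a') (at z)" "(b \<longlongrightarrow> b') (at z)" for a b :: "complex \<Rightarrow> 'a \<Rightarrow>\<^sub>L 'a" and a' b'
    by (rule bounded_bilinear.tendsto[OF bounded_bilinear_blinfun_compose that])
  have "((\<lambda>w. (((1 / (w - z)) *\<^sub>C (F w - F z)) o\<^sub>L G w) + (F z o\<^sub>L ((1 / (w - z)) *\<^sub>C (G w - G z))))
      \<longlongrightarrow> (F' o\<^sub>L G z) + (F z o\<^sub>L G')) (at z)"
    using F G has_norm_derivative_isCont[OF G] unfolding has_norm_derivative_def isCont_def
    by (intro tendsto_add comp tendsto_const)
  moreover have "(((1 / (w - z)) *\<^sub>C (F w - F z)) o\<^sub>L G w) + (F z o\<^sub>L ((1 / (w - z)) *\<^sub>C (G w - G z)))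
      = (1 / (w - z)) *\<^sub>C ((F w o\<^sub>L G w) - (F z o\<^sub>L G z))" for w
  proof (rule blinfun_eqI)
    fix x
    show "((((1 / (w - z)) *\<^sub>C (F w - F z)) o\<^sub>L G w) + (F z o\<^sub>L ((1 / (w - z)) *\<^sub>C (G w - G z)))) x
      = ((1 / (w - z)) *\<^sub>C ((F w o\<^sub>L G w) - (F z o\<^sub>L G z))) x"
      by (simp add: blinfun.add_left blinfun.diff_left clinear_simps[OF bc]
          scaleC_diff_right)
  qed
  ultimately show ?thesis unfolding has_norm_derivative_def by simp
qed

locale birman_schwinger_pair =
  fixes D DV :: "'a::complex_hilbert_space set" and H0 V H :: "'a \<Rightarrow> 'a" and K :: "complex \<Rightarrow> 'a \<Rightarrow>\<^sub>L 'a"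
  assumes H0: "linear_operator D H0" and V: "linear_operator DV V" and DV: "D \<subseteq> DV"
    and H: "\<And>x. H x = H0 x + V x"
    and K_clinear: "\<And>z. z \<in> resolvent_set D H0 \<Longrightarrow> bounded_clinear (K z)"
    and K_apply: "\<And>z x. z \<in> resolvent_set D H0 \<Longrightarrow>
      K z x = - V (resolvent D H0 z x)"
begin

abbreviation R0 where "R0 \<equiv> resolvent D H0"
abbreviation RH where "RH \<equiv> resolvent D H"
abbreviation M where "M \<equiv> \<lambda>z. id_blinfun - K z"

lemmas H0D = linear_operatorD[OF H0]

lemma V_linear:
  "x \<in> D \<Longrightarrow> y \<in> D \<Longrightarrow> V (x + y) = V x + V y" "x \<in> D \<Longrightarrow> V (c *\<^sub>C x) = c *\<^sub>C V x"
  "x \<in> D \<Longrightarrow> y \<in> D \<Longrightarrow> V (x - y) = V x - V y" "x \<in> D \<Longrightarrow> V (- x) = - V x" "V 0 = 0"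
  "(\<And>i. i \<in> I \<Longrightarrow> f i \<in> D) \<Longrightarrow> V (\<Sum>i\<in>I. f i) = (\<Sum>i\<in>I. V (f i))"
proof -
  show "(\<And>i. i \<in> I \<Longrightarrow> f i \<in> D) \<Longrightarrow> V (\<Sum>i\<in>I. f i) = (\<Sum>i\<in>I. V (f i))"
    by (rule linear_operator_sum(2)[OF V]) (use DV in auto)
  show "V 0 = 0" by (rule linear_operatorD(10)[OF V])
qed (intro linear_operatorD[OF V] subsetD[OF DV]; assumption)+

lemma M_apply: "z \<in> resolvent_set D H0 \<Longrightarrow> M z x = x + V (R0 z x)"
  by (simp add: blinfun.diff_left K_apply)

lemma M_clinear: "z \<in> resolvent_set D H0 \<Longrightarrow> bounded_clinear (M z)"
  unfolding minus_blinfun.rep_eq id_blinfun.rep_eq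
  by (intro clinear_minus_fun clinear_ident K_clinear)

lemma M_factor: "z \<in> resolvent_set D H0 \<Longrightarrow> y \<in> D \<Longrightarrow> M z (H0 y - z *\<^sub>C y) = H y - z *\<^sub>C y"
  by (simp add: M_apply resolvent_left H)

lemma RH_M:
  assumes "z \<in> resolvent_set D H0" "z \<in> resolvent_set D H"
  shows "RH z (M z x) = R0 z x"
proof -
  have "M z x = H (R0 z x) - z *\<^sub>C R0 z x"
    using M_factor[OF assms(1) resolvent_mem[OF assms(1)], of x] by (simp add: resolvent_right[OF assms(1)])
  thus ?thesis by (simp add: resolvent_left[OF assms(2) resolvent_mem[OF assms(1)]])
qed

lemma M_inverse_right:
  assumes "z \<in> resolvent_set D H0" "z \<in> resolvent_set D H"
  shows "M z (H0 (RH z x) - z *\<^sub>C RH z x) = x"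
  by (simp only: M_factor[OF assms(1) resolvent_mem[OF assms(2)]] resolvent_right[OF assms(2)])

lemma M_bij:
  assumes "z \<in> resolvent_set D H0" "z \<in> resolvent_set D H"
  shows "bij (M z)"
proof (rule bijI)
  show "inj (M z)"
  proof (rule injI)
    fix x y assume "M z x = M z y"
    hence "R0 z x = R0 z y" using RH_M[OF assms] by metis
    thus "x = y" using resolvent_right[OF assms(1)] by metis
  qed
  show "surj (M z)" by (rule surjI, rule M_inverse_right[OF assms])
qed

lemma resolvent_set_if_M_bij:
  assumes z: "z \<in> resolvent_set D H0" and bij: "bij (M z)"
  shows "z \<in> resolvent_set D H"
proof (rule resolvent_setI)
  let ?N = "inv_into UNIV (M z)"
  have MN: "M z (?N x) = x" and NM: "?N (M z x) = x" for x
    using bij by (auto simp: bij_is_surj surj_f_inv_f bij_is_inj)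
  show "bounded_clinear (\<lambda>x. R0 z (?N x))"
    by (rule clinear_compose[OF resolvent_clinear[OF z] clinear_inv[OF M_clinear[OF z] bij]])
  show "R0 z (?N x) \<in> D" for x by (rule resolvent_mem[OF z])
  show "H (R0 z (?N x)) - z *\<^sub>C R0 z (?N x) = x" for x
    using M_factor[OF z resolvent_mem[OF z], of "?N x"] by (simp add: resolvent_right[OF z] MN)
  show "R0 z (?N (H x - z *\<^sub>C x)) = x" if "x \<in> D" for x
    by (simp only: M_factor[OF z that, symmetric] NM resolvent_left[OF z that])
qed

lemma K_diff:
  assumes "w \<in> resolvent_set D H0" "z \<in> resolvent_set D H0"
  shows "K w x - K z x = (w - z) *\<^sub>C K z (R0 w x)"
proof -
  have "K w x - K z x = - V (R0 w x - R0 z x)"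
    using assms by (simp add: K_apply V_linear resolvent_mem)
  also have "\<dots> = (w - z) *\<^sub>C K z (R0 w x)"
    using assms by (simp add: resolvent_diff K_apply V_linear resolvent_mem)
  finally show ?thesis .
qed

lemma K_derivative:
  assumes z: "z \<in> resolvent_set D H0"
  shows "has_norm_derivative K (K z o\<^sub>L R0 z) z"
  unfolding has_norm_derivative_def
proof (rule Lim_transform_eventually)
  show "((\<lambda>w. K z o\<^sub>L R0 w) \<longlongrightarrow> K z o\<^sub>L R0 z) (at z)"
    using isCont_resolvent[OF H0 z] unfolding isCont_def
    by (intro bounded_bilinear.tendsto[OF bounded_bilinear_blinfun_compose] tendsto_const)
  have "K z o\<^sub>L R0 w = (1 / (w - z)) *\<^sub>C (K w - K z)" if "w \<in> resolvent_set D H0" "w \<noteq> z" for w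
    by (rule blinfun_eqI) (use that(2) in \<open>simp add: blinfun.diff_left K_diff[OF that(1) z]\<close>)
  moreover have "\<forall>\<^sub>F w in at z. w \<in> resolvent_set D H0 \<and> w \<noteq> z"
    using open_resolvent_set[OF H0] z
    by (simp add: eventually_at_in_open' eventually_conj_iff eventually_neq_at_within)
  ultimately show "\<forall>\<^sub>F w in at z. K z o\<^sub>L R0 w = (1 / (w - z)) *\<^sub>C (K w - K z)"
    by (auto elim: eventually_mono)
qed

lemma M_derivative:
  assumes z: "z \<in> resolvent_set D H0"
  shows "has_norm_derivative M (- (K z o\<^sub>L R0 z)) z"
proof -
  have "((\<lambda>w. - ((1 / (w - z)) *\<^sub>C (K w - K z))) \<longlongrightarrow> - (K z o\<^sub>L R0 z)) (at z)"
    by (rule tendsto_minus[OF K_derivative[OF z, unfolded has_norm_derivative_def]])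
  moreover have "- ((1 / (w - z)) *\<^sub>C (K w - K z)) = (1 / (w - z)) *\<^sub>C (M w - M z)" for w
    by (simp flip: scaleC_minus_right)
  ultimately show ?thesis by (simp only: has_norm_derivative_def)
qed

lemma K_eventually_bounded:
  assumes z: "z \<in> resolvent_set D H0"
  shows "\<forall>\<^sub>F w in at z. norm (K w) \<le> norm (K z) + 1"
proof -
  have "(K \<longlongrightarrow> K z) (at z)" using has_norm_derivative_isCont[OF K_derivative[OF z]] by (simp add: isCont_def)
  hence "((\<lambda>w. norm (K w)) \<longlongrightarrow> norm (K z)) (at z)" by (rule tendsto_norm)
  hence "\<forall>\<^sub>F w in at z. norm (K w) < norm (K z) + 1" by (rule order_tendstoD) simp
  thus ?thesis by (rule eventually_mono) simp
qed

text \<open>The logarithmic derivative of \<open>M\<close> simplifies because \<open>R0 z M(z)\<^sup>-\<^sup>1 = RH z\<close>.\<close>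

lemma log_derivative:
  assumes "z \<in> resolvent_set D H0" "z \<in> resolvent_set D H"
  shows "vec_deriv M z o\<^sub>L op_inverse (M z) = - (K z o\<^sub>L RH z)"
proof (rule blinfun_eqI)
  fix x
  define y where "y = H0 (RH z x) - z *\<^sub>C RH z x"
  have "inv_into UNIV (M z) x = y"
    using M_inverse_right[OF assms, of x] M_bij[OF assms] unfolding y_def by (metis bij_inv_eq_iff)
  hence "op_inverse (M z) x = y"
    unfolding op_inverse_def
    by (simp add: blinfun_apply_Blinfun_clinear[OF clinear_inv[OF M_clinear[OF assms(1)] M_bij[OF assms]]])
  moreover have "R0 z y = RH z x"
    unfolding y_def by (rule resolvent_left[OF assms(1) resolvent_mem[OF assms(2)]])
  ultimately show "(vec_deriv M z o\<^sub>L op_inverse (M z)) x = (- (K z o\<^sub>L RH z)) x"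
    by (simp add: vec_deriv_eq[OF M_derivative[OF assms(1)]] blinfun.minus_left)
qed

text \<open>A power bound for \<open>M(z)\<^sup>-\<^sup>1\<close> passes to the resolvent of \<open>H\<close> since \<open>RH z = R0 z M(z)\<^sup>-\<^sup>1\<close>.\<close>

lemma resolvent_pole_bound:
  assumes z0: "z0 \<in> resolvent_set D H0" and "0 < d"
    and M: "\<And>z x. z \<in> ball z0 d \<Longrightarrow> cmod (z - z0) ^ p * norm x \<le> C * norm (M z x)"
  obtains d' C' where "0 < d'" "\<And>z x. z \<in> ball z0 d' - {z0} \<Longrightarrow> z \<in> resolvent_set D H \<Longrightarrow>
      cmod (z - z0) ^ p * norm (RH z x) \<le> C' * norm x"
proof -
  have "(R0 \<longlongrightarrow> R0 z0) (at z0)" using isCont_resolvent[OF H0 z0] by (simp add: isCont_def)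
  hence "((\<lambda>w. norm (R0 w)) \<longlongrightarrow> norm (R0 z0)) (at z0)" by (rule tendsto_norm)
  hence "\<forall>\<^sub>F w in at z0. norm (R0 w) < norm (R0 z0) + 1" by (rule order_tendstoD) simp
  moreover have "\<forall>\<^sub>F w in at z0. w \<in> resolvent_set D H0"
    using open_resolvent_set[OF H0] z0 by (simp add: eventually_at_in_open')
  ultimately have "\<forall>\<^sub>F w in at z0. norm (R0 w) < norm (R0 z0) + 1 \<and> w \<in> resolvent_set D H0"
    by (rule eventually_conj)
  then obtain s where s: "s > 0" "\<And>z. z \<noteq> z0 \<Longrightarrow> dist z z0 < s \<Longrightarrow> norm (R0 z) < norm (R0 z0) + 1 \<and> z \<in> resolvent_set D H0"
    unfolding eventually_at by auto
  define B where "B = norm (R0 z0) + 1"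
  have B: "B \<ge> 0" by (simp add: B_def)
  show thesis
  proof (rule that[of "min d s" "B * C"])
    show "0 < min d s" using assms(2) s(1) by simp
    fix z x assume z: "z \<in> ball z0 (min d s) - {z0}" and zH: "z \<in> resolvent_set D H"
    have zd: "z \<in> ball z0 d" and zR: "norm (R0 z) \<le> B" "z \<in> resolvent_set D H0"
      using z s(2)[of z] by (auto simp: B_def dist_commute)
    define y where "y = H0 (RH z x) - z *\<^sub>C RH z x"
    have My: "M z y = x" unfolding y_def by (rule M_inverse_right[OF zR(2) zH])
    have "RH z x = R0 z y" using RH_M[OF zR(2) zH, of y] My by simp
    hence "norm (RH z x) \<le> B * norm y"
      using norm_blinfun[of "R0 z" y] mult_right_mono[OF zR(1) norm_ge_zero[of y]] by simp
    hence "cmod (z - z0) ^ p * norm (RH z x) \<le> cmod (z - z0) ^ p * (B * norm y)"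
      by (rule mult_left_mono) simp
    also have "\<dots> = B * (cmod (z - z0) ^ p * norm y)" by simp
    also have "\<dots> \<le> B * (C * norm x)" using M[OF zd, of y] B unfolding My by (rule mult_left_mono)
    finally show "cmod (z - z0) ^ p * norm (RH z x) \<le> B * C * norm x" by simp
  qed
qed

end

section \<open>The zeros of \<open>I - K(z)\<close> and the range of the Riesz projection\<close>

text \<open>Multiplying by the highest power of \<open>z - z0\<close> and letting \<open>z\<close> tend to \<open>z0\<close> isolates the leading
  coefficient, which is therefore zero.\<close>

lemma bounded_principal_part_zero:
  fixes c :: "nat \<Rightarrow> 'a::complex_normed_vector"
  assumes "\<forall>\<^sub>F z in at z0. norm (\<Sum>l<k. (1 / (z - z0) ^ Suc l) *\<^sub>C c l) \<le> B" "l < k"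
  shows "c l = 0"
  using assms
proof (induction k arbitrary: l)
  case (Suc k)
  define S where "S z = (\<Sum>l<Suc k. (1 / (z - z0) ^ Suc l) *\<^sub>C c l)" for z
  have lim0: "((\<lambda>z. (z - z0) ^ Suc k *\<^sub>C S z) \<longlongrightarrow> 0) (at z0)"
  proof (rule Lim_null_comparison)
    show "\<forall>\<^sub>F z in at z0. norm ((z - z0) ^ Suc k *\<^sub>C S z) \<le> cmod (z - z0) ^ Suc k * B"
      using Suc.prems(1) by (rule eventually_mono) (simp add: S_def norm_scaleC norm_power norm_mult mult_left_mono)
    have "((\<lambda>z. cmod (z - z0) ^ Suc k * B) \<longlongrightarrow> cmod (z0 - z0) ^ Suc k * B) (at z0)"
      by (intro tendsto_intros)
    thus "((\<lambda>z. cmod (z - z0) ^ Suc k * B) \<longlongrightarrow> 0) (at z0)" by simp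
  qed
  have "((\<lambda>z. \<Sum>l<Suc k. (z - z0) ^ (k - l) *\<^sub>C c l) \<longlongrightarrow> (\<Sum>l<Suc k. (z0 - z0) ^ (k - l) *\<^sub>C c l)) (at z0)"
    by (intro tendsto_sum bounded_linear.tendsto[OF bounded_linear_scaleC_left] tendsto_intros)
  hence "((\<lambda>z. \<Sum>l<Suc k. (z - z0) ^ (k - l) *\<^sub>C c l) \<longlongrightarrow> c k) (at z0)"
    by (simp add: power_0_left)
  moreover have "(\<Sum>l<Suc k. (z - z0) ^ (k - l) *\<^sub>C c l) = (z - z0) ^ Suc k *\<^sub>C S z" if "z \<noteq> z0" for z
    unfolding S_def scaleC_sum_right scaleC_scaleC
  proof (rule sum.cong)
    fix l assume "l \<in> {..<Suc k}"
    hence "Suc k = k - l + Suc l" by simp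
    hence "(z - z0) ^ Suc k = (z - z0) ^ (k - l) * (z - z0) ^ Suc l" by (metis power_add)
    thus "(z - z0) ^ (k - l) *\<^sub>C c l = ((z - z0) ^ Suc k * (1 / (z - z0) ^ Suc l)) *\<^sub>C c l"
      using that by simp
  qed simp
  hence "\<forall>\<^sub>F z in at z0. (\<Sum>l<Suc k. (z - z0) ^ (k - l) *\<^sub>C c l) = (z - z0) ^ Suc k *\<^sub>C S z"
    by (auto simp: eventually_at_filter)
  ultimately have "((\<lambda>z. (z - z0) ^ Suc k *\<^sub>C S z) \<longlongrightarrow> c k) (at z0)" by (rule Lim_transform_eventually)
  hence ck: "c k = 0" using lim0 by (rule tendsto_unique[OF trivial_limit_at])
  show ?case
  proof (cases "l = k")
    case False
    show ?thesis by (rule Suc.IH) (use Suc.prems ck False in auto)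
  qed (use ck in simp)
qed simp

locale birman_schwinger_pole =
  birman_schwinger_pair D DV H0 V H K + isolated_pole D H z0 e0 e d C p
  for D DV :: "'a::complex_hilbert_space set" and H0 V H K z0 e0 e d C p +
  assumes ball_H0: "ball z0 e0 \<subseteq> resolvent_set D H0"
begin

lemma z0_H0: "z0 \<in> resolvent_set D H0"
  using ball_H0 e by auto

lemma eventually_both:
  "\<forall>\<^sub>F z in at z0. z \<in> resolvent_set D H0 \<and> z \<in> resolvent_set D H \<and> z \<noteq> z0"
proof -
  have "\<forall>\<^sub>F z in at z0. z \<in> ball z0 e0 - {z0}" using e by (intro eventually_at_in_open) auto
  thus ?thesis by (rule eventually_mono) (use ball_H0 punctured in auto)
qed

text \<open>On the range of the Riesz projection this is \<open>V (H - z)\<^sup>-\<^sup>1 x\<close>, up to analytic terms the function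
  \<open>- M(z)\<^sup>-\<^sup>1 x\<close>, and this description makes it a zero of \<open>M\<close>.\<close>

definition principal_part :: "'a \<Rightarrow> complex \<Rightarrow> 'a" where
  "principal_part x = (\<lambda>z. \<Sum>l<p. (1 / (z - z0) ^ Suc l) *\<^sub>C (- V (coeff l x)))"

lemma principal_part_linear: "Vector_Spaces.linear scaleC scaleC principal_part"
proof -
  have "principal_part (x + y) = principal_part x + principal_part y" for x y
    by (rule ext)
      (simp add: principal_part_def clinear_add[OF coeff_clinear] V_linear coeff_step(1)
        scaleC_add_right sum.distrib scaleC_diff_right sum_negf sum_subtractf)
  moreover have "principal_part (c *\<^sub>C x) = c *\<^sub>C principal_part x" for c x
    by (rule ext)
      (simp add: principal_part_def clinear_scaleC[OF coeff_clinear] V_linear coeff_step(1)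
        scaleC_fun_def scaleC_sum_right mult.commute sum_negf)
  ultimately show ?thesis by unfold_locales simp_all
qed

lemma principal_part_eq:
  assumes "z \<in> resolvent_set D H"
  shows "principal_part x z = V (RH z (coeff 0 x))"
  unfolding resolvent_on_range[OF assms] principal_part_def
  by (simp add: V_linear coeff_step(1) H0D linear_operator_sum(1)[OF H0] sum_negf)

text \<open>For \<open>y = R(z) x\<close> one has \<open>(H0 - z) y + V y = x\<close>; this is the second resolvent identity.\<close>

lemma R0_V_RH:
  assumes "z \<in> resolvent_set D H0" "z \<in> resolvent_set D H"
  shows "R0 z (V (RH z x)) = R0 z x - RH z x"
proof -
  define y where "y = RH z x"
  have y: "y \<in> D" unfolding y_def by (rule resolvent_mem[OF assms(2)])
  have "H y - z *\<^sub>C y = x" unfolding y_def by (rule resolvent_right[OF assms(2)])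
  hence "V y = x - (H0 y - z *\<^sub>C y)" by (auto simp: H)
  hence "R0 z (V y) = R0 z x - R0 z (H0 y - z *\<^sub>C y)"
    by (simp only: clinear_diff[OF resolvent_clinear[OF assms(1)]])
  thus ?thesis unfolding y_def[symmetric] by (simp only: resolvent_left[OF assms(1) y])
qed

text \<open>By the second resolvent identity \<open>M(z) V R(z) x = V R0(z) x = - K(z) x\<close>, which stays bounded.\<close>

lemma principal_part_in_zero_space:
  assumes x: "coeff 0 x = x"
  shows "principal_part x \<in> zero_space z0 M"
proof -
  have form: "principal_part x = (\<lambda>z. \<Sum>j<p. (1 / (z - z0) ^ (p - j)) *\<^sub>C (- V (coeff (p - Suc j) x)))"
  proof (rule ext)
    fix z
    have "(\<Sum>j<p. (1 / (z - z0) ^ (p - j)) *\<^sub>C (- V (coeff (p - Suc j) x)))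
        = (\<Sum>j<p. (1 / (z - z0) ^ Suc (p - Suc j)) *\<^sub>C (- V (coeff (p - Suc j) x)))"
      by (rule sum.cong) (auto simp: Suc_diff_Suc)
    also have "\<dots> = principal_part x z"
      unfolding principal_part_def by (rule sum.nat_diff_reindex)
    finally show "principal_part x z = (\<Sum>j<p. (1 / (z - z0) ^ (p - j)) *\<^sub>C (- V (coeff (p - Suc j) x)))" ..
  qed
  have "(\<lambda>z. norm (M z (principal_part x z))) \<in> O[at z0](\<lambda>_. 1)"
  proof (rule bigoI)
    show "\<forall>\<^sub>F z in at z0. norm (norm (M z (principal_part x z))) \<le> ((norm (K z0) + 1) * norm x) * norm (1::real)"
      using eventually_both K_eventually_bounded[OF z0_H0]
    proof eventually_elim
      case (elim z)
      hence z: "z \<in> resolvent_set D H0" "z \<in> resolvent_set D H" by auto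
      have "M z (principal_part x z) = V (R0 z x)"
        unfolding principal_part_eq[OF z(2)] x M_apply[OF z(1)] R0_V_RH[OF z]
        by (simp add: V_linear resolvent_mem[OF z(1)] resolvent_mem[OF z(2)])
      hence "norm (M z (principal_part x z)) = norm (K z x)"
        by (simp add: K_apply[OF z(1)])
      also have "\<dots> \<le> (norm (K z0) + 1) * norm x"
        using norm_blinfun[of "K z" x] mult_right_mono[OF elim(2) norm_ge_zero[of x]] by linarith
      finally show ?case by simp
    qed
  qed
  moreover have "\<exists>k f. principal_part x = (\<lambda>z. \<Sum>j<k. (1 / (z - z0) ^ (k - j)) *\<^sub>C f j)"
    by (rule exI, rule exI, rule form)
  ultimately show ?thesis unfolding zero_space_def mem_Collect_eq by (rule conjI[rotated])
qed

text \<open>If \<open>V R(z) x\<close> vanishes, then \<open>R(z) x = R0(z) x\<close> is regular at \<open>z0\<close>, whereas for \<open>x\<close> in the range of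
  \<open>coeff 0\<close> it is a pure principal part.\<close>

lemma principal_part_inj:
  assumes x: "coeff 0 x = x" and 0: "principal_part x = 0"
  shows "x = 0"
proof -
  have bound: "\<forall>\<^sub>F z in at z0. norm (\<Sum>l<p. (1 / (z - z0) ^ Suc l) *\<^sub>C coeff l x) \<le> (norm (R0 z0) + 1) * norm x"
  proof -
    have "(R0 \<longlongrightarrow> R0 z0) (at z0)" using isCont_resolvent[OF H0 z0_H0] by (simp add: isCont_def)
    hence "((\<lambda>w. norm (R0 w)) \<longlongrightarrow> norm (R0 z0)) (at z0)" by (rule tendsto_norm)
    hence "\<forall>\<^sub>F w in at z0. norm (R0 w) < norm (R0 z0) + 1" by (rule order_tendstoD) simp
    with eventually_both show ?thesis
    proof eventually_elim
      case (elim z)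
      hence z: "z \<in> resolvent_set D H0" "z \<in> resolvent_set D H" by auto
      have "V (RH z x) = 0" using principal_part_eq[OF z(2), of x] 0 x by simp
      hence "RH z x = R0 z x"
        using R0_V_RH[OF z, of x] by (simp add: blinfun.zero_right)
      hence "norm (\<Sum>l<p. (1 / (z - z0) ^ Suc l) *\<^sub>C coeff l x) = norm (R0 z x)"
        using resolvent_on_range[OF z(2), of x] x by (metis norm_minus_cancel)
      also have "\<dots> \<le> (norm (R0 z0) + 1) * norm x"
        using norm_blinfun[of "R0 z" x] mult_right_mono[of "norm (R0 z)" "norm (R0 z0) + 1" "norm x"] elim(2) by simp
      finally show ?case .
    qed
  qed
  have "coeff l x = 0" if "l < p" for l
    by (rule bounded_principal_part_zero[OF bound that])
  hence "coeff 0 x = 0" using coeff_vanishes[of 0 x] by (cases "p = 0") auto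
  thus ?thesis using x by simp
qed

text \<open>From the coefficients \<open>c\<close> of an element of the zero space, the recursion
  \<open>\<psi>\<^sub>l = R0(z0) (c\<^sub>l + \<psi>\<^sub>l\<^sub>+\<^sub>1)\<close> produces the principal part of \<open>R0(z) \<phi>(z)\<close>; boundedness of \<open>M \<phi>\<close> says
  \<open>c\<^sub>l = - V \<psi>\<^sub>l\<close>, which turns \<open>\<psi>\<close> into a Jordan sequence of \<open>H\<close>.\<close>

lemma zero_space_is_principal_part:
  assumes "\<phi> \<in> zero_space z0 M"
  shows "\<exists>x. coeff 0 x = x \<and> \<phi> = principal_part x"
proof -
  obtain k f where \<phi>: "\<phi> = (\<lambda>z. \<Sum>j<k. (1 / (z - z0) ^ (k - j)) *\<^sub>C f j)"
    and bd: "(\<lambda>z. norm (M z (\<phi> z))) \<in> O[at z0](\<lambda>_. 1)"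
    using assms by (auto simp: zero_space_def)
  define c where "c l = f (k - Suc l)" for l
  have \<phi>c: "\<phi> z = (\<Sum>l<k. (1 / (z - z0) ^ Suc l) *\<^sub>C c l)" for z
  proof -
    have "\<phi> z = (\<Sum>l<k. (1 / (z - z0) ^ (k - (k - Suc l))) *\<^sub>C f (k - Suc l))"
      unfolding \<phi> by (rule sum.nat_diff_reindex[symmetric])
    also have "\<dots> = (\<Sum>l<k. (1 / (z - z0) ^ Suc l) *\<^sub>C c l)"
      by (rule sum.cong) (auto simp: c_def Suc_diff_Suc)
    finally show ?thesis .
  qed
  define \<chi> where "\<chi> = rec_nat 0 (\<lambda>j v. R0 z0 (c (k - Suc j) + v))"
  define \<psi> where "\<psi> l = \<chi> (k - l)" for l
  have \<chi>0: "\<chi> 0 = 0" and \<chi>S: "\<chi> (Suc j) = R0 z0 (c (k - Suc j) + \<chi> j)" for j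
    by (simp_all add: \<chi>_def)
  have \<psi>k: "\<psi> l = 0" if "k \<le> l" for l using that by (simp add: \<psi>_def \<chi>0)
  have \<psi>rec: "\<psi> l = R0 z0 (c l + \<psi> (Suc l))" if "l < k" for l
  proof -
    have "k - l = Suc (k - Suc l)" "k - Suc (k - Suc l) = l" using that by auto
    thus ?thesis by (simp add: \<psi>_def \<chi>S)
  qed
  have \<psi>D: "\<psi> l \<in> D" for l
    using \<psi>rec[of l] \<psi>k[of l] resolvent_mem[OF z0_H0] H0D(1) by (cases "l < k") auto
  have H0\<psi>: "H0 (\<psi> l) - z0 *\<^sub>C \<psi> l = c l + \<psi> (Suc l)" if "l < k" for l
    using resolvent_right[OF z0_H0, of "c l + \<psi> (Suc l)"] \<psi>rec[OF that] by simp
  define s where "s z = (\<Sum>l<k. (1 / (z - z0) ^ Suc l) *\<^sub>C \<psi> l)" for z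
  have Vs: "V (s z) = (\<Sum>l<k. (1 / (z - z0) ^ Suc l) *\<^sub>C V (\<psi> l))" for z
    unfolding s_def by (simp add: V_linear \<psi>D H0D)
  \<comment> \<open>\<open>R0(z) \<phi>(z)\<close> is the principal part \<open>s\<close> plus the regular function \<open>R0(z) \<psi>\<^sub>0\<close>.\<close>
  have M\<phi>: "M z (\<phi> z) = (\<Sum>l<k. (1 / (z - z0) ^ Suc l) *\<^sub>C (c l + V (\<psi> l))) - K z (\<psi> 0)"
    if z: "z \<in> resolvent_set D H0" "z \<noteq> z0" for z
  proof -
    have s: "s z \<in> D" "H0 (s z) - z *\<^sub>C s z = \<phi> z - \<psi> 0"
      using principal_part_telescope[OF H0, of \<psi> k z0 c z] \<psi>D H0\<psi> \<psi>k[of k] z(2) unfolding s_def \<phi>c by auto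
    hence "R0 z (\<phi> z - \<psi> 0) = s z" using resolvent_left[OF z(1) s(1)] by simp
    hence "R0 z (\<phi> z) = s z + R0 z (\<psi> 0)"
      by (simp add: clinear_diff[OF resolvent_clinear[OF z(1)]] diff_eq_eq)
    hence "M z (\<phi> z) = \<phi> z + V (s z) - K z (\<psi> 0)"
      by (simp only: M_apply[OF z(1)] V_linear(1)[OF s(1) resolvent_mem[OF z(1)]] K_apply[OF z(1)]) simp
    thus ?thesis by (simp add: \<phi>c Vs scaleC_add_right sum.distrib)
  qed
  obtain B where B: "\<forall>\<^sub>F z in at z0. norm (norm (M z (\<phi> z))) \<le> B * norm (1::real)"
    using bd by (auto elim: landau_o.bigE)
  have bound: "\<forall>\<^sub>F z in at z0. norm (\<Sum>l<k. (1 / (z - z0) ^ Suc l) *\<^sub>C (c l + V (\<psi> l))) \<le> B + (norm (K z0) + 1) * norm (\<psi> 0)"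
    using eventually_both K_eventually_bounded[OF z0_H0] B
  proof eventually_elim
    case (elim z)
    have "(\<Sum>l<k. (1 / (z - z0) ^ Suc l) *\<^sub>C (c l + V (\<psi> l))) = M z (\<phi> z) + K z (\<psi> 0)"
      using M\<phi>[of z] elim(1) by (simp del: blinfun.diff_left)
    also have "norm \<dots> \<le> norm (M z (\<phi> z)) + norm (K z (\<psi> 0))" by (rule norm_triangle_ineq)
    also have "norm (K z (\<psi> 0)) \<le> (norm (K z0) + 1) * norm (\<psi> 0)"
      using norm_blinfun[of "K z" "\<psi> 0"] mult_right_mono[OF elim(2) norm_ge_zero[of "\<psi> 0"]] by linarith
    finally show ?case using elim(3) by simp
  qed
  have cV: "c l = - V (\<psi> l)" if "l < k" for l
    using bounded_principal_part_zero[OF bound that] by (simp add: eq_neg_iff_add_eq_0)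
  have seq: "jordan_sequence D H z0 k \<psi>"
    unfolding jordan_sequence_def
  proof (intro conjI allI impI \<psi>D \<psi>k)
    fix l
    show "H (\<psi> l) - z0 *\<^sub>C \<psi> l = \<psi> (Suc l)"
    proof (cases "l < k")
      case True
      have "H (\<psi> l) - z0 *\<^sub>C \<psi> l = (H0 (\<psi> l) - z0 *\<^sub>C \<psi> l) + V (\<psi> l)" by (simp add: H)
      thus ?thesis by (simp add: H0\<psi>[OF True] cV[OF True])
    next
      case False
      hence "\<psi> l = 0" "\<psi> (Suc l) = 0" using \<psi>k[of l] \<psi>k[of "Suc l"] by auto
      thus ?thesis by (simp add: linear_operatorD(10)[OF lin])
    qed
  qed
  have coeff: "coeff l (\<psi> 0) = \<psi> l" for l by (rule coeff_jordan_sequence[OF seq])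
  have \<psi>p: "\<psi> l = 0" if "p \<le> l" for l using coeff_vanishes[OF that, of "\<psi> 0"] coeff[of l] by simp
  have "\<phi> z = principal_part (\<psi> 0) z" for z
  proof -
    have "\<phi> z = (\<Sum>l<k. (1 / (z - z0) ^ Suc l) *\<^sub>C (- V (\<psi> l)))"
      unfolding \<phi>c by (rule sum.cong) (simp_all add: cV)
    also have "\<dots> = (\<Sum>l<max k p. (1 / (z - z0) ^ Suc l) *\<^sub>C (- V (\<psi> l)))"
      by (rule sum.mono_neutral_left) (auto simp: \<psi>k V_linear)
    also have "\<dots> = (\<Sum>l<p. (1 / (z - z0) ^ Suc l) *\<^sub>C (- V (\<psi> l)))"
      by (rule sum.mono_neutral_right) (auto simp: \<psi>p V_linear)
    finally show ?thesis by (simp add: principal_part_def coeff)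
  qed
  thus ?thesis using coeff[of 0] by (intro exI[of _ "\<psi> 0"]) auto
qed

lemma zero_space_eq: "zero_space z0 M = principal_part ` range (coeff 0)"
proof -
  have fixed: "x \<in> range (coeff 0) \<longleftrightarrow> coeff 0 x = x" for x
  proof
    show "coeff 0 x = x" if "x \<in> range (coeff 0)"
      using that by (auto simp: coeff_coeff)
    show "x \<in> range (coeff 0)" if "coeff 0 x = x"
      by (rule range_eqI) (rule that[symmetric])
  qed
  show ?thesis
  proof (intro equalityI subsetI)
    fix \<phi> assume "\<phi> \<in> zero_space z0 M"
    then obtain x where "coeff 0 x = x" "\<phi> = principal_part x"
      using zero_space_is_principal_part by blast
    thus "\<phi> \<in> principal_part ` range (coeff 0)" using fixed by blast
  next
    fix \<phi> assume "\<phi> \<in> principal_part ` range (coeff 0)"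
    then obtain x where "x \<in> range (coeff 0)" "\<phi> = principal_part x" by blast
    thus "\<phi> \<in> zero_space z0 M" using principal_part_in_zero_space fixed by blast
  qed
qed

end

context birman_schwinger_pole
begin

lemma fun_alg_mult_eq:
  assumes u: "orthonormal_family n u" and E: "range (coeff 0) = cspan (u ` {..<n})"
  shows "fun_alg_mult z0 M = enat n"
proof -
  have pair: "vector_space_pair (scaleC :: complex \<Rightarrow> 'a \<Rightarrow> 'a) (scaleC :: complex \<Rightarrow> (complex \<Rightarrow> 'a) \<Rightarrow> complex \<Rightarrow> 'a)"
    by (intro vector_space_pair.intro complex_vector.vector_space_axioms)
  have fixed: "coeff 0 x = x" if "x \<in> range (coeff 0)" for x
    using that by (auto simp: coeff_coeff)
  have span: "cspan (range (coeff 0)) = range (coeff 0)"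
    by (rule complex_vector.span_eq_iff[THEN iffD2, OF subspace_range_coeff])
  have inj: "inj_on principal_part (cspan (range (coeff 0)))"
    unfolding span
  proof (rule inj_onI)
    fix x y assume xy: "x \<in> range (coeff 0)" "y \<in> range (coeff 0)"
      "principal_part x = principal_part y"
    have "x - y = 0"
    proof (rule principal_part_inj)
      show "coeff 0 (x - y) = x - y"
        by (simp add: blinfun.diff_right fixed[OF xy(1)] fixed[OF xy(2)])
      show "principal_part (x - y) = 0"
        using vector_space_pair.linear_diff[OF pair principal_part_linear, of x y] xy(3) by simp
    qed
    thus "x = y" by simp
  qed
  have zs: "zero_space z0 M = cspan (principal_part ` u ` {..<n})"
    unfolding zero_space_eq E by (rule vector_space_pair.linear_span_image[OF pair principal_part_linear, symmetric])
  have inj': "inj_on principal_part (cspan (u ` {..<n}))" using inj[unfolded span] unfolding E .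
  have ind: "complex_vector.independent (principal_part ` u ` {..<n})"
    by (rule vector_space_pair.linear_independent_injective_image[OF pair principal_part_linear
          orthonormal_family_dim(2)[OF u] inj'])
  have "inj_on principal_part (u ` {..<n})"
    by (rule inj_on_subset[OF inj']) (rule complex_vector.span_superset)
  hence "card (principal_part ` u ` {..<n}) = n"
    using orthonormal_family_dim(3)[OF u] by (simp add: card_image)
  hence "complex_vector.dim (zero_space z0 M) = n"
    unfolding zs complex_vector.dim_span complex_vector.dim_eq_card_independent[OF ind] .
  moreover have "cfinite_dim (zero_space z0 M)"
    unfolding zs cfinite_dim_def by (intro exI[of _ "principal_part ` u ` {..<n}"]) simp
  ultimately show ?thesis by (simp add: fun_alg_mult_def cdim_def)
qed

end

section \<open>The index as a trace\<close>

lemma trace_commutator: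
  fixes u :: "nat \<Rightarrow> 'a::complex_hilbert_space"
  assumes u: "orthonormal_family n u" and X: "bounded_clinear X" and N: "bounded_clinear N"
    and XE: "\<And>x. X x \<in> cspan (u ` {..<n})" and NE: "\<And>x. N x \<in> cspan (u ` {..<n})"
  shows "(\<Sum>i<n. cinner (u i) (X (N (u i)))) = (\<Sum>i<n. cinner (u i) (N (X (u i))))"
proof -
  have expand: "cinner (u i) (S (T (u i))) = (\<Sum>j<n. cinner (u j) (T (u i)) * cinner (u i) (S (u j)))"
    if "bounded_clinear S" "T (u i) \<in> cspan (u ` {..<n})" for S T :: "'a \<Rightarrow> 'a" and i
  proof -
    have "S (T (u i)) = S (\<Sum>j<n. cinner (u j) (T (u i)) *\<^sub>C u j)"
      using orthonormal_family_expansion[OF u that(2)] by (rule arg_cong)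
    thus ?thesis
      by (simp add: clinear_simps[OF that(1)] cinner_sum_right cinner_scaleC_right)
  qed
  have "(\<Sum>i<n. cinner (u i) (X (N (u i)))) = (\<Sum>i<n. \<Sum>j<n. cinner (u j) (N (u i)) * cinner (u i) (X (u j)))"
    by (rule sum.cong[OF refl expand[OF X NE]])
  also have "\<dots> = (\<Sum>j<n. \<Sum>i<n. cinner (u j) (N (u i)) * cinner (u i) (X (u j)))" by (rule sum.swap)
  also have "\<dots> = (\<Sum>j<n. \<Sum>i<n. cinner (u i) (X (u j)) * cinner (u j) (N (u i)))"
    by (simp add: mult.commute)
  also have "\<dots> = (\<Sum>j<n. cinner (u j) (N (X (u j))))"
    by (rule sum.cong[OF refl expand[OF N XE, symmetric]])
  finally show ?thesis .
qed

lemma clinear_funpow: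
  fixes f :: "'a::complex_normed_vector \<Rightarrow> 'a"
  shows "bounded_clinear f \<Longrightarrow> bounded_clinear (f ^^ m)"
proof (induction m)
  case 0
  show ?case using clinear_ident[where 'a = 'a] by (simp add: id_def)
next
  case (Suc m)
  show ?case using clinear_compose[OF Suc.prems Suc.IH[OF Suc.prems]] by (simp add: comp_def)
qed

context birman_schwinger_pole
begin

abbreviation R00 :: "'a \<Rightarrow> 'a" where "R00 \<equiv> R0 z0"

lemma R00_clinear: "bounded_clinear R00"
  by (rule resolvent_clinear[OF z0_H0])

text \<open>The geometric series of \<open>K(z) = K(z0) + (z - z0) K(z) R0(z0)\<close> with its remainder.\<close>

lemma K_expansion:
  assumes z: "z \<in> resolvent_set D H0"
  shows "K z x = (\<Sum>m<n. (z - z0) ^ m *\<^sub>C K z0 ((R00 ^^ m) x))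
    + (z - z0) ^ n *\<^sub>C K z ((R00 ^^ n) x)"
proof (induction n)
  case (Suc n)
  define y where "y = (R00 ^^ n) x"
  have "K z0 y - K z y = (z0 - z) *\<^sub>C K z (R00 y)"
    by (rule K_diff[OF z0_H0 z])
  also have "(z0 - z) *\<^sub>C K z (R00 y) = - ((z - z0) *\<^sub>C K z (R00 y))"
    by (simp flip: scaleC_minus_left)
  finally have "K z y = K z0 y + (z - z0) *\<^sub>C K z (R00 y)"
    by (simp add: algebra_simps)
  hence "(z - z0) ^ n *\<^sub>C K z y
      = (z - z0) ^ n *\<^sub>C K z0 y + (z - z0) ^ Suc n *\<^sub>C K z (R00 y)"
    by (simp add: scaleC_add_right mult.commute)
  thus ?case using Suc.IH by (simp add: y_def add.assoc)
qed simp

text \<open>The residue of \<open>M' M\<^sup>-\<^sup>1\<close> at \<open>z0\<close>.\<close>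

definition residue_map :: "'a \<Rightarrow> 'a" where
  "residue_map x = (\<Sum>m<p. K z0 ((R00 ^^ m) (coeff m x)))"

lemma residue_map_clinear: "bounded_clinear residue_map"
  unfolding residue_map_def[abs_def]
  by (intro clinear_sum_fun clinear_compose[OF K_clinear[OF z0_H0]]
      clinear_compose[OF clinear_funpow[OF R00_clinear]] coeff_clinear)

text \<open>The bounded operator \<open>T\<close> in the middle is a placeholder for the power of \<open>R0(z0)\<close> in the remainder
  of the expansion of \<open>K\<close>.\<close>

lemma K_RH_holomorphic:
  fixes T :: "'a \<Rightarrow>\<^sub>L 'a"
  assumes T: "bounded_clinear T"
  shows "(\<lambda>\<zeta>. cinner v (K \<zeta> (T (RH \<zeta> x)))) holomorphic_on ball z0 e0 - {z0}"
proof -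
  have op: "open (ball z0 e0 - {z0})" by (intro open_delete open_ball)
  have "\<exists>f'. ((\<lambda>\<zeta>. cinner v (K \<zeta> (T (RH \<zeta> x)))) has_field_derivative f') (at z)"
    if "z \<in> ball z0 e0 - {z0}" for z
  proof -
    have z: "z \<in> resolvent_set D H0" "z \<in> resolvent_set D H" using that ball_H0 punctured by auto
    show ?thesis
      using has_norm_derivative_clinear[OF clinear_cinner_eval
          has_norm_derivative_compose[OF K_derivative[OF z(1)]
            has_norm_derivative_clinear[OF clinear_blinfun_compose_left[OF T] has_norm_derivative_resolvent[OF lin z(2)]]
            K_clinear[OF z(1)]], of v x]
      unfolding has_norm_derivative_field blinfun_apply_blinfun_compose by blast
  qed
  thus ?thesis unfolding holomorphic_on_open[OF op] by blast
qed

text \<open>Expanding \<open>K\<close> at \<open>z0\<close> up to the order of the pole leaves a remainder that is regular there.\<close>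

lemma index_operator_eq:
  "blinfun_apply ((1 / (2 * of_real pi * \<i>)) *\<^sub>C
      vec_contour_integral (circlepath z0 e) (\<lambda>\<zeta>. vec_deriv M \<zeta> o\<^sub>L op_inverse (M \<zeta>))) x = residue_map x"
proof (rule cinner_eqI)
  fix v
  let ?I = "circle_integral"
  define Q where "Q \<zeta> = - (K \<zeta> o\<^sub>L RH \<zeta>)" for \<zeta>
  have path: "\<zeta> \<in> resolvent_set D H0" "\<zeta> \<in> resolvent_set D H" if "\<zeta> \<in> path_image (circlepath z0 e)" for \<zeta>
    using that circle_subset ball_H0 circle_resolvent by auto
  have in_path: "circlepath z0 e t \<in> path_image (circlepath z0 e)" if "t \<in> {0..1}" for t
    using that by (auto simp: path_image_def)
  have "vec_contour_integral (circlepath z0 e) (\<lambda>\<zeta>. vec_deriv M \<zeta> o\<^sub>L op_inverse (M \<zeta>))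
      = vec_contour_integral (circlepath z0 e) Q"
    unfolding vec_contour_integral_def
    by (rule integral_cong) (simp only: log_derivative[OF path[OF in_path]] Q_def)
  moreover have cont: "continuous_on (path_image (circlepath z0 e)) Q"
  proof (rule continuous_at_imp_continuous_on, rule ballI)
    fix \<zeta> assume "\<zeta> \<in> path_image (circlepath z0 e)"
    note \<zeta> = path[OF this]
    have "((\<lambda>w. K w o\<^sub>L RH w) \<longlongrightarrow> K \<zeta> o\<^sub>L RH \<zeta>) (at \<zeta>)"
      using has_norm_derivative_isCont[OF K_derivative[OF \<zeta>(1)]] isCont_resolvent[OF lin \<zeta>(2)]
      unfolding isCont_def by (rule bounded_bilinear.tendsto[OF bounded_bilinear_blinfun_compose])
    thus "isCont Q \<zeta>" unfolding isCont_def Q_def by (rule tendsto_minus)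
  qed
  ultimately have lhs: "cinner v (blinfun_apply ((1 / (2 * of_real pi * \<i>)) *\<^sub>C
      vec_contour_integral (circlepath z0 e) (\<lambda>\<zeta>. vec_deriv M \<zeta> o\<^sub>L op_inverse (M \<zeta>))) x)
      = (1 / (2 * of_real pi * \<i>)) * ?I (\<lambda>\<zeta>. cinner v (Q \<zeta> x))"
    using vec_contour_integral_functional[OF clinear_cinner_eval cont, of v x]
    by (simp only: blinfun_apply_scaleC cinner_scaleC_right)
  define T where "T = Blinfun (R00 ^^ p)"
  have T: "blinfun_apply T = R00 ^^ p" "bounded_clinear T"
    unfolding T_def by (simp_all add: blinfun_apply_Blinfun_clinear clinear_funpow R00_clinear)
  define \<Lambda> where "\<Lambda> m y = cinner v (K z0 ((R00 ^^ m) y))" for m y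
  have \<Lambda>: "bounded_clinear (\<Lambda> m)" for m
    unfolding \<Lambda>_def[abs_def]
    by (intro clinear_compose[OF clinear_cinner] clinear_compose[OF K_clinear[OF z0_H0]]
        clinear_funpow R00_clinear)
  define P where "P \<zeta> = (\<Sum>m<p. (\<zeta> - z0) ^ m * \<Lambda> m (RH \<zeta> x))" for \<zeta>
  define rem where "rem \<zeta> = (\<zeta> - z0) ^ p * cinner v (K \<zeta> (T (RH \<zeta> x)))" for \<zeta>
  have rem_hol: "rem holomorphic_on ball z0 e0 - {z0}"
    unfolding rem_def by (intro holomorphic_intros K_RH_holomorphic[OF T(2)])
  have rem0: "?I rem = 0"
  proof (rule circle_integral_removable[OF rem_hol e])
    have "\<forall>\<^sub>F z in at z0. z \<in> ball z0 (min d e0) - {z0}" using d e by (intro eventually_at_in_open) auto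
    with K_eventually_bounded[OF z0_H0]
    show "\<forall>\<^sub>F z in at z0. cmod (rem z) \<le> norm v * ((norm (K z0) + 1) * (norm T * (C * norm x)))"
    proof eventually_elim
      case (elim z)
      have zd: "z \<in> ball z0 d - {z0}" "z \<in> resolvent_set D H" using elim(2) punctured by auto
      have "cmod (rem z) \<le> cmod (z - z0) ^ p * (norm v * norm (K z (T (RH z x))))"
        unfolding rem_def norm_mult norm_power by (intro mult_left_mono cauchy_schwarz) simp
      also have "\<dots> \<le> cmod (z - z0) ^ p * (norm v * ((norm (K z0) + 1) * (norm T * norm (RH z x))))"
        by (intro mult_left_mono order_trans[OF norm_blinfun] mult_mono elim(1) norm_blinfun) auto
      also have "\<dots> = norm v * ((norm (K z0) + 1) * (norm T * (cmod (z - z0) ^ p * norm (RH z x))))"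
        by (simp add: mult_ac)
      also have "\<dots> \<le> norm v * ((norm (K z0) + 1) * (norm T * (C * norm x)))"
        by (intro mult_left_mono pole[OF zd]) auto
      finally show ?case .
    qed
  qed
  have intP: "(\<lambda>\<zeta>. (\<zeta> - z0) ^ m * \<Lambda> m (RH \<zeta> x)) contour_integrable_on circlepath z0 e" for m
    by (rule integrable_power_R[OF \<Lambda>])
  have "rem contour_integrable_on circlepath z0 e"
    by (rule contour_integrable_continuous_circlepath, rule holomorphic_on_imp_continuous_on,
        rule holomorphic_on_subset[OF rem_hol circle_subset])
  moreover have "P contour_integrable_on circlepath z0 e"
    unfolding P_def by (rule contour_integrable_sum) (use intP in auto)
  ultimately have "?I (\<lambda>\<zeta>. P \<zeta> + rem \<zeta>) = ?I P" by (simp add: contour_integral_add rem0)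
  moreover have "?I P = (\<Sum>m<p. ?I (\<lambda>\<zeta>. (\<zeta> - z0) ^ m * \<Lambda> m (RH \<zeta> x)))"
    unfolding P_def by (rule contour_integral_sum) (use intP in auto)
  moreover have "?I (\<lambda>\<zeta>. cinner v (Q \<zeta> x)) = ?I (\<lambda>\<zeta>. - 1 * (P \<zeta> + rem \<zeta>))"
  proof (rule contour_integral_eq)
    fix \<zeta> assume "\<zeta> \<in> path_image (circlepath z0 e)"
    note \<zeta> = path[OF this]
    have "cinner v (K \<zeta> (RH \<zeta> x)) = P \<zeta> + rem \<zeta>"
      by (subst K_expansion[OF \<zeta>(1), of _ p])
        (simp add: P_def rem_def \<Lambda>_def T(1) cinner_add_right cinner_sum_right cinner_scaleC_right)
    thus "cinner v (Q \<zeta> x) = - 1 * (P \<zeta> + rem \<zeta>)" by (simp add: Q_def blinfun.minus_left)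
  qed
  moreover have "?I (\<lambda>\<zeta>. - 1 * (P \<zeta> + rem \<zeta>)) = - 1 * ?I (\<lambda>\<zeta>. P \<zeta> + rem \<zeta>)"
    by (rule contour_integral_lmul, rule contour_integrable_add) fact+
  ultimately have "(1 / (2 * of_real pi * \<i>)) * ?I (\<lambda>\<zeta>. cinner v (Q \<zeta> x))
      = (- 1 / (2 * of_real pi * \<i>)) * (\<Sum>m<p. ?I (\<lambda>\<zeta>. (\<zeta> - z0) ^ m * \<Lambda> m (RH \<zeta> x)))"
    by simp
  also have "\<dots> = (\<Sum>m<p. \<Lambda> m (coeff m x))"
    unfolding sum_distrib_left coeff_functional[OF \<Lambda>] ..
  also have "\<dots> = cinner v (residue_map x)"
    by (simp add: \<Lambda>_def residue_map_def cinner_sum_right)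
  finally show "cinner v (blinfun_apply ((1 / (2 * of_real pi * \<i>)) *\<^sub>C
      vec_contour_integral (circlepath z0 e) (\<lambda>\<zeta>. vec_deriv M \<zeta> o\<^sub>L op_inverse (M \<zeta>))) x) = cinner v (residue_map x)"
    unfolding lhs .
qed

text \<open>Compressed to the range \<open>E\<close> of the Riesz projection, the residue is the identity plus a
  commutator: with \<open>W = \<Sum> R0(z0)\<^sup>m\<^sup>+\<^sup>1 coeff m\<close> it equals \<open>- V W = (H0 - z0) W - (H - z0) W\<close>, where
  \<open>(H0 - z0) W\<close> is the identity plus \<open>W\<close> after \<open>coeff 1\<close>, and the projection turns \<open>(H - z0) W\<close> into
  \<open>coeff 1\<close> after \<open>W\<close>.\<close>

lemma compressed_residue:
  defines "W \<equiv> \<lambda>x. \<Sum>m<p. (R00 ^^ Suc m) (coeff m x)"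
  assumes x: "coeff 0 x = x"
  shows "coeff 0 (residue_map x)
    = x + coeff 0 (W (coeff 1 x)) - coeff 1 (coeff 0 (W x))"
proof -
  have R00D: "R00 y \<in> D" for y by (rule resolvent_mem[OF z0_H0])
  have WD: "W x \<in> D" unfolding W_def by (rule linear_operator_sum(1)[OF H0]) (simp add: R00D)
  have "residue_map x = (\<Sum>m<p. - V ((R00 ^^ Suc m) (coeff m x)))"
    unfolding residue_map_def by (rule sum.cong) (simp_all add: K_apply[OF z0_H0])
  also have "\<dots> = - V (W x)"
    unfolding W_def sum_negf by (subst V_linear(6)) (simp_all add: R00D)
  finally have res: "residue_map x = (H0 (W x) - z0 *\<^sub>C W x) - (H (W x) - z0 *\<^sub>C W x)" by (simp add: H)
  define g where "g m = (R00 ^^ m) (coeff m x)" for m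
  have "H0 (W x) = (\<Sum>m<p. H0 ((R00 ^^ Suc m) (coeff m x)))"
    unfolding W_def by (rule linear_operator_sum(2)[OF H0]) (simp add: R00D)
  hence "H0 (W x) - z0 *\<^sub>C W x = (\<Sum>m<p. H0 (R00 (g m)) - z0 *\<^sub>C R00 (g m))"
    by (simp add: W_def g_def scaleC_sum_right sum_subtractf)
  also have "\<dots> = (\<Sum>m<p. g m)" by (simp only: resolvent_right[OF z0_H0])
  also have "\<dots> = x + (\<Sum>m<p. g (Suc m))"
  proof -
    have "g p = 0" using coeff_vanishes[of p x] by (simp add: g_def clinear_zero[OF clinear_funpow[OF R00_clinear]])
    moreover have "g 0 = x" using x by (simp add: g_def)
    ultimately show ?thesis using sum.lessThan_Suc_shift[of g p] sum.lessThan_Suc[of g p] by simp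
  qed
  also have "(\<Sum>m<p. g (Suc m)) = W (coeff 1 x)"
    unfolding W_def g_def coeff_coeff by simp
  finally have "residue_map x = x + W (coeff 1 x) - (H (W x) - z0 *\<^sub>C W x)" using res by simp
  moreover have "coeff 0 (H (W x) - z0 *\<^sub>C W x) = coeff 1 (coeff 0 (W x))"
    unfolding coeff_operator[OF WD] coeff_coeff by simp
  ultimately show ?thesis
    by (simp only: clinear_simps[OF coeff_clinear] x)
qed

text \<open>The residue factors through the projection \<open>coeff 0\<close>, so its trace is the trace of its compression to
  \<open>E\<close>; there the commutator contributes nothing and the identity contributes the dimension.\<close>

lemma op_index_eq:
  assumes sep: "separable_space (euclidean :: 'a topology)"
    and u: "orthonormal_family n u" and E: "range (coeff 0) = cspan (u ` {..<n})"
  shows "op_index z0 e M = of_nat n"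
proof -
  define W where "W x = (\<Sum>m<p. (R00 ^^ Suc m) (coeff m x))" for x
  define X where "X x = coeff 0 (W x)" for x
  have W: "bounded_clinear W" unfolding W_def[abs_def]
    by (intro clinear_sum_fun clinear_compose[OF clinear_funpow[OF R00_clinear]] coeff_clinear)
  have X: "bounded_clinear X" unfolding X_def[abs_def] by (rule clinear_compose[OF coeff_clinear W])
  have fix_u: "coeff 0 (u i) = u i" if "i < n" for i
  proof -
    have "u i \<in> range (coeff 0)" unfolding E using that by (intro complex_vector.span_base) auto
    thus ?thesis using coeff_coeff[of 0 0] by auto
  qed
  define f where "f i x = cinner (u i) (coeff 0 x)" for i x
  have rank: "residue_map x = (\<Sum>i<n. f i x *\<^sub>C residue_map (u i))" for x
  proof -
    have "residue_map x = residue_map (coeff 0 x)" by (simp add: residue_map_def coeff_coeff)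
    also have "\<dots> = residue_map (\<Sum>i<n. f i x *\<^sub>C u i)"
      unfolding f_def by (rule arg_cong[OF orthonormal_family_expansion[OF u]]) (use E in blast)
    finally show ?thesis
      by (simp add: clinear_simps[OF residue_map_clinear])
  qed
  have "op_index z0 e M = (\<Sum>i<n. f i (residue_map (u i)))"
    unfolding op_index_def
  proof (rule op_trace_finite_rank[OF sep])
    show "bounded_clinear (f i)" for i
      unfolding f_def[abs_def] by (rule clinear_compose[OF clinear_cinner coeff_clinear])
    show "blinfun_apply ((1 / (2 * of_real pi * \<i>)) *\<^sub>C
        vec_contour_integral (circlepath z0 e) (\<lambda>\<zeta>. vec_deriv M \<zeta> o\<^sub>L op_inverse (M \<zeta>))) x
      = (\<Sum>i<n. f i x *\<^sub>C residue_map (u i))" for x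
      unfolding index_operator_eq by (rule rank)
  qed simp
  also have "\<dots> = (\<Sum>i<n. 1 + cinner (u i) (X (coeff 1 (u i))) - cinner (u i) (coeff 1 (X (u i))))"
  proof (rule sum.cong)
    fix i assume i: "i \<in> {..<n}"
    have "coeff 0 (residue_map (u i)) = u i + X (coeff 1 (u i)) - coeff 1 (X (u i))"
      using compressed_residue[OF fix_u, of i] i unfolding X_def W_def by simp
    thus "f i (residue_map (u i)) = 1 + cinner (u i) (X (coeff 1 (u i))) - cinner (u i) (coeff 1 (X (u i)))"
      using i orthonormal_family_cinner[OF u, of i i] by (simp add: f_def cinner_add_right cinner_diff_right)
  qed simp
  also have "\<dots> = of_nat n"
  proof -
    have "X x \<in> cspan (u ` {..<n})" for x unfolding X_def E[symmetric] by (rule rangeI)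
    moreover have "coeff 1 x \<in> cspan (u ` {..<n})" for x
      unfolding E[symmetric] using coeff_coeff[of 0 1 x] by (metis add_0 rangeI)
    ultimately show ?thesis
      using trace_commutator[OF u X coeff_clinear[of 1]] by (simp add: sum.distrib sum_subtractf)
  qed
  finally show ?thesis .
qed

end

theorem theorem5p11:
  fixes D\<^sub>0 D\<^sub>V :: "'a::complex_hilbert_space set"
    and H\<^sub>0 V H :: "'a \<Rightarrow> 'a"
    and K :: "complex \<Rightarrow> 'a \<Rightarrow>\<^sub>L 'a"
    and z\<^sub>0 :: complex and \<epsilon>\<^sub>0 :: real
  assumes "separable_space (euclidean :: 'a topology)"
    and "closed_operator D\<^sub>0 H\<^sub>0"
    and "resolvent_set D\<^sub>0 H\<^sub>0 \<noteq> {}"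
    and "linear_operator D\<^sub>V V"
    and "D\<^sub>0 \<subseteq> D\<^sub>V"
    and H_def: "H = (\<lambda>x. H\<^sub>0 x + V x)"
    and "resolvent_set D\<^sub>0 H \<noteq> {}"
    and "\<exists>z\<in>resolvent_set D\<^sub>0 H\<^sub>0. bounded_clinear (birman_schwinger_fun D\<^sub>0 H\<^sub>0 V z)"
    and K_def: "K = birman_schwinger D\<^sub>0 H\<^sub>0 V"
    and "z\<^sub>0 \<in> resolvent_set D\<^sub>0 H\<^sub>0 \<inter> spectrum D\<^sub>0 H"
    and "\<epsilon>\<^sub>0 > 0"
    and "ball z\<^sub>0 \<epsilon>\<^sub>0 - {z\<^sub>0} \<subseteq> resolvent_set D\<^sub>0 H\<^sub>0 \<inter> resolvent_set D\<^sub>0 H"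
    and "fredholm (id_blinfun - K z\<^sub>0)"
  shows "z\<^sub>0 \<in> discrete_spectrum D\<^sub>0 H
    \<and> (\<forall>\<epsilon>. 0 < \<epsilon> \<and> \<epsilon> < \<epsilon>\<^sub>0 \<longrightarrow>
         (\<exists>n::nat. op_alg_mult D\<^sub>0 H z\<^sub>0 = enat n
           \<and> fun_alg_mult z\<^sub>0 (\<lambda>z. id_blinfun - K z) = enat n
           \<and> op_index z\<^sub>0 \<epsilon> (\<lambda>z. id_blinfun - K z) = of_nat n))"
proof -
  have H0: "linear_operator D\<^sub>0 H\<^sub>0" using assms(2) by (simp add: closed_operator_def)
  have z0: "z\<^sub>0 \<in> resolvent_set D\<^sub>0 H\<^sub>0" "z\<^sub>0 \<in> spectrum D\<^sub>0 H" using assms(10) by auto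
  have ball: "ball z\<^sub>0 \<epsilon>\<^sub>0 \<subseteq> resolvent_set D\<^sub>0 H\<^sub>0" and punct: "ball z\<^sub>0 \<epsilon>\<^sub>0 - {z\<^sub>0} \<subseteq> resolvent_set D\<^sub>0 H"
    using assms(12) z0 by auto
  have Vlin: "V (x + y) = V x + V y" "V (c *\<^sub>C x) = c *\<^sub>C V x" if "x \<in> D\<^sub>0" "y \<in> D\<^sub>0" for x y c
    by (rule linear_operatorD(5)[OF assms(4)] linear_operatorD(6)[OF assms(4)]; use assms(5) that in blast)+
  obtain z1 where z1: "z1 \<in> resolvent_set D\<^sub>0 H\<^sub>0" and K1: "bounded_clinear (birman_schwinger_fun D\<^sub>0 H\<^sub>0 V z1)"
    using assms(8) by blast
  have bs: "birman_schwinger_fun D\<^sub>0 H\<^sub>0 V z x = - V (resolvent D\<^sub>0 H\<^sub>0 z x)"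
    if "z \<in> resolvent_set D\<^sub>0 H\<^sub>0" for z x
    by (simp add: birman_schwinger_fun_def resolvent_apply[OF that])
  \<comment> \<open>Boundedness at one point spreads by \<open>K(z) = K(z1) (I + (z - z1) R0(z))\<close>.\<close>
  have Kbc: "bounded_clinear (birman_schwinger_fun D\<^sub>0 H\<^sub>0 V z)" if z: "z \<in> resolvent_set D\<^sub>0 H\<^sub>0" for z
  proof -
    have "birman_schwinger_fun D\<^sub>0 H\<^sub>0 V z
        = (\<lambda>x. birman_schwinger_fun D\<^sub>0 H\<^sub>0 V z1 (x + (z - z1) *\<^sub>C resolvent D\<^sub>0 H\<^sub>0 z x))"
      unfolding bs[OF z] bs[OF z1]
      by (rule ext)
        (subst resolvent_identity[OF z z1],
          simp add: clinear_simps[OF resolvent_clinear[OF z1]])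
    thus ?thesis
      using clinear_compose[OF K1 clinear_plus[OF clinear_ident
            clinear_scaleC_fun[OF resolvent_clinear[OF z]]]] by metis
  qed
  have Kapp: "blinfun_apply (K z) = birman_schwinger_fun D\<^sub>0 H\<^sub>0 V z" if "z \<in> resolvent_set D\<^sub>0 H\<^sub>0" for z
    unfolding K_def birman_schwinger_def by (rule blinfun_apply_Blinfun_clinear[OF Kbc[OF that]])
  interpret pair: birman_schwinger_pair D\<^sub>0 D\<^sub>V H\<^sub>0 V H K
    by unfold_locales (use H0 assms(4,5) H_def Kapp Kbc bs in auto)
  have Hlin: "linear_operator D\<^sub>0 H"
    using H0 Vlin unfolding linear_operator_def H_def by (auto simp: scaleC_add_right algebra_simps)
  let ?M = "\<lambda>z. id_blinfun - K z"
  have "\<exists>p d C. 0 < d \<and> d \<le> \<epsilon>\<^sub>0 \<and> 0 < C \<and>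
      (\<forall>z\<in>ball z\<^sub>0 d. \<forall>x. cmod (z - z\<^sub>0) ^ p * norm x \<le> C * norm (?M z x))"
    and injsurj: "inj (?M z\<^sub>0) \<Longrightarrow> surj (?M z\<^sub>0)"
    using analytic_fredholm_inverse_bound[of \<epsilon>\<^sub>0 z\<^sub>0 ?M "\<lambda>z. - (K z o\<^sub>L resolvent D\<^sub>0 H\<^sub>0 z)"]
      assms(11,13) pair.M_clinear pair.M_derivative pair.M_bij ball punct by (auto simp: subset_iff)
  then obtain p d C where "0 < d"
    "\<And>z x. z \<in> ball z\<^sub>0 d \<Longrightarrow> cmod (z - z\<^sub>0) ^ p * norm x \<le> C * norm (?M z x)" by blast
  then obtain d' C' where pole: "0 < d'" "\<And>z x. z \<in> ball z\<^sub>0 d' - {z\<^sub>0} \<Longrightarrow> z \<in> resolvent_set D\<^sub>0 H \<Longrightarrow>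
      cmod (z - z\<^sub>0) ^ p * norm (resolvent D\<^sub>0 H z x) \<le> C' * norm x"
    using pair.resolvent_pole_bound[OF z0(1)] by metis
  have loc: "birman_schwinger_pole D\<^sub>0 D\<^sub>V H\<^sub>0 V H K z\<^sub>0 \<epsilon>\<^sub>0 \<epsilon> d' C' p" if "0 < \<epsilon>" "\<epsilon> < \<epsilon>\<^sub>0" for \<epsilon>
    by unfold_locales (use Hlin punct z0 that pole ball in auto)
  have kerM: "cfinite_dim {x. ?M z\<^sub>0 x = 0}" using assms(13) by (simp add: fredholm_def)
  \<comment> \<open>\<open>R0(z0)\<close> maps the kernel of \<open>M(z0)\<close> onto the eigenspace of \<open>H\<close>.\<close>
  have ker: "cfinite_dim {x\<in>D\<^sub>0. H x = z\<^sub>0 *\<^sub>C x}"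
  proof -
    obtain B where B: "finite B" "{x. ?M z\<^sub>0 x = 0} \<subseteq> cspan B"
      using kerM by (auto simp: cfinite_dim_def)
    define Z where "Z = resolvent D\<^sub>0 H\<^sub>0 z\<^sub>0"
    have Zc: "bounded_clinear Z" unfolding Z_def by (rule resolvent_clinear[OF z0(1)])
    have Zspan: "Z y \<in> cspan (Z ` B)" if "y \<in> cspan B" for y
      using that
    proof (induction rule: complex_vector.span_induct_alt)
      case (step c x y)
      have "c *\<^sub>C Z x \<in> cspan (Z ` B)"
        by (intro complex_vector.span_scale complex_vector.span_base imageI step.hyps)
      thus ?case
        unfolding clinear_simps[OF Zc] using step.IH by (rule complex_vector.span_add)
    qed (simp add: clinear_zero[OF Zc] complex_vector.span_zero)
    have "x \<in> cspan (Z ` B)" if x: "x \<in> D\<^sub>0" "H x = z\<^sub>0 *\<^sub>C x" for x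
    proof -
      have "?M z\<^sub>0 (H\<^sub>0 x - z\<^sub>0 *\<^sub>C x) = 0" using pair.M_factor[OF z0(1) x(1)] x(2) by simp
      hence "H\<^sub>0 x - z\<^sub>0 *\<^sub>C x \<in> cspan B" using B(2) by blast
      thus ?thesis using Zspan resolvent_left[OF z0(1) x(1)] unfolding Z_def by metis
    qed
    thus ?thesis unfolding cfinite_dim_def using B(1) by (intro exI[of _ "Z ` B"]) auto
  qed
  have mult: "\<exists>n::nat. cfinite_dim (range (riesz_projection D\<^sub>0 H z\<^sub>0))
      \<and> op_alg_mult D\<^sub>0 H z\<^sub>0 = enat n \<and> fun_alg_mult z\<^sub>0 ?M = enat n \<and> op_index z\<^sub>0 \<epsilon> ?M = of_nat n"
    if \<epsilon>: "0 < \<epsilon>" "\<epsilon> < \<epsilon>\<^sub>0" for \<epsilon>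
  proof -
    interpret bsp: birman_schwinger_pole D\<^sub>0 D\<^sub>V H\<^sub>0 V H K z\<^sub>0 \<epsilon>\<^sub>0 \<epsilon> d' C' p by (rule loc[OF \<epsilon>])
    have fin: "cfinite_dim (range (bsp.coeff 0))" using bsp.cfinite_dim_range_coeff[OF ker, of p] by simp
    obtain n u where u: "orthonormal_family n u" "range (bsp.coeff 0) = cspan (u ` {..<n})"
      using cfinite_dim_orthonormal_family[OF fin bsp.subspace_range_coeff] by metis
    have "op_alg_mult D\<^sub>0 H z\<^sub>0 = enat n"
      unfolding op_alg_mult_def bsp.riesz_projection_eq cdim_def u(2) orthonormal_family_dim(1)[OF u(1)]
      using fin[unfolded u(2)] by simp
    thus ?thesis
      using fin bsp.fun_alg_mult_eq[OF u] bsp.op_index_eq[OF assms(1) u] unfolding bsp.riesz_projection_eq by blast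
  qed
  have "z\<^sub>0 \<in> discrete_spectrum D\<^sub>0 H"
    unfolding discrete_spectrum_def mem_Collect_eq
  proof (intro conjI)
    show "cfinite_dim (range (riesz_projection D\<^sub>0 H z\<^sub>0))"
      using mult[of "\<epsilon>\<^sub>0 / 2"] assms(11) by auto
    have "ball z\<^sub>0 \<epsilon>\<^sub>0 \<inter> spectrum D\<^sub>0 H = {z\<^sub>0}" using punct z0 assms(11) unfolding spectrum_def by auto
    thus "z\<^sub>0 isolated_in spectrum D\<^sub>0 H" using open_ball unfolding isolated_in_def using z0(2) by blast
    have "\<not> inj (?M z\<^sub>0)"
    proof
      assume "inj (?M z\<^sub>0)"
      hence "z\<^sub>0 \<in> resolvent_set D\<^sub>0 H"
        using pair.resolvent_set_if_M_bij[OF z0(1)] injsurj unfolding bij_def by blast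
      thus False using z0(2) by (simp add: spectrum_def)
    qed
    then obtain x y where xy: "?M z\<^sub>0 x = ?M z\<^sub>0 y" "x \<noteq> y" unfolding inj_def by blast
    define w where "w = resolvent D\<^sub>0 H\<^sub>0 z\<^sub>0 (x - y)"
    have w: "w \<in> D\<^sub>0" "H\<^sub>0 w - z\<^sub>0 *\<^sub>C w = x - y"
      unfolding w_def using resolvent_mem[OF z0(1)] resolvent_right[OF z0(1)] by auto
    have "H w - z\<^sub>0 *\<^sub>C w = 0"
      using pair.M_factor[OF z0(1) w(1)] xy(1) unfolding w(2) blinfun.diff_right by simp
    moreover have "w \<noteq> 0" using w(2) xy(2) linear_operatorD(10)[OF H0] by auto
    ultimately show "\<exists>x\<in>D\<^sub>0. x \<noteq> 0 \<and> H x = z\<^sub>0 *\<^sub>C x" using w(1) by auto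
  qed
  thus ?thesis using mult by blast
qed

end
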